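(* Let $n\ge 3$. The associated graded Lie algebra $\mathrm{gr}(I_n)$ over $\mathbb{Z}$ has a presentation (as a Lie algebra over $\mathbb{Z}$) with generators $y_{ij}$, $i\in\{2,\ldots,n\}$, $j\in\{1,\ldots,n\}$, $i\ge j$ (where the generator $y_{ij}$ corresponds to the class $y_{ij}I_n'$ in $\mathrm{gr}_1(I_n)=I_n/I_n'$), and with the following relators: (1) $[y_{mi},y_{ri}]$, $2\le r<m\le n$, $1\le i\le r$; (2) $[y_{mi},y_{rj}]$, $2\le r<i\le m\le n$, $1\le j\le r$; (3) $[y_{mi},y_{rj}]-[y_{mi},y_{mj}]$, $2\le r<m\le n$, $1\le i\le r$, $1\le j\le r$, $j\ne i$.
   Context: $F_n$ is the free group on $\{x_1,\ldots,x_n\}$. For $2\le m\le n$ and $1\le i\le m$ let $y_{mi}\in\mathrm{Aut}(F_n)$ be given by $y_{mi}(x_k)=x_i^{-1}x_kx_i$ for $k\le m$ and $y_{mi}(x_k)=x_k$ for $k>m$. $I_n$ is the subgroup of $\mathrm{Aut}(F_n)$ generated by all these $y_{mi}$. For a group $G$, $\gamma_c(G)$ is the $c$-th term of the lower central series, $G'=\gamma_2(G)$, and $\mathrm{gr}(G)=\bigoplus_{c\ge1}\gamma_c(G)/\gamma_{c+1}(G)$ is the associated graded Lie algebra over $\mathbb{Z}$, with bracket induced by the group commutator $[a,b]=a^{-1}b^{-1}ab$. *)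

theory Defs
  imports "HOL-Algebra.Algebra"
begin

section \<open>Free groups\<close>

text \<open>A letter \<open>(x, True)\<close> stands for the generator \<open>x\<close>, and \<open>(x, False)\<close> for its inverse.
  Elements of the free group are the freely reduced words.\<close>

type_synonym 'a letter = "'a \<times> bool"

definition letter_inv :: "'a letter \<Rightarrow> 'a letter" where
  "letter_inv a = (fst a, \<not> snd a)"

definition reduced :: "'a letter list \<Rightarrow> bool" where
  "reduced w \<longleftrightarrow> successively (\<lambda>a b. b \<noteq> letter_inv a) w"

fun push :: "'a letter \<Rightarrow> 'a letter list \<Rightarrow> 'a letter list" where
  "push a [] = [a]"
| "push a (b # w) = (if b = letter_inv a then w else a # b # w)"

definition free_group :: "'a set \<Rightarrow> 'a letter list monoid" where
  "free_group S =
    \<lparr>carrier = {w. reduced w \<and> fst ` set w \<subseteq> S},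
     monoid.mult = (\<lambda>u v. foldr push u v),
     one = []\<rparr>"

definition fgen :: "'a \<Rightarrow> 'a letter list" where
  "fgen x = [(x, True)]"

text \<open>The homomorphism out of a free group determined by the images of the generators.\<close>

definition free_group_ext :: "('b, 'c) monoid_scheme \<Rightarrow> ('a \<Rightarrow> 'b) \<Rightarrow> 'a letter list \<Rightarrow> 'b" where
  "free_group_ext G f w =
     foldr (\<lambda>a g. (if snd a then f (fst a) else inv\<^bsub>G\<^esub> (f (fst a))) \<otimes>\<^bsub>G\<^esub> g) w \<one>\<^bsub>G\<^esub>"

lemma letter_inv_invol [simp]: "letter_inv (letter_inv a) = a"
  by (simp add: letter_inv_def)

lemma letter_inv_neq [simp]: "letter_inv a \<noteq> a" "a \<noteq> letter_inv a"
  by (metis letter_inv_def snd_conv)+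

lemma fst_letter_inv [simp]: "fst (letter_inv a) = fst a"
  by (simp add: letter_inv_def)

lemma reduced_Nil [simp]: "reduced []"
  by (simp add: reduced_def)

lemma reduced_Cons_D: "reduced (a # w) \<Longrightarrow> reduced w"
  by (cases w) (auto simp: reduced_def)

lemma reduced_push: "reduced w \<Longrightarrow> reduced (push a w)"
  by (cases w) (auto simp: reduced_def dest: reduced_Cons_D[unfolded reduced_def])

lemma set_push: "set (push a w) \<subseteq> insert a (set w)"
  by (cases w) auto

lemma push_reduced: "reduced (a # w) \<Longrightarrow> push a w = a # w"
  by (cases w) (auto simp: reduced_def)

lemma push_push_inv: "reduced w \<Longrightarrow> push a (push (letter_inv a) w) = w"
  by (cases w) (auto simp: push_reduced)

lemma reduced_foldr_push: "reduced v \<Longrightarrow> reduced (foldr push u v)"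
  by (induction u) (auto intro: reduced_push)

lemma set_foldr_push: "set (foldr push u v) \<subseteq> set u \<union> set v"
proof (induction u)
  case (Cons a u)
  then show ?case using set_push[of a "foldr push u v"] by auto
qed simp

lemma foldr_push_push:
  "reduced w \<Longrightarrow> foldr push (push a v) w = push a (foldr push v w)"
proof (cases v)
  case (Cons b v')
  assume "reduced w"
  then show ?thesis
    using Cons push_push_inv[of "foldr push v' w" a] by (auto simp: reduced_foldr_push)
qed simp

lemma foldr_push_assoc:
  "reduced w \<Longrightarrow> foldr push (foldr push u v) w = foldr push u (foldr push v w)"
  by (induction u) (auto simp: foldr_push_push)

lemma foldr_push_Nil: "reduced w \<Longrightarrow> foldr push w [] = w"
proof (induction w)
  case (Cons a w)
  then show ?case using reduced_Cons_D[of a w] by (simp add: push_reduced)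
qed simp

lemma reduced_inverse: "reduced w \<Longrightarrow> reduced (rev (map letter_inv w))"
  by (fastforce simp: reduced_def successively_map elim: successively_mono)

lemma foldr_push_inverse: "foldr push (rev (map letter_inv w)) w = []"
proof (induction w)
  case (Cons a w)
  then show ?case by (simp add: foldr_append)
qed simp

lemma free_group_group: "group (free_group S)"
proof (rule groupI)
  fix u v w
  assume u: "u \<in> carrier (free_group S)" and v: "v \<in> carrier (free_group S)"
    and w: "w \<in> carrier (free_group S)"
  show "u \<otimes>\<^bsub>free_group S\<^esub> v \<in> carrier (free_group S)"
    using u v set_foldr_push[of u v]
    by (simp add: free_group_def reduced_foldr_push) (blast dest: subsetD)
  show "u \<otimes>\<^bsub>free_group S\<^esub> v \<otimes>\<^bsub>free_group S\<^esub> w = u \<otimes>\<^bsub>free_group S\<^esub> (v \<otimes>\<^bsub>free_group S\<^esub> w)"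
    using w by (simp add: free_group_def foldr_push_assoc)
next
  fix u assume u: "u \<in> carrier (free_group S)"
  show "\<exists>v\<in>carrier (free_group S). v \<otimes>\<^bsub>free_group S\<^esub> u = \<one>\<^bsub>free_group S\<^esub>"
    using u by (intro bexI[of _ "rev (map letter_inv u)"])
      (auto simp: free_group_def foldr_push_inverse reduced_inverse image_image)
qed (auto simp: free_group_def)

lemma fgen_carrier: "x \<in> S \<Longrightarrow> fgen x \<in> carrier (free_group S)"
  by (simp add: fgen_def free_group_def reduced_def)

context group
begin

lemma free_group_ext_closed:
  assumes "f \<in> S \<rightarrow> carrier G" "fst ` set w \<subseteq> S"
  shows "free_group_ext G f w \<in> carrier G"
  using assms by (induction w) (auto simp: free_group_ext_def Pi_iff)

lemma free_group_ext_push: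
  assumes "f \<in> S \<rightarrow> carrier G" "fst ` set w \<subseteq> S" "fst a \<in> S"
  shows "free_group_ext G f (push a w) =
    (if snd a then f (fst a) else inv (f (fst a))) \<otimes> free_group_ext G f w"
proof (cases w)
  case (Cons b w')
  have "free_group_ext G f w' \<in> carrier G" "f (fst a) \<in> carrier G"
    using assms Cons free_group_ext_closed[OF assms(1), of w'] by auto
  then show ?thesis
    using Cons by (auto simp: free_group_ext_def letter_inv_def m_assoc[symmetric])
qed (simp add: free_group_ext_def)

lemma free_group_ext_hom:
  assumes "f \<in> S \<rightarrow> carrier G"
  shows "free_group_ext G f \<in> hom (free_group S) G"
proof (rule homI)
  fix u v assume u: "u \<in> carrier (free_group S)" and v: "v \<in> carrier (free_group S)"
  show "free_group_ext G f u \<in> carrier G"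
    using u assms by (simp add: free_group_ext_closed free_group_def)
  have "fst ` set u \<subseteq> S \<Longrightarrow> free_group_ext G f (foldr push u v) =
      free_group_ext G f u \<otimes> free_group_ext G f v"
  proof (induction u)
    case Nil
    then show ?case
      using v assms by (simp add: free_group_ext_def free_group_ext_closed[unfolded free_group_ext_def] free_group_def)
  next
    case (Cons a u)
    have c: "free_group_ext G f u \<in> carrier G" "free_group_ext G f v \<in> carrier G"
      "f (fst a) \<in> carrier G"
      using Cons.prems v assms free_group_ext_closed[OF assms, of u]
        free_group_ext_closed[OF assms, of v] by (auto simp: free_group_def)
    have "fst ` set (foldr push u v) \<subseteq> S"
      using Cons.prems v set_foldr_push[of u v]
      by (simp add: free_group_def) (blast dest: subsetD)
    then have "free_group_ext G f (push a (foldr push u v)) =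
      (if snd a then f (fst a) else inv (f (fst a))) \<otimes> free_group_ext G f (foldr push u v)"
      using Cons.prems by (intro free_group_ext_push[OF assms]) auto
    moreover have "free_group_ext G f (a # u) =
      (if snd a then f (fst a) else inv (f (fst a))) \<otimes> free_group_ext G f u"
      by (simp add: free_group_ext_def)
    ultimately show ?case
      using Cons c by (simp add: m_assoc)
  qed
  then show "free_group_ext G f (u \<otimes>\<^bsub>free_group S\<^esub> v) = free_group_ext G f u \<otimes> free_group_ext G f v"
    using u by (simp add: free_group_def)
qed

lemma free_group_ext_fgen: "f x \<in> carrier G \<Longrightarrow> free_group_ext G f (fgen x) = f x"
  by (simp add: free_group_ext_def fgen_def)

lemma inv_fgen: "x \<in> S \<Longrightarrow> inv\<^bsub>free_group S\<^esub> (fgen x) = [(x, False)]"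
  by (rule group.inv_equality[OF free_group_group])
    (auto simp: free_group_def fgen_def reduced_def letter_inv_def)

lemma free_group_hom_eqI:
  assumes "h \<in> hom (free_group S) G" "k \<in> hom (free_group S) G"
    and "\<And>x. x \<in> S \<Longrightarrow> h (fgen x) = k (fgen x)" and "w \<in> carrier (free_group S)"
  shows "h w = k w"
  using assms(4)
proof (induction w)
  interpret F: group "free_group S" by (rule free_group_group)
  interpret h: group_hom "free_group S" G h by unfold_locales (rule assms(1))
  interpret k: group_hom "free_group S" G k by unfold_locales (rule assms(2))
  {
    case Nil
    have "[] = \<one>\<^bsub>free_group S\<^esub>" by (simp add: free_group_def)
    then show ?case by (metis h.hom_one k.hom_one)
  next
    case (Cons a w)
    have w: "w \<in> carrier (free_group S)"
      using Cons.prems reduced_Cons_D[of a w] by (auto simp: free_group_def)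
    have a: "fst a \<in> S" and red: "reduced (a # w)"
      using Cons.prems by (auto simp: free_group_def)
    have s: "[a] = (if snd a then fgen (fst a) else inv\<^bsub>free_group S\<^esub> (fgen (fst a)))"
      using a inv_fgen[OF a] by (cases a) (auto simp: fgen_def)
    have "h [a] = k [a]"
      unfolding s using assms(3)[OF a] fgen_carrier[OF a] by simp
    moreover have "a # w = [a] \<otimes>\<^bsub>free_group S\<^esub> w"
      using red by (simp add: free_group_def push_reduced)
    moreover have "[a] \<in> carrier (free_group S)"
      using a by (simp add: free_group_def reduced_def)
    ultimately show ?case
      using Cons.IH[OF w] w by simp
  }
qed

end


section \<open>The automorphisms and the group they generate\<close>

abbreviation Fn :: "nat \<Rightarrow> nat letter list monoid" where
  "Fn n \<equiv> free_group {1..n}"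

definition yaut :: "nat \<Rightarrow> nat \<Rightarrow> nat \<Rightarrow> nat letter list \<Rightarrow> nat letter list" where
  "yaut n m i = restrict
     (free_group_ext (Fn n)
       (\<lambda>k. if k \<le> m then inv\<^bsub>Fn n\<^esub> (fgen i) \<otimes>\<^bsub>Fn n\<^esub> fgen k \<otimes>\<^bsub>Fn n\<^esub> fgen i else fgen k))
     (carrier (Fn n))"

text \<open>Products in \<open>AutoGroup\<close> are compositions with the right factor applied first.\<close>

definition I_group :: "nat \<Rightarrow> (nat letter list \<Rightarrow> nat letter list) monoid" where
  "I_group n = subgroup_generated (AutoGroup (Fn n))
     {yaut n m i | m i. 2 \<le> m \<and> m \<le> n \<and> 1 \<le> i \<and> i \<le> m}"

lemma yaut_fgen:
  assumes "k \<in> {1..n}" "i \<in> {1..n}"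
  shows "yaut n m i (fgen k) =
    (if k \<le> m then inv\<^bsub>Fn n\<^esub> (fgen i) \<otimes>\<^bsub>Fn n\<^esub> fgen k \<otimes>\<^bsub>Fn n\<^esub> fgen i else fgen k)"
proof -
  note One_nat_def [simp del]
  interpret F: group "Fn n" by (rule free_group_group)
  show ?thesis
    using assms by (simp add: yaut_def fgen_carrier F.free_group_ext_fgen)
qed

lemma yaut_auto:
  assumes "1 \<le> i" "i \<le> m" "m \<le> n"
  shows "yaut n m i \<in> auto (Fn n)"
proof -
  note One_nat_def [simp del]
  interpret F: group "Fn n" by (rule free_group_group)
  let ?f = "\<lambda>k. if k \<le> m then inv\<^bsub>Fn n\<^esub> (fgen i) \<otimes>\<^bsub>Fn n\<^esub> fgen k \<otimes>\<^bsub>Fn n\<^esub> fgen i else fgen k"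
  let ?g = "\<lambda>k. if k \<le> m then fgen i \<otimes>\<^bsub>Fn n\<^esub> fgen k \<otimes>\<^bsub>Fn n\<^esub> inv\<^bsub>Fn n\<^esub> (fgen i) else fgen k"
  let ?F = "free_group_ext (Fn n) ?f" and ?G = "free_group_ext (Fn n) ?g"
  have i: "fgen i \<in> carrier (Fn n)" using assms by (intro fgen_carrier) auto
  have f: "?f \<in> {1..n} \<rightarrow> carrier (Fn n)" and g: "?g \<in> {1..n} \<rightarrow> carrier (Fn n)"
    using i fgen_carrier[of _ "{1..n}"] by auto
  interpret f: group_hom "Fn n" "Fn n" ?F
    by unfold_locales (rule F.free_group_ext_hom[OF f])
  interpret g: group_hom "Fn n" "Fn n" ?G
    by unfold_locales (rule F.free_group_ext_hom[OF g])
  have Ff: "?F (fgen k) = ?f k" if "k \<in> {1..n}" for k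
    by (rule F.free_group_ext_fgen) (rule funcset_mem[OF f that])
  have Gg: "?G (fgen k) = ?g k" if "k \<in> {1..n}" for k
    by (rule F.free_group_ext_fgen) (rule funcset_mem[OF g that])
  have Ffi: "?F (fgen i) = fgen i" and Ggi: "?G (fgen i) = fgen i"
    using Ff[of i] Gg[of i] assms i by (simp_all add: F.m_assoc)
  have cancel: "inv\<^bsub>Fn n\<^esub> (fgen i) \<otimes>\<^bsub>Fn n\<^esub> (fgen i \<otimes>\<^bsub>Fn n\<^esub> z) = z"
    "fgen i \<otimes>\<^bsub>Fn n\<^esub> (inv\<^bsub>Fn n\<^esub> (fgen i) \<otimes>\<^bsub>Fn n\<^esub> z) = z" if "z \<in> carrier (Fn n)" for z
    using i that by (simp_all add: F.m_assoc[symmetric])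
  have GF: "?G (?F w) = w" if "w \<in> carrier (Fn n)" for w
  proof -
    have "(?G \<circ> ?F) w = id w"
    proof (rule F.free_group_hom_eqI[OF _ _ _ that])
      show "?G \<circ> ?F \<in> hom (Fn n) (Fn n)" by (rule hom_compose[OF f.homh g.homh])
      fix x assume x: "x \<in> {1..n}"
      have xc: "fgen x \<in> carrier (Fn n)" using x by (rule fgen_carrier)
      have "?G (?f x) = fgen x"
        using i xc Gg[OF x] Ggi by (simp add: F.m_assoc cancel)
      then show "(?G \<circ> ?F) (fgen x) = id (fgen x)" using Ff[OF x] by simp
    qed (simp add: hom_def)
    then show ?thesis by simp
  qed
  have FG: "?F (?G w) = w" if "w \<in> carrier (Fn n)" for w
  proof -
    have "(?F \<circ> ?G) w = id w"
    proof (rule F.free_group_hom_eqI[OF _ _ _ that])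
      show "?F \<circ> ?G \<in> hom (Fn n) (Fn n)" by (rule hom_compose[OF g.homh f.homh])
      fix x assume x: "x \<in> {1..n}"
      have xc: "fgen x \<in> carrier (Fn n)" using x by (rule fgen_carrier)
      have "?F (?g x) = fgen x"
        using i xc Ff[OF x] Ffi by (simp add: F.m_assoc cancel)
      then show "(?F \<circ> ?G) (fgen x) = id (fgen x)" using Gg[OF x] by simp
    qed (simp add: hom_def)
    then show ?thesis by simp
  qed
  have "bij_betw ?F (carrier (Fn n)) (carrier (Fn n))"
    by (rule bij_betw_byWitness[where f' = ?G]) (use GF FG in auto)
  moreover have "yaut n m i \<in> hom (Fn n) (Fn n)"
    by (auto simp: yaut_def hom_def f.hom_mult)
  ultimately show ?thesis
    unfolding auto_def Bij_def
    by (auto simp: yaut_def cong: bij_betw_cong)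
qed


section \<open>The associated graded Lie ring of a group\<close>

text \<open>A Lie algebra over the integers is an abelian group with a biadditive alternating bracket
  satisfying the Jacobi identity.  The additive group is represented by a \<open>monoid\<close>
  record, as for \<open>free_Abelian_group\<close> and \<open>sum_group\<close>, so \<open>\<otimes>\<close>, \<open>\<one>\<close> and \<open>inv\<close> are its addition, zero and negation.\<close>

record 'a lie_ring = "'a monoid" +
  bracket :: "'a \<Rightarrow> 'a \<Rightarrow> 'a"

locale lie_ring = comm_group L for L :: "('a, 'm) lie_ring_scheme" (structure) +
  assumes bracket_closed:
      "\<lbrakk>x \<in> carrier L; y \<in> carrier L\<rbrakk> \<Longrightarrow> bracket L x y \<in> carrier L"
    and bracket_add_left:
      "\<lbrakk>x \<in> carrier L; y \<in> carrier L; z \<in> carrier L\<rbrakk>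
        \<Longrightarrow> bracket L (x \<otimes> y) z = bracket L x z \<otimes> bracket L y z"
    and bracket_add_right:
      "\<lbrakk>x \<in> carrier L; y \<in> carrier L; z \<in> carrier L\<rbrakk>
        \<Longrightarrow> bracket L x (y \<otimes> z) = bracket L x y \<otimes> bracket L x z"
    and bracket_self: "x \<in> carrier L \<Longrightarrow> bracket L x x = \<one>"
    and jacobi:
      "\<lbrakk>x \<in> carrier L; y \<in> carrier L; z \<in> carrier L\<rbrakk>
        \<Longrightarrow> bracket L x (bracket L y z) \<otimes> bracket L y (bracket L z x)
              \<otimes> bracket L z (bracket L x y) = \<one>"

definition commutator :: "('a, 'b) monoid_scheme \<Rightarrow> 'a \<Rightarrow> 'a \<Rightarrow> 'a" where
  "commutator G a b = inv\<^bsub>G\<^esub> a \<otimes>\<^bsub>G\<^esub> inv\<^bsub>G\<^esub> b \<otimes>\<^bsub>G\<^esub> a \<otimes>\<^bsub>G\<^esub> b"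

text \<open>The series is indexed from 1; the value at 0 is a dummy.\<close>

fun lower_central :: "('a, 'b) monoid_scheme \<Rightarrow> nat \<Rightarrow> 'a set" where
  "lower_central G 0 = carrier G"
| "lower_central G (Suc 0) = carrier G"
| "lower_central G (Suc (Suc c)) =
     generate G {commutator G a b | a b. a \<in> lower_central G (Suc c) \<and> b \<in> carrier G}"

definition gr_part :: "('a, 'b) monoid_scheme \<Rightarrow> nat \<Rightarrow> 'a set monoid" where
  "gr_part G c = (G\<lparr>carrier := lower_central G c\<rparr>) Mod (lower_central G (Suc c))"

text \<open>The bracket of the cosets of \<open>a\<close> (degree \<open>p\<close>) and \<open>b\<close> (degree \<open>q\<close>) is the coset of the
  commutator; the union is over all choices of representatives, which all give the same coset.\<close>

definition gr_part_bracket ::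
    "('a, 'b) monoid_scheme \<Rightarrow> nat \<Rightarrow> nat \<Rightarrow> 'a set \<Rightarrow> 'a set \<Rightarrow> 'a set" where
  "gr_part_bracket G p q A B =
     (\<Union>a\<in>A. \<Union>b\<in>B. lower_central G (Suc (p + q)) #>\<^bsub>G\<^esub> commutator G a b)"

definition gr :: "('a, 'b) monoid_scheme \<Rightarrow> (nat \<Rightarrow> 'a set) lie_ring" where
  "gr G =
    \<lparr>carrier = carrier (sum_group {1..} (gr_part G)),
     monoid.mult = monoid.mult (sum_group {1..} (gr_part G)),
     one = one (sum_group {1..} (gr_part G)),
     bracket = (\<lambda>x y. \<lambda>c\<in>{1..}.
       finprod (gr_part G c) (\<lambda>p. gr_part_bracket G p (c - p) (x p) (y (c - p))) {1..<c})\<rparr>"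

text \<open>The class of \<open>a\<close>, an element of the \<open>c\<close>-th term of the series, in the summand of degree
  \<open>c\<close>.\<close>

definition gr_class :: "('a, 'b) monoid_scheme \<Rightarrow> nat \<Rightarrow> 'a \<Rightarrow> nat \<Rightarrow> 'a set" where
  "gr_class G c a =
     (\<lambda>d\<in>{1..}. if d = c then lower_central G (Suc c) #>\<^bsub>G\<^esub> a else \<one>\<^bsub>gr_part G d\<^esub>)"


section \<open>Free Lie rings and presentations\<close>

text \<open>The free Lie ring on \<open>S\<close> consists of the formal Lie expressions in \<open>S\<close> modulo the
  consequences of the Lie ring axioms.\<close>

datatype (lie_term_gens: 'x) lie_term =
    LGen 'x
  | LZero
  | LNeg "'x lie_term"
  | LAdd "'x lie_term" "'x lie_term"
  | LBr "'x lie_term" "'x lie_term"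

inductive lie_eq :: "'x lie_term \<Rightarrow> 'x lie_term \<Rightarrow> bool" where
  refl: "lie_eq s s"
| sym: "lie_eq s t \<Longrightarrow> lie_eq t s"
| trans: "lie_eq s t \<Longrightarrow> lie_eq t u \<Longrightarrow> lie_eq s u"
| neg_cong: "lie_eq s s' \<Longrightarrow> lie_eq (LNeg s) (LNeg s')"
| add_cong: "lie_eq s s' \<Longrightarrow> lie_eq t t' \<Longrightarrow> lie_eq (LAdd s t) (LAdd s' t')"
| br_cong: "lie_eq s s' \<Longrightarrow> lie_eq t t' \<Longrightarrow> lie_eq (LBr s t) (LBr s' t')"
| add_assoc: "lie_eq (LAdd (LAdd s t) u) (LAdd s (LAdd t u))"
| add_comm: "lie_eq (LAdd s t) (LAdd t s)"
| add_zero: "lie_eq (LAdd LZero s) s"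
| add_neg: "lie_eq (LAdd (LNeg s) s) LZero"
| br_add_left: "lie_eq (LBr (LAdd s t) u) (LAdd (LBr s u) (LBr t u))"
| br_add_right: "lie_eq (LBr s (LAdd t u)) (LAdd (LBr s t) (LBr s u))"
| br_self: "lie_eq (LBr s s) LZero"
| jacobi: "lie_eq (LAdd (LAdd (LBr s (LBr t u)) (LBr t (LBr u s))) (LBr u (LBr s t))) LZero"

definition lie_terms :: "'x set \<Rightarrow> 'x lie_term set" where
  "lie_terms S = {t. lie_term_gens t \<subseteq> S}"

definition lie_rel :: "'x set \<Rightarrow> ('x lie_term \<times> 'x lie_term) set" where
  "lie_rel S = {(s, t). s \<in> lie_terms S \<and> t \<in> lie_terms S \<and> lie_eq s t}"

definition free_lie :: "'x set \<Rightarrow> 'x lie_term set lie_ring" where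
  "free_lie S =
    \<lparr>carrier = lie_terms S // lie_rel S,
     monoid.mult = (\<lambda>A B. \<Union>a\<in>A. \<Union>b\<in>B. lie_rel S `` {LAdd a b}),
     one = lie_rel S `` {LZero},
     bracket = (\<lambda>A B. \<Union>a\<in>A. \<Union>b\<in>B. lie_rel S `` {LBr a b})\<rparr>"

definition lie_gen :: "'x set \<Rightarrow> 'x \<Rightarrow> 'x lie_term set" where
  "lie_gen S x = lie_rel S `` {LGen x}"

definition lie_hom :: "('a, 'c) lie_ring_scheme \<Rightarrow> ('b, 'd) lie_ring_scheme \<Rightarrow> ('a \<Rightarrow> 'b) set" where
  "lie_hom L M = {h \<in> hom L M.
     \<forall>x\<in>carrier L. \<forall>y\<in>carrier L. h (bracket L x y) = bracket M (h x) (h y)}"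

definition lie_ideal :: "'a set \<Rightarrow> ('a, 'c) lie_ring_scheme \<Rightarrow> bool" where
  "lie_ideal I L \<longleftrightarrow> subgroup I L \<and> (\<forall>x\<in>carrier L. \<forall>a\<in>I. bracket L x a \<in> I)"

definition gen_lie_ideal :: "('a, 'c) lie_ring_scheme \<Rightarrow> 'a set \<Rightarrow> 'a set" where
  "gen_lie_ideal L R = \<Inter>{I. lie_ideal I L \<and> R \<subseteq> I}"

text \<open>\<open>L\<close> is presented by the generators \<open>S\<close> and relators \<open>R\<close>, a set of elements of the free
  Lie ring on \<open>S\<close>, where \<open>g x\<close> is the element of \<open>L\<close> to which the generator \<open>x\<close> corresponds.\<close>

definition lie_presentation ::
    "('a, 'c) lie_ring_scheme \<Rightarrow> 'x set \<Rightarrow> ('x \<Rightarrow> 'a) \<Rightarrow> 'x lie_term set set \<Rightarrow> bool" where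
  "lie_presentation L S g R \<longleftrightarrow>
     lie_ring L \<and> g \<in> S \<rightarrow> carrier L \<and> R \<subseteq> carrier (free_lie S) \<and>
     (\<exists>h \<in> lie_hom (free_lie S) L.
        (\<forall>x\<in>S. h (lie_gen S x) = g x) \<and>
        h ` carrier (free_lie S) = carrier L \<and>
        kernel (free_lie S) L h = gen_lie_ideal (free_lie S) R)"

lemma equiv_lie_rel: "equiv (lie_terms S) (lie_rel S)"
  by (auto simp: equiv_def refl_on_def sym_def trans_def lie_rel_def
      intro: lie_eq.refl lie_eq.sym lie_eq.trans)

lemma lie_terms_simps [simp]:
  "LGen x \<in> lie_terms S \<longleftrightarrow> x \<in> S" "LZero \<in> lie_terms S"
  "LNeg s \<in> lie_terms S \<longleftrightarrow> s \<in> lie_terms S"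
  "LAdd s t \<in> lie_terms S \<longleftrightarrow> s \<in> lie_terms S \<and> t \<in> lie_terms S"
  "LBr s t \<in> lie_terms S \<longleftrightarrow> s \<in> lie_terms S \<and> t \<in> lie_terms S"
  by (auto simp: lie_terms_def)

lemma lie_class_eqI:
  "\<lbrakk>lie_eq s t; s \<in> lie_terms S; t \<in> lie_terms S\<rbrakk> \<Longrightarrow> lie_rel S `` {s} = lie_rel S `` {t}"
  by (rule equiv_class_eq[OF equiv_lie_rel]) (simp add: lie_rel_def)

lemma lie_class_eq_iff:
  "\<lbrakk>s \<in> lie_terms S; t \<in> lie_terms S\<rbrakk> \<Longrightarrow> lie_rel S `` {s} = lie_rel S `` {t} \<longleftrightarrow> lie_eq s t"
  by (subst eq_equiv_class_iff[OF equiv_lie_rel]) (auto simp: lie_rel_def)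

lemma free_lie_carrier: "carrier (free_lie S) = {lie_rel S `` {t} | t. t \<in> lie_terms S}"
  by (auto simp: free_lie_def quotient_def)

lemma free_lie_add:
  assumes "s \<in> lie_terms S" "t \<in> lie_terms S"
  shows "lie_rel S `` {s} \<otimes>\<^bsub>free_lie S\<^esub> lie_rel S `` {t} = lie_rel S `` {LAdd s t}"
proof -
  have "congruent2 (lie_rel S) (lie_rel S) (\<lambda>a b. lie_rel S `` {LAdd a b})"
    by (rule congruent2I', rule lie_class_eqI) (auto simp: lie_rel_def intro: lie_eq.add_cong)
  from UN_equiv_class2[OF equiv_lie_rel equiv_lie_rel this assms]
  show ?thesis by (simp add: free_lie_def)
qed

lemma free_lie_bracket:
  assumes "s \<in> lie_terms S" "t \<in> lie_terms S"
  shows "bracket (free_lie S) (lie_rel S `` {s}) (lie_rel S `` {t}) = lie_rel S `` {LBr s t}"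
proof -
  have "congruent2 (lie_rel S) (lie_rel S) (\<lambda>a b. lie_rel S `` {LBr a b})"
    by (rule congruent2I', rule lie_class_eqI) (auto simp: lie_rel_def intro: lie_eq.br_cong)
  from UN_equiv_class2[OF equiv_lie_rel equiv_lie_rel this assms]
  show ?thesis by (simp add: free_lie_def)
qed

lemma free_lie_zero: "\<one>\<^bsub>free_lie S\<^esub> = lie_rel S `` {LZero}"
  by (simp add: free_lie_def)

lemma free_lie_class_carrier: "t \<in> lie_terms S \<Longrightarrow> lie_rel S `` {t} \<in> carrier (free_lie S)"
  by (auto simp: free_lie_carrier)

lemma free_lie_carrierE:
  assumes "x \<in> carrier (free_lie S)"
  obtains t where "t \<in> lie_terms S" "x = lie_rel S `` {t}"
  using assms by (auto simp: free_lie_carrier)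

lemma free_lie_lie_ring: "lie_ring (free_lie S)"
proof (rule lie_ring.intro)
  note simps = free_lie_add free_lie_bracket free_lie_zero free_lie_class_carrier
    lie_class_eq_iff lie_eq.add_assoc lie_eq.add_comm lie_eq.add_zero lie_eq.add_neg
    lie_eq.br_add_left lie_eq.br_add_right lie_eq.br_self lie_eq.jacobi
  show "comm_group (free_lie S)"
  proof (rule comm_groupI)
    fix x assume "x \<in> carrier (free_lie S)"
    then obtain t where t: "t \<in> lie_terms S" "x = lie_rel S `` {t}"
      by (rule free_lie_carrierE)
    then show "\<exists>y\<in>carrier (free_lie S). y \<otimes>\<^bsub>free_lie S\<^esub> x = \<one>\<^bsub>free_lie S\<^esub>"
      by (intro bexI[of _ "lie_rel S `` {LNeg t}"])
        (simp_all add: simps)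
  qed (((elim free_lie_carrierE)?, simp add: simps)+)
  show "lie_ring_axioms (free_lie S)"
    by unfold_locales (elim free_lie_carrierE, simp add: simps)+
qed

lemma free_lie_neg:
  assumes "t \<in> lie_terms S"
  shows "inv\<^bsub>free_lie S\<^esub> (lie_rel S `` {t}) = lie_rel S `` {LNeg t}"
proof -
  interpret lie_ring "free_lie S" by (rule free_lie_lie_ring)
  show ?thesis
    by (rule inv_equality)
      (use assms in \<open>simp_all add: free_lie_add free_lie_zero free_lie_class_carrier
        lie_class_eqI lie_eq.add_neg\<close>)
qed

lemma lie_gen_carrier: "x \<in> S \<Longrightarrow> lie_gen S x \<in> carrier (free_lie S)"
  by (auto simp: lie_gen_def free_lie_carrier intro!: exI[of _ "LGen x"])

fun lie_eval :: "('a, 'c) lie_ring_scheme \<Rightarrow> ('x \<Rightarrow> 'a) \<Rightarrow> 'x lie_term \<Rightarrow> 'a" where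
  "lie_eval L g (LGen x) = g x"
| "lie_eval L g LZero = \<one>\<^bsub>L\<^esub>"
| "lie_eval L g (LNeg s) = inv\<^bsub>L\<^esub> (lie_eval L g s)"
| "lie_eval L g (LAdd s t) = lie_eval L g s \<otimes>\<^bsub>L\<^esub> lie_eval L g t"
| "lie_eval L g (LBr s t) = bracket L (lie_eval L g s) (lie_eval L g t)"

context lie_ring
begin

lemma lie_eval_closed: "(\<And>x. g x \<in> carrier L) \<Longrightarrow> lie_eval L g t \<in> carrier L"
  by (induction t) (auto intro: bracket_closed)

lemma lie_eval_eq:
  assumes "lie_eq s t" "\<And>x. g x \<in> carrier L"
  shows "lie_eval L g s = lie_eval L g t"
  using assms(1)
proof (induction rule: lie_eq.induct)
  case (add_assoc s t u)
  then show ?case by (simp add: m_assoc lie_eval_closed[OF assms(2)])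
next
  case (add_comm s t)
  then show ?case by (simp add: m_comm lie_eval_closed[OF assms(2)])
qed (simp_all add: lie_eval_closed[OF assms(2)] bracket_add_left bracket_add_right
  bracket_self jacobi)

theorem free_lie_universal:
  assumes g: "g \<in> S \<rightarrow> carrier L"
  shows "\<exists>!h. h \<in> lie_hom (free_lie S) L \<and> h \<in> extensional (carrier (free_lie S)) \<and>
    (\<forall>x\<in>S. h (lie_gen S x) = g x)"
proof -
  interpret F: lie_ring "free_lie S" by (rule free_lie_lie_ring)
  define g' where "g' x = (if x \<in> S then g x else \<one>)" for x
  have g': "g' x \<in> carrier L" for x using g by (auto simp: g'_def)
  note cl = lie_eval_closed[of g', OF g']
  define h where "h = (\<lambda>A\<in>carrier (free_lie S). the_elem (lie_eval L g' ` A))"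
  have h: "h (lie_rel S `` {t}) = lie_eval L g' t" if "t \<in> lie_terms S" for t
  proof -
    have "lie_eval L g' ` (lie_rel S `` {t}) = {lie_eval L g' t}"
      using that lie_eval_eq[of _ _ g', OF _ g'] by (auto simp: lie_rel_def intro: lie_eq.refl image_eqI[of _ _ t])
    then show ?thesis using that by (simp add: h_def free_lie_class_carrier)
  qed
  have uniq: "k (lie_rel S `` {t}) = lie_eval L g' t"
    if k: "k \<in> lie_hom (free_lie S) L" "\<forall>x\<in>S. k (lie_gen S x) = g x"
      and t: "t \<in> lie_terms S" for k t
  proof -
    interpret k: group_hom "free_lie S" L k
      by unfold_locales (use k in \<open>simp add: lie_hom_def\<close>)
    have br: "k (bracket (free_lie S) x y) = bracket L (k x) (k y)"
      if "x \<in> carrier (free_lie S)" "y \<in> carrier (free_lie S)" for x y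
      using that k by (simp add: lie_hom_def)
    show ?thesis
      using t
    proof (induction t)
      case (LGen x)
      then show ?case using k(2) by (simp add: lie_gen_def g'_def)
    next
      case LZero
      then show ?case using k.hom_one by (simp add: free_lie_zero)
    next
      case (LNeg t)
      then show ?case using k.hom_inv[OF free_lie_class_carrier, of t] by (simp add: free_lie_neg)
    next
      case (LAdd s t)
      then show ?case
        using k.hom_mult[OF free_lie_class_carrier free_lie_class_carrier, of s t]
        by (simp add: free_lie_add)
    next
      case (LBr s t)
      then show ?case
        using br[OF free_lie_class_carrier free_lie_class_carrier, of s t]
        by (simp add: free_lie_bracket)
    qed
  qed
  show ?thesis
  proof (rule ex1I[of _ h], intro conjI ballI)
    show "h \<in> lie_hom (free_lie S) L"
      by (auto simp: lie_hom_def h cl free_lie_add free_lie_bracket elim!: free_lie_carrierE intro!: homI)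
    show "h \<in> extensional (carrier (free_lie S))" by (simp add: h_def)
    show "h (lie_gen S x) = g x" if "x \<in> S" for x
      using that by (simp add: lie_gen_def h g'_def)
  next
    fix k assume k: "k \<in> lie_hom (free_lie S) L \<and> k \<in> extensional (carrier (free_lie S)) \<and>
      (\<forall>x\<in>S. k (lie_gen S x) = g x)"
    show "k = h"
    proof (rule extensionalityI)
      fix x assume "x \<in> carrier (free_lie S)"
      then obtain t where "t \<in> lie_terms S" "x = lie_rel S `` {t}" by (rule free_lie_carrierE)
      then show "k x = h x" using uniq[of k t] k h by simp
    qed (use k in \<open>auto simp: h_def\<close>)
  qed
qed

end


section \<open>The relators\<close>

definition ygens :: "nat \<Rightarrow> (nat \<times> nat) set" where
  "ygens n = {(i, j). 2 \<le> i \<and> i \<le> n \<and> 1 \<le> j \<and> j \<le> i}"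

definition yrelators :: "nat \<Rightarrow> (nat \<times> nat) lie_term set set" where
  "yrelators n =
    (let F = free_lie (ygens n); y = (\<lambda>i j. lie_gen (ygens n) (i, j)) in
      {bracket F (y m i) (y r i) | m r i.
         2 \<le> r \<and> r < m \<and> m \<le> n \<and> 1 \<le> i \<and> i \<le> r} \<union>
      {bracket F (y m i) (y r j) | m r i j.
         2 \<le> r \<and> r < i \<and> i \<le> m \<and> m \<le> n \<and> 1 \<le> j \<and> j \<le> r} \<union>
      {bracket F (y m i) (y r j) \<otimes>\<^bsub>F\<^esub> inv\<^bsub>F\<^esub> (bracket F (y m i) (y m j)) | m r i j.
         2 \<le> r \<and> r < m \<and> m \<le> n \<and> 1 \<le> i \<and> i \<le> r \<and> 1 \<le> j \<and> j \<le> r \<and> j \<noteq> i})"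

end

theory Submission
  imports Defs "HOL-Library.List_Lexorder"
begin

text \<open>The relators already hold in \<open>I_group n\<close> as identities between group commutators, because
  \<open>yaut n m i\<close> is the conjugation by the inverse of the generator \<open>i\<close> on the first \<open>m\<close> generators.
  Modulo the relators every Lie element is a sum of Lie elements \<open>z m\<close>, one for each \<open>m\<close>, in the
  generators with first index \<open>m\<close> only, and \<open>z m\<close> is a combination of Lyndon brackets.

  That no further relators are needed is read off from a Johnson homomorphism.  An element \<open>g\<close> of
  the \<open>c\<close>-th term of the lower central series moves each generator of the free group only modulo
  the term of degree \<open>c + 1\<close>; the leading term of the Magnus expansion of the change of generator
  \<open>k\<close> is additive in \<open>g\<close> and depends only on its class in the associated graded ring.  On the
  image of the sum of the \<open>z m\<close> it is the commutator of the variable \<open>k\<close> with the sum of the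
  \<open>z m\<close> for \<open>m \<ge> k\<close>, evaluated in the ring of noncommutative power series.  If all these
  commutators vanish, each partial sum consists of powers of one variable, which forces every
  \<open>z m\<close> to vanish in the power series ring, and thus in the free Lie ring by the linear
  independence of the Lyndon brackets.\<close>

section \<open>The lower central series\<close>

text \<open>What the relators achieve is that each row becomes stable: they turn the bracket of a
  generator of row \<open>m\<close> with one of a row \<open>r < m\<close> into zero or into a
  bracket inside row \<open>m\<close>. This is why brackets can be sorted by rows. The obstacle is
  the lower bound. The degree of a product of commutators in \<open>I_group n\<close> is not visible
  from its factors, and a count of rational dimensions would not exclude torsion. The action on the
  free group supplies integer invariants of the classes, and Lyndon brackets have leading
  coefficient 1, so no division occurs. A partial sum from row \<open>k\<close> on that consists of
  positive powers of the variable \<open>k\<close> is compared with the sum from row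
  \<open>k - 1\<close> on, which consists of powers of the variable \<open>k - 1\<close>. The two
  differ by a row in which the variable \<open>k\<close> does not occur, so nothing can cancel and
  the former is zero. For \<open>k = 2\<close> the two sums coincide, because the rows start at 2:
  one series then commutes with two different variables.\<close>

context group
begin

lemma commutator_closed [simp, intro]:
  "\<lbrakk>a \<in> carrier G; b \<in> carrier G\<rbrakk> \<Longrightarrow> commutator G a b \<in> carrier G"
  by (simp add: commutator_def)

lemma commutator_swap:
  "\<lbrakk>a \<in> carrier G; b \<in> carrier G\<rbrakk> \<Longrightarrow> commutator G b a = inv (commutator G a b)"
  by (simp add: commutator_def inv_mult_group m_assoc)

lemma inv_mult_cancel:
  "\<lbrakk>a \<in> carrier G; z \<in> carrier G\<rbrakk> \<Longrightarrow> inv a \<otimes> (a \<otimes> z) = z"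
  "\<lbrakk>a \<in> carrier G; z \<in> carrier G\<rbrakk> \<Longrightarrow> a \<otimes> (inv a \<otimes> z) = z"
  by (simp_all add: m_assoc[symmetric])

lemma mult_commutator:
  "\<lbrakk>a \<in> carrier G; b \<in> carrier G\<rbrakk> \<Longrightarrow> a \<otimes> b = b \<otimes> a \<otimes> commutator G a b"
  by (simp add: commutator_def m_assoc inv_mult_cancel)

lemma commutator_eq_one_iff:
  assumes "a \<in> carrier G" "b \<in> carrier G"
  shows "commutator G a b = \<one> \<longleftrightarrow> a \<otimes> b = b \<otimes> a"
  using mult_commutator[OF assms] assms r_cancel_one[of "b \<otimes> a" "commutator G a b"]
  by auto

lemma lower_central_Suc:
  assumes "c \<ge> 1"
  shows "lower_central G (Suc c) =
    generate G {commutator G a b | a b. a \<in> lower_central G c \<and> b \<in> carrier G}"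
  using assms by (cases c) auto

lemma lower_central_subset: "lower_central G c \<subseteq> carrier G"
proof (induction c)
  case (Suc c)
  then show ?case
  proof (cases "c \<ge> 1")
    case True
    show ?thesis
      unfolding lower_central_Suc[OF True]
      by (rule generate_incl) (use Suc in auto)
  qed (auto simp: not_le)
qed simp

lemma lower_central_carrier: "a \<in> lower_central G c \<Longrightarrow> a \<in> carrier G"
  using lower_central_subset by blast

lemma lower_central_normal: "lower_central G c \<lhd> G"
proof (induction c)
  case (Suc c)
  show ?case
  proof (cases "c \<ge> 1")
    case True
    show ?thesis
      unfolding lower_central_Suc[OF True]
    proof (rule normal_generateI)
      show "{commutator G a b |a b. a \<in> lower_central G c \<and> b \<in> carrier G} \<subseteq> carrier G"
        by (auto intro: lower_central_carrier)
    next
      fix h g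
      assume "h \<in> {commutator G a b |a b. a \<in> lower_central G c \<and> b \<in> carrier G}"
        and g: "g \<in> carrier G"
      then obtain a b where h: "h = commutator G a b" and a: "a \<in> lower_central G c"
        and b: "b \<in> carrier G" by auto
      have ac: "a \<in> carrier G" using a by (rule lower_central_carrier)
      have "g \<otimes> h \<otimes> inv g = commutator G (g \<otimes> a \<otimes> inv g) (g \<otimes> b \<otimes> inv g)"
        using g ac b by (simp add: h commutator_def inv_mult_group m_assoc inv_mult_cancel)
      moreover have "g \<otimes> a \<otimes> inv g \<in> lower_central G c"
        using Suc a g by (simp add: normal_inv_iff)
      ultimately show "g \<otimes> h \<otimes> inv g \<in> {commutator G a b |a b. a \<in> lower_central G c \<and> b \<in> carrier G}"
        using g b by blast
    qed
  qed (auto simp: not_le normal_self)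
qed (simp add: normal_self)

lemma lower_central_subgroup: "subgroup (lower_central G c) G"
  using lower_central_normal by (rule normal_imp_subgroup)

lemma lower_central_Suc_subset: "lower_central G (Suc c) \<subseteq> lower_central G c"
proof (cases "c \<ge> 1")
  case True
  interpret N: normal "lower_central G c" G by (rule lower_central_normal)
  have "commutator G a b \<in> lower_central G c" if "a \<in> lower_central G c" "b \<in> carrier G" for a b
  proof -
    have "inv b \<otimes> a \<otimes> b \<in> lower_central G c"
      using N.inv_op_closed1 that by auto
    then have "inv a \<otimes> (inv b \<otimes> a \<otimes> b) \<in> lower_central G c"
      using that by auto
    then show ?thesis
      using that lower_central_carrier[of a c] by (simp add: commutator_def m_assoc)
  qed
  then show ?thesis
    unfolding lower_central_Suc[OF True]
    by (intro generate_subgroup_incl lower_central_subgroup) auto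
qed (simp add: not_le lower_central_subset)

lemma lower_central_antimono: "c \<le> d \<Longrightarrow> lower_central G d \<subseteq> lower_central G c"
  by (induction d rule: dec_induct) (use lower_central_Suc_subset in blast)+

lemma lower_central_mono: "\<lbrakk>a \<in> lower_central G d; c \<le> d\<rbrakk> \<Longrightarrow> a \<in> lower_central G c"
  using lower_central_antimono by blast

lemma lower_central_closed:
  "\<one> \<in> lower_central G c"
  "\<lbrakk>a \<in> lower_central G c; b \<in> lower_central G c\<rbrakk> \<Longrightarrow> a \<otimes> b \<in> lower_central G c"
  "a \<in> lower_central G c \<Longrightarrow> inv a \<in> lower_central G c"
  using lower_central_subgroup[of c] by (simp_all add: subgroup_def)

end

lemma (in normal) coset_hom: "group_hom G (G Mod H) (\<lambda>a. H #> a)"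
  by (rule group_hom.intro) (simp_all add: is_group factorgroup_is_group group_hom_axioms_def r_coset_hom_Mod)

lemma (in normal) coset_eq_one_iff: "a \<in> carrier G \<Longrightarrow> H #> a = \<one>\<^bsub>G Mod H\<^esub> \<longleftrightarrow> a \<in> H"
  by (metis FactGroup_def coset_join1 coset_join2 is_group monoid.select_convs(2) subgroup_axioms subset)

context group_hom
begin

lemma commutator_hom:
  "\<lbrakk>a \<in> carrier G; b \<in> carrier G\<rbrakk> \<Longrightarrow> h (commutator G a b) = commutator H (h a) (h b)"
  by (simp add: commutator_def)

end

context group
begin

lemma commute_inv:
  assumes "z \<otimes> g = g \<otimes> z" "z \<in> carrier G" "g \<in> carrier G"
  shows "inv z \<otimes> g = g \<otimes> inv z" "g \<otimes> inv z = inv z \<otimes> g"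
proof -
  have "inv z \<otimes> g = inv z \<otimes> (g \<otimes> z) \<otimes> inv z" using assms(2,3) by (simp add: m_assoc)
  also have "\<dots> = g \<otimes> inv z" unfolding assms(1)[symmetric] using assms(2,3) by (simp add: m_assoc[symmetric])
  finally show "inv z \<otimes> g = g \<otimes> inv z" .
  then show "g \<otimes> inv z = inv z \<otimes> g" ..
qed

text \<open>The Hall-Witt argument behind the three subgroups lemma, in the one case that the
  induction along the series uses. Conjugate \<open>a\<close> by \<open>inv x\<close>,
  \<open>inv y\<close>, \<open>x\<close> and \<open>y\<close> in turn: the central \<open>z\<close>
  enters twice with opposite exponents, while \<open>s\<close> enters at the second conjugation,
  passes the third unchanged because it commutes with \<open>x\<close>, and leaves at the
  fourth.\<close>

lemma commute_commutator:
  assumes "a \<in> carrier G" "x \<in> carrier G" "y \<in> carrier G"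
    and z: "\<And>g. g \<in> carrier G \<Longrightarrow> commutator G a x \<otimes> g = g \<otimes> commutator G a x"
    and s: "commutator G a (inv y) \<otimes> x = x \<otimes> commutator G a (inv y)"
  shows "a \<otimes> commutator G x y = commutator G x y \<otimes> a"
proof -
  define cj where "cj g k = inv g \<otimes> k \<otimes> g" for g k
  define z where "z = commutator G a x"
  define s where "s = commutator G a (inv y)"
  have c: "z \<in> carrier G" "s \<in> carrier G" using assms by (simp_all add: z_def s_def)
  have cj_mult: "cj g (h \<otimes> k) = cj g h \<otimes> cj g k"
    if "g \<in> carrier G" "h \<in> carrier G" "k \<in> carrier G" for g h k
    using that by (simp add: cj_def m_assoc inv_mult_cancel)
  have cj_inv: "cj (inv g) k = l" if "cj g l = k" "g \<in> carrier G" "l \<in> carrier G" for g k l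
    using that by (auto simp: cj_def m_assoc inv_mult_cancel)
  have cj_id: "cj g k = k" if "k \<otimes> g = g \<otimes> k" "g \<in> carrier G" "k \<in> carrier G" for g k
    using that by (simp add: cj_def m_assoc inv_mult_cancel)
  have cj_z: "cj g z = z" "cj g (inv z) = inv z" if "g \<in> carrier G" for g
  proof -
    have "z \<otimes> g = g \<otimes> z" using z that by (simp add: z_def)
    then show "cj g z = z" "cj g (inv z) = inv z"
      using that c commute_inv(1)[of z g] by (auto intro!: cj_id)
  qed
  have sz: "s \<otimes> inv z = inv z \<otimes> s"
    using commute_inv(2)[of z s] z[of s] c by (simp add: z_def)
  have cx: "cj x a = a \<otimes> z" "cj (inv y) a = a \<otimes> s" "cj x s = s"
    using assms(1-3) c s by (simp_all add: z_def s_def cj_id)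
      (simp_all add: cj_def commutator_def m_assoc inv_mult_cancel)
  have "cj x (a \<otimes> inv z) = a"
    using assms(1-3) c cx by (simp add: cj_mult cj_z m_assoc)
  then have cx': "cj (inv x) a = a \<otimes> inv z"
    by (rule cj_inv) (use assms c in auto)
  have "cj (inv (inv y)) (a \<otimes> s) = a"
    by (rule cj_inv) (use assms cx in auto)
  then have cy: "cj y (a \<otimes> s) = a" using assms by simp
  have "cj (commutator G x y) a = cj y (cj x (cj (inv y) (cj (inv x) a)))"
    using assms(1-3) by (simp add: cj_def commutator_def m_assoc inv_mult_group)
  also have "\<dots> = cj y (a \<otimes> z \<otimes> (s \<otimes> inv z))"
    using assms(1-3) c by (simp add: cx cx' cj_mult cj_z m_assoc)
  also have "\<dots> = cj y (a \<otimes> s)"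
    using assms(1-3) c by (simp add: sz m_assoc inv_mult_cancel)
  finally have e: "cj (commutator G x y) a = a" by (simp add: cy)
  have k: "commutator G x y \<in> carrier G" using assms by simp
  have "a \<otimes> commutator G x y = commutator G x y \<otimes> cj (commutator G x y) a"
    using assms(1) k by (simp only: cj_def m_assoc m_closed inv_closed inv_mult_cancel)
  then show ?thesis unfolding e .
qed

end

section \<open>Commutators of two terms of the series\<close>

lemma (in group_hom) centralizer_subgroup:
  assumes a: "a \<in> carrier H"
  shows "subgroup {b \<in> carrier G. a \<otimes>\<^bsub>H\<^esub> h b = h b \<otimes>\<^bsub>H\<^esub> a} G"
proof (rule G.subgroupI)
  show "inv b \<in> {b \<in> carrier G. a \<otimes>\<^bsub>H\<^esub> h b = h b \<otimes>\<^bsub>H\<^esub> a}"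
    if "b \<in> {b \<in> carrier G. a \<otimes>\<^bsub>H\<^esub> h b = h b \<otimes>\<^bsub>H\<^esub> a}" for b
    using that a H.commute_inv(2)[of "h b" a] by simp
  show "b \<otimes> c \<in> {b \<in> carrier G. a \<otimes>\<^bsub>H\<^esub> h b = h b \<otimes>\<^bsub>H\<^esub> a}"
    if "b \<in> {b \<in> carrier G. a \<otimes>\<^bsub>H\<^esub> h b = h b \<otimes>\<^bsub>H\<^esub> a}" "c \<in> {b \<in> carrier G. a \<otimes>\<^bsub>H\<^esub> h b = h b \<otimes>\<^bsub>H\<^esub> a}" for b c
  proof -
    have b: "b \<in> carrier G" "a \<otimes>\<^bsub>H\<^esub> h b = h b \<otimes>\<^bsub>H\<^esub> a" and c: "c \<in> carrier G" "a \<otimes>\<^bsub>H\<^esub> h c = h c \<otimes>\<^bsub>H\<^esub> a"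
      using that by auto
    have "a \<otimes>\<^bsub>H\<^esub> (h b \<otimes>\<^bsub>H\<^esub> h c) = h b \<otimes>\<^bsub>H\<^esub> a \<otimes>\<^bsub>H\<^esub> h c"
      using a b(1) c(1) by (simp add: H.m_assoc[symmetric] b(2))
    also have "\<dots> = h b \<otimes>\<^bsub>H\<^esub> h c \<otimes>\<^bsub>H\<^esub> a"
      using a b(1) c(1) by (simp add: H.m_assoc c(2))
    finally show ?thesis using b c by simp
  qed
  have "\<one> \<in> {b \<in> carrier G. a \<otimes>\<^bsub>H\<^esub> h b = h b \<otimes>\<^bsub>H\<^esub> a}" using a by simp
  then show "{b \<in> carrier G. a \<otimes>\<^bsub>H\<^esub> h b = h b \<otimes>\<^bsub>H\<^esub> a} \<noteq> {}" by blast
qed auto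

context group
begin

text \<open>Modulo \<open>N = lower_central G (p + Suc q)\<close> it suffices that \<open>a\<close>
  centralizes a generating set of \<open>lower_central G (Suc q)\<close>, namely the commutators of
  elements of \<open>lower_central G q\<close> with elements of \<open>G\<close>. For these
  \<open>commute_commutator\<close> applies in the quotient.\<close>

lemma lower_central_commutator:
  assumes "a \<in> lower_central G p" "b \<in> lower_central G q" "p \<ge> 1" "q \<ge> 1"
  shows "commutator G a b \<in> lower_central G (p + q)"
proof -
  \<comment> \<open>\<open>p\<close> stays quantified because the inductive step also needs the
    hypothesis at \<open>Suc p\<close>, for the commutator of \<open>a\<close> with
    \<open>inv y\<close>.\<close>
  have "\<forall>p\<ge>1. \<forall>a\<in>lower_central G p. \<forall>b\<in>lower_central G q. commutator G a b \<in> lower_central G (p + q)"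
    using \<open>q \<ge> 1\<close>
  proof (induction q rule: dec_induct)
    case base
    have "commutator G a b \<in> lower_central G (Suc p)"
      if "p \<ge> 1" "a \<in> lower_central G p" "b \<in> carrier G" for p a b
      unfolding lower_central_Suc[OF that(1)] using that by (intro generate.incl) auto
    then show ?case by simp
  next
    case (step q)
    show ?case
    proof (intro allI impI ballI)
      fix p a b
      assume p: "(p::nat) \<ge> 1" and a: "a \<in> lower_central G p" and b: "b \<in> lower_central G (Suc q)"
      define N where "N = lower_central G (p + Suc q)"
      interpret N: normal N G unfolding N_def by (rule lower_central_normal)
      interpret pi: group_hom G "G Mod N" "\<lambda>a. N #> a" by (rule N.coset_hom)
      have N1: "N #> g = \<one>\<^bsub>G Mod N\<^esub>" if "g \<in> lower_central G d" "d \<ge> p + Suc q" for g d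
        using lower_central_mono[OF that] lower_central_carrier[OF that(1)]
        by (subst N.coset_eq_one_iff) (auto simp: N_def)
      define C where "C = {b \<in> carrier G. (N #> a) \<otimes>\<^bsub>G Mod N\<^esub> (N #> b) = (N #> b) \<otimes>\<^bsub>G Mod N\<^esub> (N #> a)}"
      have ac: "a \<in> carrier G" using a by (rule lower_central_carrier)
      have "subgroup C G"
        unfolding C_def by (rule pi.centralizer_subgroup) (rule pi.hom_closed[OF ac])
      moreover have "commutator G x y \<in> C" if x: "x \<in> lower_central G q" and y: "y \<in> carrier G" for x y
      proof -
        have xc: "x \<in> carrier G" using x by (rule lower_central_carrier)
        have z: "commutator G a x \<in> lower_central G (p + q)" using step a x p by blast
        have s: "commutator G a (inv y) \<in> lower_central G (Suc p)"
          unfolding lower_central_Suc[OF p] using a y by (intro generate.incl) auto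
        have z': "commutator G (commutator G a x) g \<in> lower_central G (Suc (p + q))"
          if "g \<in> carrier G" for g
          using z that p by (subst lower_central_Suc) (auto intro: generate.incl)
        have s': "commutator G (commutator G a (inv y)) x \<in> lower_central G (Suc p + q)"
          using step.IH[rule_format, OF _ s x] by simp
        have zq: "commutator (G Mod N) (commutator (G Mod N) (N #> a) (N #> x)) (N #> g) = \<one>\<^bsub>G Mod N\<^esub>"
          if "g \<in> carrier G" for g
          using N1[OF z'[OF that]] ac xc that by (simp add: pi.commutator_hom)
        have sq: "commutator (G Mod N) (commutator (G Mod N) (N #> a) (inv\<^bsub>G Mod N\<^esub> (N #> y))) (N #> x) = \<one>\<^bsub>G Mod N\<^esub>"
          using N1[OF s'] ac xc y by (simp add: pi.commutator_hom)
        have "(N #> a) \<otimes>\<^bsub>G Mod N\<^esub> commutator (G Mod N) (N #> x) (N #> y) =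
              commutator (G Mod N) (N #> x) (N #> y) \<otimes>\<^bsub>G Mod N\<^esub> (N #> a)"
        proof (rule pi.H.commute_commutator)
          fix g assume "g \<in> carrier (G Mod N)"
          then obtain g' where "g' \<in> carrier G" "g = N #> g'" by (auto simp: FactGroup_def RCOSETS_def)
          then show "commutator (G Mod N) (N #> a) (N #> x) \<otimes>\<^bsub>G Mod N\<^esub> g =
             g \<otimes>\<^bsub>G Mod N\<^esub> commutator (G Mod N) (N #> a) (N #> x)"
            using zq[of g'] ac xc by (subst pi.H.commutator_eq_one_iff[symmetric]) auto
        next
          show "commutator (G Mod N) (N #> a) (inv\<^bsub>G Mod N\<^esub> (N #> y)) \<otimes>\<^bsub>G Mod N\<^esub> (N #> x) =
            (N #> x) \<otimes>\<^bsub>G Mod N\<^esub> commutator (G Mod N) (N #> a) (inv\<^bsub>G Mod N\<^esub> (N #> y))"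
            using sq ac xc y by (subst pi.H.commutator_eq_one_iff[symmetric]) auto
        qed (use ac xc y in auto)
        then show ?thesis using xc y by (simp add: C_def pi.commutator_hom)
      qed
      ultimately have "lower_central G (Suc q) \<subseteq> C"
        unfolding lower_central_Suc[OF \<open>1 \<le> q\<close>] by (intro generate_subgroup_incl) auto
      then have bC: "b \<in> C" using b by auto
      then have "commutator (G Mod N) (N #> a) (N #> b) = \<one>\<^bsub>G Mod N\<^esub>"
        using ac by (subst pi.H.commutator_eq_one_iff) (auto simp: C_def)
      then have "N #> commutator G a b = \<one>\<^bsub>G Mod N\<^esub>"
        using ac bC by (simp add: C_def pi.commutator_hom)
      then show "commutator G a b \<in> lower_central G (p + Suc q)"
        using ac bC by (subst (asm) N.coset_eq_one_iff) (auto simp: C_def N_def)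
    qed
  qed
  with assms show ?thesis by blast
qed

end

declare mult_FactGroup [simp del] one_FactGroup [simp del]

section \<open>Bilinearity and the Jacobi identity modulo deeper terms\<close>

context group
begin

text \<open>An exact identity of groups behind additivity on the left: the middle factor is a triple
  commutator and lies deeper in the series than the outer two, so it disappears in the graded
  ring.\<close>

lemma commutator_mult_left:
  assumes "a \<in> carrier G" "a' \<in> carrier G" "b \<in> carrier G"
  shows "commutator G (a \<otimes> a') b =
    commutator G a b \<otimes> commutator G (commutator G a b) a' \<otimes> commutator G a' b"
  using assms by (simp add: commutator_def m_assoc inv_mult_group inv_mult_cancel)

lemma commutator_mult_right:
  assumes "a \<in> carrier G" "b \<in> carrier G" "b' \<in> carrier G"
  shows "commutator G a (b \<otimes> b') =
    commutator G a b' \<otimes> commutator G a b \<otimes> commutator G (commutator G a b) b'"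
  using assms by (simp add: commutator_def m_assoc inv_mult_group inv_mult_cancel)

lemma commutator_one [simp]:
  "a \<in> carrier G \<Longrightarrow> commutator G a \<one> = \<one>" "a \<in> carrier G \<Longrightarrow> commutator G \<one> a = \<one>"
  by (simp_all add: commutator_def)

text \<open>Conjugate \<open>a\<close> by both sides of
  \<open>b \<otimes> c = c \<otimes> b \<otimes> commutator G b c\<close> and compare. The
  commutation hypotheses let the factors be sorted; what remains is
  \<open>[[a, b], c] = [a, [b, c]] [[a, c], b]\<close>, which is the Jacobi identity up to inverting
  commutators.\<close>

lemma jacobi_commutator:
  assumes abc: "a \<in> carrier G" "b \<in> carrier G" "c \<in> carrier G"
    and comm: "commutator G a b \<otimes> commutator G b c = commutator G b c \<otimes> commutator G a b"
      "commutator G a c \<otimes> commutator G b c = commutator G b c \<otimes> commutator G a c"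
      "commutator G a b \<otimes> commutator G a c = commutator G a c \<otimes> commutator G a b"
    and central: "\<And>g. g \<in> carrier G \<Longrightarrow>
        commutator G a (commutator G b c) \<otimes> g = g \<otimes> commutator G a (commutator G b c)"
      "\<And>g. g \<in> carrier G \<Longrightarrow>
        commutator G (commutator G a c) b \<otimes> g = g \<otimes> commutator G (commutator G a c) b"
  shows "commutator G a (commutator G b c) \<otimes> commutator G b (commutator G c a)
    \<otimes> commutator G c (commutator G a b) = \<one>"
proof -
  define cj where "cj g k = inv g \<otimes> k \<otimes> g" for g k
  have cj_mult: "cj g (h \<otimes> k) = cj g h \<otimes> cj g k"
    if "g \<in> carrier G" "h \<in> carrier G" "k \<in> carrier G" for g h k
    using that by (simp add: cj_def m_assoc inv_mult_cancel)
  have cj_comm: "cj g k = k \<otimes> commutator G k g" if "g \<in> carrier G" "k \<in> carrier G" for g k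
    using that by (simp add: cj_def commutator_def m_assoc inv_mult_cancel)
  have cj_id: "cj g k = k" if "k \<otimes> g = g \<otimes> k" "g \<in> carrier G" "k \<in> carrier G" for g k
    using that by (simp add: cj_def m_assoc inv_mult_cancel)
  have cj_cj: "cj (g \<otimes> h) k = cj h (cj g k)" if "g \<in> carrier G" "h \<in> carrier G" "k \<in> carrier G" for g h k
    using that by (simp add: cj_def m_assoc inv_mult_group)
  define B where "B = commutator G a b"
  define C where "C = commutator G a c"
  define D where "D = commutator G b c"
  define T1 where "T1 = commutator G B c"
  define T2 where "T2 = commutator G a D"
  define T3 where "T3 = commutator G C b"
  have cl: "B \<in> carrier G" "C \<in> carrier G" "D \<in> carrier G" "T1 \<in> carrier G" "T2 \<in> carrier G" "T3 \<in> carrier G"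
    using abc by (simp_all add: B_def C_def D_def T1_def T2_def T3_def)
  have comm': "B \<otimes> D = D \<otimes> B" "C \<otimes> D = D \<otimes> C" "B \<otimes> C = C \<otimes> B"
    using comm by (simp_all add: B_def C_def D_def)
  have T2c: "T2 \<otimes> g = g \<otimes> T2" if "g \<in> carrier G" for g using central that by (simp add: T2_def D_def)
  have T3c: "T3 \<otimes> g = g \<otimes> T3" if "g \<in> carrier G" for g using central that by (simp add: T3_def C_def)
  have e1: "cj (b \<otimes> c) a = a \<otimes> C \<otimes> (B \<otimes> T1)"
    using abc cl by (simp add: cj_cj cj_comm[of b a] B_def[symmetric] cj_mult)
      (simp add: cj_comm B_def C_def T1_def)
  have e2: "cj (c \<otimes> b \<otimes> D) a = cj D (cj b (a \<otimes> C))"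
    using abc cl by (simp add: cj_cj cj_comm[of c a] C_def)
  have e3: "cj b (a \<otimes> C) = a \<otimes> B \<otimes> (C \<otimes> T3)"
    using abc cl by (simp add: cj_mult) (simp add: cj_comm B_def T3_def)
  have "cj D a = a \<otimes> T2" using abc cl by (simp add: cj_comm T2_def)
  moreover have "cj D B = B" "cj D C = C" "cj D T3 = T3"
    using comm' cl T3c[of D] by (simp_all only: cj_id)
  ultimately have e4: "cj D (a \<otimes> B \<otimes> (C \<otimes> T3)) = a \<otimes> T2 \<otimes> B \<otimes> (C \<otimes> T3)"
    using abc cl by (simp add: cj_mult)
  have e5: "b \<otimes> c = c \<otimes> b \<otimes> D" using mult_commutator[OF abc(2,3)] by (simp add: D_def)
  have "a \<otimes> C \<otimes> (B \<otimes> T1) = a \<otimes> T2 \<otimes> B \<otimes> (C \<otimes> T3)"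
    unfolding e1[symmetric] e4[symmetric] e3[symmetric] e2[symmetric] e5 ..
  then have "C \<otimes> (B \<otimes> T1) = T2 \<otimes> (B \<otimes> (C \<otimes> T3))"
    using abc cl by (simp add: m_assoc)
  also have "\<dots> = T2 \<otimes> (C \<otimes> (B \<otimes> T3))"
    using cl comm'(3) by (simp add: m_assoc[symmetric])
  also have "\<dots> = C \<otimes> (B \<otimes> (T2 \<otimes> T3))"
    using cl T2c[of "C \<otimes> B"] by (simp add: m_assoc[symmetric])
  finally have T1: "T1 = T2 \<otimes> T3" using cl by simp
  have "commutator G (commutator G c a) b = C \<otimes> inv T3 \<otimes> inv C"
    using abc by (simp add: T3_def C_def commutator_def m_assoc inv_mult_group inv_mult_cancel)
  also have "\<dots> = inv T3"
    using cl unfolding commute_inv(1)[OF T3c[OF cl(2)] cl(6,2), symmetric] by (simp add: m_assoc)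
  finally have "commutator G b (commutator G c a) = T3"
    using abc cl by (subst commutator_swap) simp_all
  moreover have "commutator G c (commutator G a b) = inv T1"
    using abc cl by (subst commutator_swap) (simp_all add: T1_def B_def)
  moreover have "T2 \<otimes> T3 \<otimes> inv (T2 \<otimes> T3) = \<one>" using cl by simp
  ultimately show ?thesis using T1 by (simp add: T2_def D_def)
qed

text \<open>The coset is formed for every element of \<open>G\<close>, not only for those of degree
  \<open>c\<close>. This makes it a homomorphism to a quotient of \<open>G\<close>, so that products
  can be split without checking degrees; on \<open>lower_central G c\<close> it is the projection to
  \<open>gr_part G c\<close>.\<close>

definition lc_class :: "nat \<Rightarrow> 'a \<Rightarrow> 'a set" where
  "lc_class c a = lower_central G (Suc c) #> a"

lemma lc_class_hom: "group_hom G (G Mod lower_central G (Suc c)) (lc_class c)"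
  using normal.coset_hom[OF lower_central_normal, of "Suc c"] by (simp add: lc_class_def[abs_def])

lemma lc_class_eq_one_iff:
  "a \<in> carrier G \<Longrightarrow> lc_class c a = \<one>\<^bsub>G Mod lower_central G (Suc c)\<^esub> \<longleftrightarrow> a \<in> lower_central G (Suc c)"
  unfolding lc_class_def by (rule normal.coset_eq_one_iff[OF lower_central_normal])

lemma lc_class_eq_one: "a \<in> lower_central G (Suc c) \<Longrightarrow> lc_class c a = \<one>\<^bsub>G Mod lower_central G (Suc c)\<^esub>"
  using lower_central_carrier lc_class_eq_one_iff by blast

lemma lc_class_eq_iff:
  assumes "a \<in> carrier G" "b \<in> carrier G"
  shows "lc_class c a = lc_class c b \<longleftrightarrow> a \<otimes> inv b \<in> lower_central G (Suc c)"
proof -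
  interpret pi: group_hom G "G Mod lower_central G (Suc c)" "lc_class c" by (rule lc_class_hom)
  show ?thesis
    using assms lc_class_eq_one_iff[of "a \<otimes> inv b" c]
      pi.H.inv_solve_right[of "\<one>\<^bsub>G Mod lower_central G (Suc c)\<^esub>" "lc_class c a" "lc_class c b"]
    by auto
qed

lemma lc_class_commutator_mult_left:
  assumes "a \<in> lower_central G p" "a' \<in> lower_central G p" "b \<in> lower_central G q" "p \<ge> 1" "q \<ge> 1"
  shows "lc_class (p + q) (commutator G (a \<otimes> a') b) =
    lc_class (p + q) (commutator G a b \<otimes> commutator G a' b)"
proof -
  interpret pi: group_hom G "G Mod lower_central G (Suc (p + q))" "lc_class (p + q)" by (rule lc_class_hom)
  have c: "a \<in> carrier G" "a' \<in> carrier G" "b \<in> carrier G" using assms lower_central_carrier by auto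
  have "commutator G (commutator G a b) a' \<in> lower_central G (Suc (p + q))"
    by (rule lower_central_mono[OF lower_central_commutator[OF lower_central_commutator[OF assms(1,3-5)] assms(2)]])
      (use assms in auto)
  from lc_class_eq_one[OF this] show ?thesis
    using c by (simp add: commutator_mult_left)
qed

lemma lc_class_mult_commute:
  assumes "a \<in> lower_central G p" "b \<in> lower_central G p" "p \<ge> 1"
  shows "lc_class p (a \<otimes> b) = lc_class p (b \<otimes> a)"
proof -
  interpret pi: group_hom G "G Mod lower_central G (Suc p)" "lc_class p" by (rule lc_class_hom)
  have c: "a \<in> carrier G" "b \<in> carrier G" using assms lower_central_carrier by auto
  have "commutator G a b \<in> lower_central G (Suc p)"
    by (rule lower_central_mono[OF lower_central_commutator[OF assms(1,2,3,3)]]) (use assms(3) in auto)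
  from lc_class_eq_one[OF this] show ?thesis
    using c by (simp add: mult_commutator[of a b])
qed

lemma lc_class_commutator_mult_right:
  assumes "a \<in> lower_central G p" "b \<in> lower_central G q" "b' \<in> lower_central G q" "p \<ge> 1" "q \<ge> 1"
  shows "lc_class (p + q) (commutator G a (b \<otimes> b')) =
    lc_class (p + q) (commutator G a b \<otimes> commutator G a b')"
proof -
  interpret pi: group_hom G "G Mod lower_central G (Suc (p + q))" "lc_class (p + q)" by (rule lc_class_hom)
  have c: "a \<in> carrier G" "b' \<in> carrier G" "b \<in> carrier G" using assms lower_central_carrier by auto
  have "commutator G (commutator G a b) b' \<in> lower_central G (Suc (p + q))"
    by (rule lower_central_mono[OF lower_central_commutator[OF lower_central_commutator[OF assms(1,2,4,5)] assms(3)]])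
      (use assms in auto)
  from lc_class_eq_one[OF this] show ?thesis
    using c lc_class_mult_commute[of "commutator G a b" "p + q" "commutator G a b'"] assms
    by (simp add: commutator_mult_right lower_central_commutator)
qed

text \<open>Well-definedness of the bracket. Write \<open>a = u \<otimes> a'\<close> and
  \<open>b = v \<otimes> b'\<close>; equality of the classes puts \<open>u\<close> and
  \<open>v\<close> one term deeper, so their commutators vanish modulo
  \<open>lower_central G (Suc (p + q))\<close> and additivity leaves the commutator of
  \<open>a'\<close> and \<open>b'\<close>.\<close>

lemma lc_class_commutator_cong:
  assumes "a \<in> lower_central G p" "a' \<in> lower_central G p" "b \<in> lower_central G q" "b' \<in> lower_central G q"
    "p \<ge> 1" "q \<ge> 1" "lc_class p a = lc_class p a'" "lc_class q b = lc_class q b'"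
  shows "lc_class (p + q) (commutator G a b) = lc_class (p + q) (commutator G a' b')"
proof -
  interpret pi: group_hom G "G Mod lower_central G (Suc (p + q))" "lc_class (p + q)" by (rule lc_class_hom)
  have c: "a \<in> carrier G" "b \<in> carrier G" "a' \<in> carrier G" "b' \<in> carrier G"
    using assms lower_central_carrier by auto
  define u where "u = a \<otimes> inv a'"
  define v where "v = b \<otimes> inv b'"
  have u: "u \<in> lower_central G (Suc p)" and v: "v \<in> lower_central G (Suc q)"
    using assms c lc_class_eq_iff by (auto simp: u_def v_def)
  have uv: "u \<in> carrier G" "v \<in> carrier G" using u v lower_central_carrier by auto
  have u1: "lc_class (p + q) (commutator G u b) = \<one>\<^bsub>G Mod lower_central G (Suc (p + q))\<^esub>"
    by (rule lc_class_eq_one) (use lower_central_commutator[OF u assms(3)] assms in simp)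
  have v1: "lc_class (p + q) (commutator G a' v) = \<one>\<^bsub>G Mod lower_central G (Suc (p + q))\<^esub>"
    by (rule lc_class_eq_one) (use lower_central_commutator[OF assms(2) v] assms in simp)
  have "lc_class (p + q) (commutator G (u \<otimes> a') b) = lc_class (p + q) (commutator G a' b)"
    using lc_class_commutator_mult_left[of u p a' b q] assms u u1 c uv
    by (simp add: lower_central_mono)
  moreover have "lc_class (p + q) (commutator G a' (v \<otimes> b')) = lc_class (p + q) (commutator G a' b')"
    using lc_class_commutator_mult_right[of a' p v q b'] assms v v1 c uv
    by (simp add: lower_central_mono)
  moreover have "u \<otimes> a' = a" "v \<otimes> b' = b" using c by (simp_all add: u_def v_def m_assoc)
  ultimately show ?thesis by simp
qed

text \<open>In the quotient by \<open>lower_central G (Suc (p + q + r))\<close> the triple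
  commutators of \<open>a\<close>, \<open>b\<close>, \<open>c\<close> are central, and two double
  commutators commute because a weight such as \<open>(p + q) + (q + r)\<close> exceeds
  \<open>p + q + r\<close>. These are the hypotheses of \<open>jacobi_commutator\<close>.\<close>

lemma lc_class_jacobi:
  assumes "a \<in> lower_central G p" "b \<in> lower_central G q" "c \<in> lower_central G r"
    "p \<ge> 1" "q \<ge> 1" "r \<ge> 1"
  shows "commutator G a (commutator G b c) \<otimes> commutator G b (commutator G c a)
    \<otimes> commutator G c (commutator G a b) \<in> lower_central G (Suc (p + q + r))"
proof -
  let ?Q = "G Mod lower_central G (Suc (p + q + r))"
  define f where "f = lc_class (p + q + r)"
  interpret pi: group_hom G ?Q f unfolding f_def by (rule lc_class_hom)
  have abc: "a \<in> carrier G" "b \<in> carrier G" "c \<in> carrier G"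
    using assms lower_central_carrier by auto
  have f1: "f x = \<one>\<^bsub>?Q\<^esub>" if "x \<in> lower_central G d" "d > p + q + r" for x d
    unfolding f_def using lower_central_mono[OF that(1)] that(2) by (intro lc_class_eq_one) auto
  have comm: "f x \<otimes>\<^bsub>?Q\<^esub> f y = f y \<otimes>\<^bsub>?Q\<^esub> f x"
    if "x \<in> lower_central G d" "y \<in> lower_central G e" "d \<ge> 1" "e \<ge> 1" "d + e > p + q + r" for x y d e
  proof -
    have "x \<in> carrier G" "y \<in> carrier G" using that lower_central_carrier by auto
    then show ?thesis
      using f1[OF lower_central_commutator[OF that(1-4)] that(5)]
      by (subst pi.H.commutator_eq_one_iff[symmetric]) (simp_all add: pi.commutator_hom)
  qed
  note lcc = lower_central_commutator
  have ab: "commutator G a b \<in> lower_central G (p + q)" and ac: "commutator G a c \<in> lower_central G (p + r)"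
    and bc: "commutator G b c \<in> lower_central G (q + r)" using assms by (auto intro: lcc)
  have abc1: "commutator G a (commutator G b c) \<in> lower_central G (p + (q + r))"
    and abc2: "commutator G (commutator G a c) b \<in> lower_central G (p + r + q)"
    using assms ab ac bc by (auto intro: lcc)
  have "commutator ?Q (f a) (commutator ?Q (f b) (f c)) \<otimes>\<^bsub>?Q\<^esub> commutator ?Q (f b) (commutator ?Q (f c) (f a))
    \<otimes>\<^bsub>?Q\<^esub> commutator ?Q (f c) (commutator ?Q (f a) (f b)) = \<one>\<^bsub>?Q\<^esub>"
  proof (rule pi.H.jacobi_commutator)
    fix g assume "g \<in> carrier ?Q"
    then obtain g' where g': "g' \<in> carrier G" "g = f g'" by (auto simp: FactGroup_def RCOSETS_def f_def lc_class_def)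
    have g1: "g' \<in> lower_central G 1" using g' by simp
    show "commutator ?Q (f a) (commutator ?Q (f b) (f c)) \<otimes>\<^bsub>?Q\<^esub> g = g \<otimes>\<^bsub>?Q\<^esub> commutator ?Q (f a) (commutator ?Q (f b) (f c))"
      using comm[OF abc1 g1] abc g' assms by (simp add: pi.commutator_hom)
    show "commutator ?Q (commutator ?Q (f a) (f c)) (f b) \<otimes>\<^bsub>?Q\<^esub> g = g \<otimes>\<^bsub>?Q\<^esub> commutator ?Q (commutator ?Q (f a) (f c)) (f b)"
      using comm[OF abc2 g1] abc g' assms by (simp add: pi.commutator_hom)
  qed (use abc assms comm[OF ab bc] comm[OF ac bc] comm[OF ab ac] in \<open>auto simp: pi.commutator_hom\<close>)
  then have "f (commutator G a (commutator G b c) \<otimes> commutator G b (commutator G c a)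
    \<otimes> commutator G c (commutator G a b)) = \<one>\<^bsub>?Q\<^esub>"
    using abc by (simp add: pi.commutator_hom)
  then show ?thesis
    unfolding f_def using abc by (subst (asm) lc_class_eq_one_iff) auto
qed

end

declare One_nat_def [simp del]

section \<open>The associated graded Lie ring\<close>

context group
begin

lemma gr_part_carrier:
  "carrier (gr_part G c) = lc_class c ` lower_central G c"
  by (auto simp: gr_part_def FactGroup_def RCOSETS_def lc_class_def r_coset_def)

lemma gr_part_carrierE:
  assumes "A \<in> carrier (gr_part G c)"
  obtains a where "a \<in> lower_central G c" "A = lc_class c a"
  using assms by (auto simp: gr_part_carrier)

lemma lc_class_carrier: "a \<in> lower_central G c \<Longrightarrow> lc_class c a \<in> carrier (gr_part G c)"
  by (auto simp: gr_part_carrier)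

lemma gr_part_one: "\<one>\<^bsub>gr_part G c\<^esub> = lc_class c \<one>"
  using lower_central_subset[of "Suc c"] by (simp add: gr_part_def FactGroup_def lc_class_def)

lemma gr_part_mult:
  assumes "a \<in> lower_central G c" "b \<in> lower_central G c"
  shows "lc_class c a \<otimes>\<^bsub>gr_part G c\<^esub> lc_class c b = lc_class c (a \<otimes> b)"
proof -
  have "lc_class c a \<otimes>\<^bsub>gr_part G c\<^esub> lc_class c b = lc_class c a <#>\<^bsub>G\<^esub> lc_class c b"
    by (simp add: gr_part_def FactGroup_def set_mult_def)
  also have "\<dots> = lc_class c (a \<otimes> b)"
    unfolding lc_class_def
    using normal.rcos_sum[OF lower_central_normal] lower_central_carrier assms by blast
  finally show ?thesis .
qed

lemma lc_class_eq_one': "a \<in> lower_central G c \<Longrightarrow> lc_class c a = \<one>\<^bsub>gr_part G c\<^esub> \<longleftrightarrow> a \<in> lower_central G (Suc c)"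
  using lower_central_carrier[of a c] by (simp add: gr_part_one lc_class_eq_iff)

lemma gr_part_comm_group:
  assumes "c \<ge> 1"
  shows "comm_group (gr_part G c)"
proof (rule comm_groupI)
  fix x assume "x \<in> carrier (gr_part G c)"
  then obtain a where a: "a \<in> lower_central G c" "x = lc_class c a" by (rule gr_part_carrierE)
  then show "\<exists>y\<in>carrier (gr_part G c). y \<otimes>\<^bsub>gr_part G c\<^esub> x = \<one>\<^bsub>gr_part G c\<^esub>"
    by (intro bexI[of _ "lc_class c (inv a)"])
      (simp_all add: gr_part_mult gr_part_one lc_class_carrier lower_central_closed lower_central_carrier[of _ c])
qed (use assms in \<open>(elim gr_part_carrierE)?, simp add: gr_part_mult gr_part_one lc_class_carrier lower_central_closed
    lower_central_carrier[of _ c] m_assoc lc_class_mult_commute\<close>)+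

lemma gr_part_group: "c \<ge> 1 \<Longrightarrow> group (gr_part G c)"
  using gr_part_comm_group comm_group.axioms(2) by blast

text \<open>Every representative of the class of \<open>a\<close> again lies in
  \<open>lower_central G p\<close>, because the modulus does. All pairs of representatives therefore
  have commutators of one class, and the union in \<open>gr_part_bracket\<close> runs over a
  constant nonempty family.\<close>

lemma gr_part_bracket_class:
  assumes "a \<in> lower_central G p" "b \<in> lower_central G q" "p \<ge> 1" "q \<ge> 1"
  shows "gr_part_bracket G p q (lc_class p a) (lc_class q b) = lc_class (p + q) (commutator G a b)"
proof -
  have sub: "lc_class p a \<subseteq> lower_central G p \<and> a \<in> lc_class p a" if "a \<in> lower_central G p" for p a
  proof -
    have "lc_class p a \<subseteq> lower_central G p"
      using that lower_central_closed lower_central_Suc_subset[of p]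
      by (auto simp: lc_class_def r_coset_def)
    moreover have "a \<in> lc_class p a"
      unfolding lc_class_def
      using lower_central_subgroup that lower_central_carrier by (intro rcos_self)
    ultimately show ?thesis by blast
  qed
  have cl: "lc_class p a' = lc_class p a" if "a \<in> lower_central G p" "a' \<in> lc_class p a" for p a a'
    using repr_independence[OF _ lower_central_carrier[OF that(1)] lower_central_subgroup] that(2)
    unfolding lc_class_def by simp
  have "lower_central G (Suc (p + q)) #> commutator G a' b' = lc_class (p + q) (commutator G a b)"
    if "a' \<in> lc_class p a" "b' \<in> lc_class q b" for a' b'
    unfolding lc_class_def[symmetric]
  proof (rule lc_class_commutator_cong)
    show "lc_class p a' = lc_class p a" "lc_class q b' = lc_class q b"
      using cl assms that by simp_all
    show "a' \<in> lower_central G p" "b' \<in> lower_central G q"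
      using sub[OF assms(1)] sub[OF assms(2)] that by auto
  qed (use assms in auto)
  then have "gr_part_bracket G p q (lc_class p a) (lc_class q b) =
      (\<Union>a'\<in>lc_class p a. \<Union>b'\<in>lc_class q b. lc_class (p + q) (commutator G a b))"
    by (simp add: gr_part_bracket_def)
  then show ?thesis using sub[OF assms(1)] sub[OF assms(2)] by auto
qed

lemma gr_simps:
  "carrier (gr G) = carrier (sum_group {1..} (gr_part G))"
  "x \<otimes>\<^bsub>gr G\<^esub> y = (\<lambda>c\<in>{1..}. x c \<otimes>\<^bsub>gr_part G c\<^esub> y c)"
  "\<one>\<^bsub>gr G\<^esub> = (\<lambda>c\<in>{1..}. \<one>\<^bsub>gr_part G c\<^esub>)"
  by (simp_all add: gr_def)

lemma gr_carrier_iff: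
  "x \<in> carrier (gr G) \<longleftrightarrow>
    x \<in> (\<Pi>\<^sub>E c\<in>{1..}. carrier (gr_part G c)) \<and> finite {c\<in>{1..}. x c \<noteq> \<one>\<^bsub>gr_part G c\<^esub>}"
  unfolding gr_simps by (subst carrier_sum_group) (auto simp: gr_part_group)

lemma gr_component: "\<lbrakk>x \<in> carrier (gr G); c \<ge> 1\<rbrakk> \<Longrightarrow> x c \<in> carrier (gr_part G c)"
  by (auto simp: gr_carrier_iff)

lemma gr_eqI:
  assumes "x \<in> carrier (gr G)" "y \<in> carrier (gr G)" "\<And>c. c \<ge> 1 \<Longrightarrow> x c = y c"
  shows "x = y"
  using assms by (intro PiE_ext[of x "{1..}" "\<lambda>c. carrier (gr_part G c)"]) (auto simp: gr_carrier_iff)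

lemma gr_comm_group: "comm_group (gr G)"
proof -
  interpret S: group "sum_group {1..} (gr_part G)" by (rule sum_group) (simp add: gr_part_group)
  have m: "x \<otimes>\<^bsub>gr G\<^esub> y = x \<otimes>\<^bsub>sum_group {1..} (gr_part G)\<^esub> y" for x y by (simp add: gr_def)
  have o: "\<one>\<^bsub>gr G\<^esub> = \<one>\<^bsub>sum_group {1..} (gr_part G)\<^esub>" by (simp add: gr_def)
  have c: "carrier (gr G) = carrier (sum_group {1..} (gr_part G))" by (simp add: gr_def)
  show ?thesis
  proof (rule comm_groupI, unfold m o c)
    fix x y assume "x \<in> carrier (sum_group {1..} (gr_part G))" "y \<in> carrier (sum_group {1..} (gr_part G))"
    then have xy: "x \<in> carrier (gr G)" "y \<in> carrier (gr G)" by (simp_all add: c)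
    show "x \<otimes>\<^bsub>sum_group {1..} (gr_part G)\<^esub> y = y \<otimes>\<^bsub>sum_group {1..} (gr_part G)\<^esub> x"
      unfolding mult_sum_group
    proof (rule restrict_ext)
      fix d :: nat assume "d \<in> {1..}"
      then interpret P: comm_group "gr_part G d" by (intro gr_part_comm_group) simp
      show "x d \<otimes>\<^bsub>gr_part G d\<^esub> y d = y d \<otimes>\<^bsub>gr_part G d\<^esub> x d"
        using xy \<open>d \<in> {1..}\<close> by (intro P.m_comm gr_component) auto
    qed
  qed (use S.l_inv_ex in \<open>auto simp del: mult_sum_group one_sum_group intro: S.m_assoc\<close>)
qed

lemma gr_class_eq:
  "gr_class G c a = (\<lambda>d\<in>{1..}. if d = c then lc_class c a else \<one>\<^bsub>gr_part G d\<^esub>)"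
  by (simp add: gr_class_def lc_class_def restrict_def fun_eq_iff)

lemma gr_class_carrier:
  assumes "a \<in> lower_central G c"
  shows "gr_class G c a \<in> carrier (gr G)"
proof -
  have "{d \<in> {1..}. gr_class G c a d \<noteq> \<one>\<^bsub>gr_part G d\<^esub>} \<subseteq> {c}"
    by (auto simp: gr_class_eq)
  then have "finite {d \<in> {1..}. gr_class G c a d \<noteq> \<one>\<^bsub>gr_part G d\<^esub>}"
    by (rule finite_subset) simp
  moreover have "\<one>\<^bsub>gr_part G d\<^esub> \<in> carrier (gr_part G d)" for d
    by (simp add: gr_part_one lc_class_carrier lower_central_closed)
  ultimately show ?thesis
    using assms by (auto simp: gr_carrier_iff gr_class_eq lc_class_carrier)
qed

lemma gr_class_mult:
  assumes "a \<in> lower_central G c" "b \<in> lower_central G c"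
  shows "gr_class G c a \<otimes>\<^bsub>gr G\<^esub> gr_class G c b = gr_class G c (a \<otimes> b)"
proof -
  have "\<one>\<^bsub>gr_part G d\<^esub> \<otimes>\<^bsub>gr_part G d\<^esub> \<one>\<^bsub>gr_part G d\<^esub> = \<one>\<^bsub>gr_part G d\<^esub>" for d
    by (simp add: gr_part_one gr_part_mult lower_central_closed)
  then show ?thesis
    using assms by (simp add: gr_simps gr_class_eq gr_part_mult restrict_def fun_eq_iff)
qed

lemma gr_class_eq_one_iff:
  assumes "a \<in> lower_central G c" "c \<ge> 1"
  shows "gr_class G c a = \<one>\<^bsub>gr G\<^esub> \<longleftrightarrow> a \<in> lower_central G (Suc c)"
  using assms lc_class_eq_one'[of a c] by (auto simp: gr_simps gr_class_eq fun_eq_iff restrict_def)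

lemma gr_class_one: "gr_class G c \<one> = \<one>\<^bsub>gr G\<^esub>"
  by (simp add: gr_simps gr_class_eq gr_part_one restrict_def fun_eq_iff)

lemma gr_class_inv:
  assumes "a \<in> lower_central G c"
  shows "gr_class G c (inv a) = inv\<^bsub>gr G\<^esub> (gr_class G c a)"
proof -
  interpret L: comm_group "gr G" by (rule gr_comm_group)
  show ?thesis
    using assms lower_central_carrier[of a c]
    by (intro L.inv_equality[symmetric])
      (simp_all add: gr_class_mult gr_class_carrier lower_central_closed gr_class_one)
qed

text \<open>Elements of the direct sum have finite support, so they arise from zero by adding
  homogeneous classes one at a time. Through this rule the Lie identities are reduced to statements
  about commutators in \<open>G\<close>.\<close>

lemma gr_induct [consumes 1, case_names one step]:
  assumes x: "x \<in> carrier (gr G)" and one: "P \<one>\<^bsub>gr G\<^esub>"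
    and step: "\<And>c a y. \<lbrakk>c \<ge> 1; a \<in> lower_central G c; y \<in> carrier (gr G); P y\<rbrakk>
      \<Longrightarrow> P (gr_class G c a \<otimes>\<^bsub>gr G\<^esub> y)"
  shows "P x"
proof -
  define supp where "supp x = {c\<in>{1..}. x c \<noteq> \<one>\<^bsub>gr_part G c\<^esub>}" for x :: "nat \<Rightarrow> 'a set"
  have "finite (supp x)" using x by (simp add: gr_carrier_iff supp_def)
  then show ?thesis
    using x
  proof (induction "supp x" arbitrary: x rule: finite_induct)
    case empty
    interpret L: comm_group "gr G" by (rule gr_comm_group)
    have "x = \<one>\<^bsub>gr G\<^esub>"
    proof (rule gr_eqI)
      show "x c = \<one>\<^bsub>gr G\<^esub> c" if "c \<ge> 1" for c
        using empty(1) that by (auto simp: supp_def gr_simps(3))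
    qed (use empty in auto)
    then show ?case using one by simp
  next
    case (insert c S)
    interpret L: comm_group "gr G" by (rule gr_comm_group)
    have c: "c \<ge> 1" using insert by (auto simp: supp_def)
    then obtain a where a: "a \<in> lower_central G c" "x c = lc_class c a"
      using gr_component[OF insert.prems c] gr_part_carrierE by metis
    define y where "y = x(c := \<one>\<^bsub>gr_part G c\<^esub>)"
    have supp_y: "supp y = S" using insert by (auto simp: supp_def y_def)
    have one_c: "\<one>\<^bsub>gr_part G c\<^esub> \<in> carrier (gr_part G c)"
      by (simp add: gr_part_one lc_class_carrier lower_central_closed)
    have y: "y \<in> carrier (gr G)"
      unfolding gr_carrier_iff
    proof
      show "y \<in> (\<Pi>\<^sub>E c\<in>{1..}. carrier (gr_part G c))"
        using insert.prems c one_c by (auto simp: gr_carrier_iff y_def PiE_iff extensional_def)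
      show "finite {c \<in> {1..}. y c \<noteq> \<one>\<^bsub>gr_part G c\<^esub>}"
        using supp_y insert.hyps(1) by (simp add: supp_def)
    qed
    have "x = gr_class G c a \<otimes>\<^bsub>gr G\<^esub> y"
    proof (rule gr_eqI)
      fix d :: nat assume d: "d \<ge> 1"
      interpret P: comm_group "gr_part G d" by (rule gr_part_comm_group) (rule d)
      have "x d \<in> carrier (gr_part G d)" using insert.prems d by (rule gr_component)
      then show "x d = (gr_class G c a \<otimes>\<^bsub>gr G\<^esub> y) d"
        using d a(2) P.r_one[of "x d"] P.l_one[of "x d"] by (cases "d = c") (simp_all add: gr_simps(2) gr_class_eq y_def)
    qed (use insert.prems y a in \<open>auto intro: gr_class_carrier\<close>)
    then show ?case using step[OF c a(1) y] insert.hyps(3)[OF supp_y[symmetric] y] by simp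
  qed
qed

lemma gr_part_bracket_closed:
  assumes "A \<in> carrier (gr_part G p)" "B \<in> carrier (gr_part G q)" "p \<ge> 1" "q \<ge> 1"
  shows "gr_part_bracket G p q A B \<in> carrier (gr_part G (p + q))"
  using assms
  by (elim gr_part_carrierE) (simp add: gr_part_bracket_class lc_class_carrier lower_central_commutator)

lemma gr_part_bracket_mult_left:
  assumes "A \<in> carrier (gr_part G p)" "A' \<in> carrier (gr_part G p)" "B \<in> carrier (gr_part G q)" "p \<ge> 1" "q \<ge> 1"
  shows "gr_part_bracket G p q (A \<otimes>\<^bsub>gr_part G p\<^esub> A') B =
    gr_part_bracket G p q A B \<otimes>\<^bsub>gr_part G (p + q)\<^esub> gr_part_bracket G p q A' B"
proof -
  obtain a where a: "a \<in> lower_central G p" "A = lc_class p a" using assms(1) by (rule gr_part_carrierE)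
  obtain a' where a': "a' \<in> lower_central G p" "A' = lc_class p a'" using assms(2) by (rule gr_part_carrierE)
  obtain b where b: "b \<in> lower_central G q" "B = lc_class q b" using assms(3) by (rule gr_part_carrierE)
  show ?thesis
    using a a' b assms(4,5) lc_class_commutator_mult_left[OF a(1) a'(1) b(1) assms(4,5)]
    by (simp add: gr_part_mult gr_part_bracket_class lower_central_closed lower_central_commutator)
qed

lemma gr_part_bracket_mult_right:
  assumes "A \<in> carrier (gr_part G p)" "B \<in> carrier (gr_part G q)" "B' \<in> carrier (gr_part G q)" "p \<ge> 1" "q \<ge> 1"
  shows "gr_part_bracket G p q A (B \<otimes>\<^bsub>gr_part G q\<^esub> B') =
    gr_part_bracket G p q A B \<otimes>\<^bsub>gr_part G (p + q)\<^esub> gr_part_bracket G p q A B'"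
proof -
  obtain a where a: "a \<in> lower_central G p" "A = lc_class p a" using assms(1) by (rule gr_part_carrierE)
  obtain b where b: "b \<in> lower_central G q" "B = lc_class q b" using assms(2) by (rule gr_part_carrierE)
  obtain b' where b': "b' \<in> lower_central G q" "B' = lc_class q b'" using assms(3) by (rule gr_part_carrierE)
  show ?thesis
    using a b b' assms(4,5) lc_class_commutator_mult_right[OF a(1) b(1) b'(1) assms(4,5)]
    by (simp add: gr_part_mult gr_part_bracket_class lower_central_closed lower_central_commutator)
qed

lemma gr_part_bracket_one:
  assumes "p \<ge> 1" "q \<ge> 1"
  shows "A \<in> carrier (gr_part G p) \<Longrightarrow> gr_part_bracket G p q A \<one>\<^bsub>gr_part G q\<^esub> = \<one>\<^bsub>gr_part G (p + q)\<^esub>"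
    and "B \<in> carrier (gr_part G q) \<Longrightarrow> gr_part_bracket G p q \<one>\<^bsub>gr_part G p\<^esub> B = \<one>\<^bsub>gr_part G (p + q)\<^esub>"
  using assms lower_central_carrier
  by (auto elim!: gr_part_carrierE simp: gr_part_one gr_part_bracket_class lower_central_closed)

lemma gr_bracket_component:
  "c \<ge> 1 \<Longrightarrow> bracket (gr G) x y c =
    finprod (gr_part G c) (\<lambda>p. gr_part_bracket G p (c - p) (x p) (y (c - p))) {1..<c}"
  by (simp add: gr_def)

lemma gr_bracket_summand:
  assumes "x \<in> carrier (gr G)" "y \<in> carrier (gr G)"
  shows "(\<lambda>p. gr_part_bracket G p (c - p) (x p) (y (c - p))) \<in> {1..<c} \<rightarrow> carrier (gr_part G c)"
proof
  fix p assume p: "p \<in> {1..<c}"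
  then have "gr_part_bracket G p (c - p) (x p) (y (c - p)) \<in> carrier (gr_part G (p + (c - p)))"
    using assms by (intro gr_part_bracket_closed gr_component) auto
  then show "gr_part_bracket G p (c - p) (x p) (y (c - p)) \<in> carrier (gr_part G c)"
    using p by simp
qed

lemma gr_bracket_closed:
  assumes "x \<in> carrier (gr G)" "y \<in> carrier (gr G)"
  shows "bracket (gr G) x y \<in> carrier (gr G)"
proof -
  have fin: "finite {c\<in>{1..}. x c \<noteq> \<one>\<^bsub>gr_part G c\<^esub>}" "finite {c\<in>{1..}. y c \<noteq> \<one>\<^bsub>gr_part G c\<^esub>}"
    using assms by (auto simp: gr_carrier_iff)
  obtain M where "\<forall>c\<in>{c\<in>{1..}. x c \<noteq> \<one>\<^bsub>gr_part G c\<^esub>}. c \<le> M"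
    using fin(1) unfolding finite_nat_set_iff_bounded_le by blast
  then have M: "x c = \<one>\<^bsub>gr_part G c\<^esub>" if "c \<ge> 1" "c > M" for c
    using that unfolding not_le[symmetric] by blast
  obtain N where "\<forall>c\<in>{c\<in>{1..}. y c \<noteq> \<one>\<^bsub>gr_part G c\<^esub>}. c \<le> N"
    using fin(2) unfolding finite_nat_set_iff_bounded_le by blast
  then have N: "y c = \<one>\<^bsub>gr_part G c\<^esub>" if "c \<ge> 1" "c > N" for c
    using that unfolding not_le[symmetric] by blast
  \<comment> \<open>In a degree above \<open>M + N\<close> every splitting
    \<open>c = p + (c - p)\<close> has a part beyond the support of \<open>x\<close> or of
    \<open>y\<close>.\<close>
  have "bracket (gr G) x y c = \<one>\<^bsub>gr_part G c\<^esub>" if c: "c \<ge> 1" "c > M + N" for c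
    unfolding gr_bracket_component[OF c(1)]
  proof (intro comm_monoid.finprod_one_eqI comm_group.axioms(1) gr_part_comm_group c(1))
    fix p assume p: "p \<in> {1..<c}"
    have "x p = \<one>\<^bsub>gr_part G p\<^esub> \<or> y (c - p) = \<one>\<^bsub>gr_part G (c - p)\<^esub>"
    proof (cases "p > M")
      case False
      then have "c - p > N" "c - p \<ge> 1" using p c by auto
      then show ?thesis using N by blast
    qed (use M p in auto)
    moreover have "x p \<in> carrier (gr_part G p)" "y (c - p) \<in> carrier (gr_part G (c - p))"
      using assms p by (auto intro!: gr_component)
    ultimately show "gr_part_bracket G p (c - p) (x p) (y (c - p)) = \<one>\<^bsub>gr_part G c\<^esub>"
      using p gr_part_bracket_one[of p "c - p"] by auto
  qed
  then have "{c\<in>{1..}. bracket (gr G) x y c \<noteq> \<one>\<^bsub>gr_part G c\<^esub>} \<subseteq> {..M + N}"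
    by (auto simp: not_le[symmetric])
  then have "finite {c\<in>{1..}. bracket (gr G) x y c \<noteq> \<one>\<^bsub>gr_part G c\<^esub>}"
    by (rule finite_subset) simp
  moreover have "bracket (gr G) x y c \<in> carrier (gr_part G c)" if "c \<ge> 1" for c
    unfolding gr_bracket_component[OF that]
    by (intro comm_monoid.finprod_closed comm_group.axioms(1) gr_part_comm_group that gr_bracket_summand assms)
  moreover have "bracket (gr G) x y \<in> extensional {1..}"
    by (simp add: gr_def)
  ultimately show ?thesis
    unfolding gr_carrier_iff PiE_iff by blast
qed

lemma gr_bracket_mult_left:
  assumes "x \<in> carrier (gr G)" "x' \<in> carrier (gr G)" "y \<in> carrier (gr G)"
  shows "bracket (gr G) (x \<otimes>\<^bsub>gr G\<^esub> x') y = bracket (gr G) x y \<otimes>\<^bsub>gr G\<^esub> bracket (gr G) x' y"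
proof (rule gr_eqI)
  interpret L: comm_group "gr G" by (rule gr_comm_group)
  show "bracket (gr G) (x \<otimes>\<^bsub>gr G\<^esub> x') y \<in> carrier (gr G)"
    "bracket (gr G) x y \<otimes>\<^bsub>gr G\<^esub> bracket (gr G) x' y \<in> carrier (gr G)"
    using assms by (auto intro!: gr_bracket_closed)
  fix c :: nat assume c: "c \<ge> 1"
  interpret P: comm_group "gr_part G c" by (rule gr_part_comm_group) (rule c)
  have "bracket (gr G) (x \<otimes>\<^bsub>gr G\<^esub> x') y c =
    finprod (gr_part G c) (\<lambda>p. gr_part_bracket G p (c - p) (x p) (y (c - p)) \<otimes>\<^bsub>gr_part G c\<^esub>
      gr_part_bracket G p (c - p) (x' p) (y (c - p))) {1..<c}"
    unfolding gr_bracket_component[OF c]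
  proof (rule P.finprod_cong')
    fix p assume p: "p \<in> {1..<c}"
    then have cp: "c - p \<ge> 1" by auto
    from p show "gr_part_bracket G p (c - p) ((x \<otimes>\<^bsub>gr G\<^esub> x') p) (y (c - p)) =
      gr_part_bracket G p (c - p) (x p) (y (c - p)) \<otimes>\<^bsub>gr_part G c\<^esub> gr_part_bracket G p (c - p) (x' p) (y (c - p))"
      using gr_part_bracket_mult_left[of "x p" p "x' p" "y (c - p)" "c - p"] assms cp
      by (simp add: gr_simps(2) gr_component)
  qed (use gr_bracket_summand[OF assms(1,3)] gr_bracket_summand[OF assms(2,3)] in \<open>auto simp: Pi_iff\<close>)
  also have "\<dots> = (bracket (gr G) x y \<otimes>\<^bsub>gr G\<^esub> bracket (gr G) x' y) c"
    using c gr_bracket_summand[OF assms(1,3)] gr_bracket_summand[OF assms(2,3)]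
    by (simp add: gr_simps(2) gr_bracket_component P.finprod_multf)
  finally show "bracket (gr G) (x \<otimes>\<^bsub>gr G\<^esub> x') y c = (bracket (gr G) x y \<otimes>\<^bsub>gr G\<^esub> bracket (gr G) x' y) c" .
qed

lemma gr_bracket_mult_right:
  assumes "x \<in> carrier (gr G)" "y \<in> carrier (gr G)" "y' \<in> carrier (gr G)"
  shows "bracket (gr G) x (y \<otimes>\<^bsub>gr G\<^esub> y') = bracket (gr G) x y \<otimes>\<^bsub>gr G\<^esub> bracket (gr G) x y'"
proof (rule gr_eqI)
  interpret L: comm_group "gr G" by (rule gr_comm_group)
  show "bracket (gr G) x (y \<otimes>\<^bsub>gr G\<^esub> y') \<in> carrier (gr G)"
    "bracket (gr G) x y \<otimes>\<^bsub>gr G\<^esub> bracket (gr G) x y' \<in> carrier (gr G)"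
    using assms by (auto intro!: gr_bracket_closed)
  fix c :: nat assume c: "c \<ge> 1"
  interpret P: comm_group "gr_part G c" by (rule gr_part_comm_group) (rule c)
  have "bracket (gr G) x (y \<otimes>\<^bsub>gr G\<^esub> y') c =
    finprod (gr_part G c) (\<lambda>p. gr_part_bracket G p (c - p) (x p) (y (c - p)) \<otimes>\<^bsub>gr_part G c\<^esub>
      gr_part_bracket G p (c - p) (x p) (y' (c - p))) {1..<c}"
    unfolding gr_bracket_component[OF c]
  proof (rule P.finprod_cong')
    fix p assume p: "p \<in> {1..<c}"
    then have cp: "c - p \<ge> 1" by auto
    from p show "gr_part_bracket G p (c - p) (x p) ((y \<otimes>\<^bsub>gr G\<^esub> y') (c - p)) =
      gr_part_bracket G p (c - p) (x p) (y (c - p)) \<otimes>\<^bsub>gr_part G c\<^esub> gr_part_bracket G p (c - p) (x p) (y' (c - p))"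
      using gr_part_bracket_mult_right[of "x p" p "y (c - p)" "c - p" "y' (c - p)"] assms cp
      by (simp add: gr_simps(2) gr_component)
  qed (use gr_bracket_summand[OF assms(1,2)] gr_bracket_summand[OF assms(1,3)] in \<open>auto simp: Pi_iff\<close>)
  also have "\<dots> = (bracket (gr G) x y \<otimes>\<^bsub>gr G\<^esub> bracket (gr G) x y') c"
    using c gr_bracket_summand[OF assms(1,2)] gr_bracket_summand[OF assms(1,3)]
    by (simp add: gr_simps(2) gr_bracket_component P.finprod_multf)
  finally show "bracket (gr G) x (y \<otimes>\<^bsub>gr G\<^esub> y') c = (bracket (gr G) x y \<otimes>\<^bsub>gr G\<^esub> bracket (gr G) x y') c" .
qed

text \<open>In the finite product that defines a component of the bracket only the summand with
  \<open>p' = p\<close> and \<open>c - p' = q\<close> can have two nontrivial entries.\<close>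

lemma gr_bracket_class:
  assumes a: "a \<in> lower_central G p" and b: "b \<in> lower_central G q" and pq: "p \<ge> 1" "q \<ge> 1"
  shows "bracket (gr G) (gr_class G p a) (gr_class G q b) = gr_class G (p + q) (commutator G a b)"
proof (rule gr_eqI)
  show "bracket (gr G) (gr_class G p a) (gr_class G q b) \<in> carrier (gr G)"
    "gr_class G (p + q) (commutator G a b) \<in> carrier (gr G)"
    using assms by (auto intro!: gr_bracket_closed gr_class_carrier lower_central_commutator)
  fix c :: nat assume c: "c \<ge> 1"
  interpret P: comm_group "gr_part G c" by (rule gr_part_comm_group) (rule c)
  have other: "gr_part_bracket G p' (c - p') (gr_class G p a p') (gr_class G q b (c - p')) = \<one>\<^bsub>gr_part G c\<^esub>"
    if "p' \<in> {1..<c}" "p' \<noteq> p \<or> c - p' \<noteq> q" for p'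
  proof -
    have "gr_class G p a p' = \<one>\<^bsub>gr_part G p'\<^esub> \<or> gr_class G q b (c - p') = \<one>\<^bsub>gr_part G (c - p')\<^esub>"
      using that by (auto simp: gr_class_eq)
    moreover have "gr_class G p a p' \<in> carrier (gr_part G p')" "gr_class G q b (c - p') \<in> carrier (gr_part G (c - p'))"
      using a b that by (auto intro!: gr_component gr_class_carrier)
    ultimately show ?thesis using that gr_part_bracket_one[of p' "c - p'"] by auto
  qed
  show "bracket (gr G) (gr_class G p a) (gr_class G q b) c = gr_class G (p + q) (commutator G a b) c"
  proof (cases "c = p + q")
    case True
    have k: "lc_class c (commutator G a b) \<in> carrier (gr_part G c)"
      unfolding True using assms by (intro lc_class_carrier lower_central_commutator)
    have "finprod (gr_part G c) (\<lambda>p'. gr_part_bracket G p' (c - p') (gr_class G p a p') (gr_class G q b (c - p'))) {1..<c} =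
      finprod (gr_part G c) (\<lambda>p'. if p = p' then lc_class c (commutator G a b) else \<one>\<^bsub>gr_part G c\<^esub>) {1..<c}"
    proof (rule P.finprod_cong')
      fix p' assume p': "p' \<in> {1..<c}"
      show "gr_part_bracket G p' (c - p') (gr_class G p a p') (gr_class G q b (c - p')) =
        (if p = p' then lc_class c (commutator G a b) else \<one>\<^bsub>gr_part G c\<^esub>)"
        using other[OF p'] assms True by (auto simp: gr_class_eq gr_part_bracket_class)
    qed (use k in auto)
    also have "\<dots> = lc_class c (commutator G a b)"
      by (rule P.finprod_singleton) (use k assms True in auto)
    finally show ?thesis using c True by (simp add: gr_bracket_component) (simp add: gr_class_eq)
  next
    case False
    have "finprod (gr_part G c) (\<lambda>p'. gr_part_bracket G p' (c - p') (gr_class G p a p') (gr_class G q b (c - p'))) {1..<c} = \<one>\<^bsub>gr_part G c\<^esub>"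
    proof (rule P.finprod_one_eqI)
      fix p' assume p': "p' \<in> {1..<c}"
      then have "p' \<noteq> p \<or> c - p' \<noteq> q" using False by auto
      with p' show "gr_part_bracket G p' (c - p') (gr_class G p a p') (gr_class G q b (c - p')) = \<one>\<^bsub>gr_part G c\<^esub>"
        by (rule other)
    qed
    then show ?thesis using c False by (simp add: gr_bracket_component) (simp add: gr_class_eq)
  qed
qed

lemma gr_bracket_one:
  assumes "x \<in> carrier (gr G)"
  shows "bracket (gr G) \<one>\<^bsub>gr G\<^esub> x = \<one>\<^bsub>gr G\<^esub>" "bracket (gr G) x \<one>\<^bsub>gr G\<^esub> = \<one>\<^bsub>gr G\<^esub>"
proof -
  interpret L: comm_group "gr G" by (rule gr_comm_group)
  have c: "bracket (gr G) \<one>\<^bsub>gr G\<^esub> x \<in> carrier (gr G)" "bracket (gr G) x \<one>\<^bsub>gr G\<^esub> \<in> carrier (gr G)"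
    using assms by (auto intro!: gr_bracket_closed)
  show "bracket (gr G) \<one>\<^bsub>gr G\<^esub> x = \<one>\<^bsub>gr G\<^esub>"
    using gr_bracket_mult_left[of "\<one>\<^bsub>gr G\<^esub>" "\<one>\<^bsub>gr G\<^esub>" x] assms c(1) by simp
  show "bracket (gr G) x \<one>\<^bsub>gr G\<^esub> = \<one>\<^bsub>gr G\<^esub>"
    using gr_bracket_mult_right[of x "\<one>\<^bsub>gr G\<^esub>" "\<one>\<^bsub>gr G\<^esub>"] assms c(2) by simp
qed

lemma gr_bracket_antisym:
  assumes "x \<in> carrier (gr G)" "y \<in> carrier (gr G)"
  shows "bracket (gr G) x y \<otimes>\<^bsub>gr G\<^esub> bracket (gr G) y x = \<one>\<^bsub>gr G\<^esub>"
proof -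
  interpret L: comm_group "gr G" by (rule gr_comm_group)
  note simps = gr_bracket_closed gr_bracket_mult_left gr_bracket_mult_right gr_class_carrier
  have add: "bracket (gr G) (x \<otimes>\<^bsub>gr G\<^esub> x') y \<otimes>\<^bsub>gr G\<^esub> bracket (gr G) y (x \<otimes>\<^bsub>gr G\<^esub> x') = \<one>\<^bsub>gr G\<^esub>"
    if "bracket (gr G) x y \<otimes>\<^bsub>gr G\<^esub> bracket (gr G) y x = \<one>\<^bsub>gr G\<^esub>"
      "bracket (gr G) x' y \<otimes>\<^bsub>gr G\<^esub> bracket (gr G) y x' = \<one>\<^bsub>gr G\<^esub>"
      "x \<in> carrier (gr G)" "x' \<in> carrier (gr G)" "y \<in> carrier (gr G)" for x x' y
  proof -
    have "bracket (gr G) (x \<otimes>\<^bsub>gr G\<^esub> x') y \<otimes>\<^bsub>gr G\<^esub> bracket (gr G) y (x \<otimes>\<^bsub>gr G\<^esub> x') =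
      (bracket (gr G) x y \<otimes>\<^bsub>gr G\<^esub> bracket (gr G) y x) \<otimes>\<^bsub>gr G\<^esub> (bracket (gr G) x' y \<otimes>\<^bsub>gr G\<^esub> bracket (gr G) y x')"
      using that(3-5) by (simp add: simps L.m_ac)
    then show ?thesis using that by simp
  qed
  show ?thesis
    using assms
  proof (induction x arbitrary: y rule: gr_induct)
    case (step c a x)
    have "bracket (gr G) (gr_class G c a) y \<otimes>\<^bsub>gr G\<^esub> bracket (gr G) y (gr_class G c a) = \<one>\<^bsub>gr G\<^esub>"
      using step.prems
    proof (induction y rule: gr_induct)
      case one
      then show ?case using step by (simp add: gr_bracket_one gr_class_carrier)
    next
      case (step d b y)
      have "commutator G b a \<otimes> commutator G a b = \<one>"
        using \<open>a \<in> lower_central G c\<close> step lower_central_carrier commutator_swap[of a b] by auto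
      then have "bracket (gr G) (gr_class G d b) (gr_class G c a) \<otimes>\<^bsub>gr G\<^esub> bracket (gr G) (gr_class G c a) (gr_class G d b) = \<one>\<^bsub>gr G\<^esub>"
        using \<open>a \<in> lower_central G c\<close> \<open>c \<ge> 1\<close> step lower_central_commutator[of a c b d] lower_central_commutator[of b d a c]
        by (simp add: gr_bracket_class add.commute[of c d] gr_class_mult gr_class_one)
      then show ?case
        using add[of "gr_class G d b" "gr_class G c a" y] step \<open>a \<in> lower_central G c\<close>
        by (simp add: L.m_comm simps)
    qed
    then show ?case
      using step by (intro add) (auto intro: gr_class_carrier)
  qed (simp add: gr_bracket_one)
qed

text \<open>The self-bracket is not additive: adding a homogeneous class creates two cross terms,
  which cancel by antisymmetry. This is why antisymmetry is proved separately beforehand.\<close>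

lemma gr_bracket_self:
  assumes "x \<in> carrier (gr G)"
  shows "bracket (gr G) x x = \<one>\<^bsub>gr G\<^esub>"
proof -
  interpret L: comm_group "gr G" by (rule gr_comm_group)
  show ?thesis
    using assms
  proof (induction x rule: gr_induct)
    case (step c a y)
    have "commutator G a a = \<one>" using step lower_central_carrier by (auto simp: commutator_eq_one_iff)
    then have "bracket (gr G) (gr_class G c a) (gr_class G c a) = \<one>\<^bsub>gr G\<^esub>"
      using step by (simp add: gr_bracket_class gr_class_one)
    then show ?case
      using step gr_bracket_antisym[of y "gr_class G c a"]
      by (simp add: gr_bracket_closed gr_bracket_mult_left gr_bracket_mult_right gr_class_carrier)
  qed (simp add: gr_bracket_one)
qed

text \<open>The Jacobi sum \<open>J\<close> is additive in its first argument and invariant under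
  cyclic rotation. So each argument in turn can be rotated to the front and replaced by a
  homogeneous class, until \<open>lc_class_jacobi\<close> applies.\<close>

lemma gr_jacobi:
  assumes "x \<in> carrier (gr G)" "y \<in> carrier (gr G)" "z \<in> carrier (gr G)"
  shows "bracket (gr G) x (bracket (gr G) y z) \<otimes>\<^bsub>gr G\<^esub> bracket (gr G) y (bracket (gr G) z x)
              \<otimes>\<^bsub>gr G\<^esub> bracket (gr G) z (bracket (gr G) x y) = \<one>\<^bsub>gr G\<^esub>"
proof -
  interpret L: comm_group "gr G" by (rule gr_comm_group)
  define J where "J x y z = bracket (gr G) x (bracket (gr G) y z) \<otimes>\<^bsub>gr G\<^esub> bracket (gr G) y (bracket (gr G) z x)
              \<otimes>\<^bsub>gr G\<^esub> bracket (gr G) z (bracket (gr G) x y)" for x y z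
  have cyc: "J x y z = J y z x" if "x \<in> carrier (gr G)" "y \<in> carrier (gr G)" "z \<in> carrier (gr G)" for x y z
    using that by (simp add: J_def gr_bracket_closed L.m_ac)
  have add: "J (x \<otimes>\<^bsub>gr G\<^esub> x') y z = J x y z \<otimes>\<^bsub>gr G\<^esub> J x' y z"
    if "x \<in> carrier (gr G)" "x' \<in> carrier (gr G)" "y \<in> carrier (gr G)" "z \<in> carrier (gr G)" for x x' y z
    using that by (simp add: J_def gr_bracket_closed gr_bracket_mult_left gr_bracket_mult_right L.m_ac)
  have one: "J \<one>\<^bsub>gr G\<^esub> y z = \<one>\<^bsub>gr G\<^esub>" if "y \<in> carrier (gr G)" "z \<in> carrier (gr G)" for y z
    using that by (simp add: J_def gr_bracket_one gr_bracket_closed)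
  have ext: "J x y z = \<one>\<^bsub>gr G\<^esub>"
    if "\<And>p a. \<lbrakk>p \<ge> 1; a \<in> lower_central G p\<rbrakk> \<Longrightarrow> J (gr_class G p a) y z = \<one>\<^bsub>gr G\<^esub>"
      "x \<in> carrier (gr G)" "y \<in> carrier (gr G)" "z \<in> carrier (gr G)" for x y z
    using that(2) by (induction x rule: gr_induct) (simp_all add: add one that gr_class_carrier)
  have J3: "J (gr_class G p a) (gr_class G q b) (gr_class G r c) = \<one>\<^bsub>gr G\<^esub>"
    if "p \<ge> 1" "a \<in> lower_central G p" "q \<ge> 1" "b \<in> lower_central G q" "r \<ge> 1" "c \<in> lower_central G r" for p q r a b c
  proof -
    have n: "p + (q + r) = p + q + r" "q + (r + p) = p + q + r" "r + (p + q) = p + q + r" by auto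
    have l: "commutator G a (commutator G b c) \<in> lower_central G (p + q + r)"
       "commutator G b (commutator G c a) \<in> lower_central G (p + q + r)"
       "commutator G c (commutator G a b) \<in> lower_central G (p + q + r)"
      using lower_central_commutator[OF that(2) lower_central_commutator[OF that(4,6,3,5)] that(1)]
        lower_central_commutator[OF that(4) lower_central_commutator[OF that(6,2,5,1)] that(3)]
        lower_central_commutator[OF that(6) lower_central_commutator[OF that(2,4,1,3)] that(5)] that n
      by simp_all
    have "J (gr_class G p a) (gr_class G q b) (gr_class G r c) =
      gr_class G (p + q + r) (commutator G a (commutator G b c) \<otimes> commutator G b (commutator G c a)
    \<otimes> commutator G c (commutator G a b))"
      using that l by (simp add: J_def gr_bracket_class lower_central_commutator n gr_class_mult lower_central_closed)
    also have "\<dots> = \<one>\<^bsub>gr G\<^esub>"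
      using lc_class_jacobi[of a p b q c r] that l
      by (subst gr_class_eq_one_iff) (auto intro: lower_central_closed)
    finally show ?thesis .
  qed
  have J2: "J (gr_class G p a) (gr_class G q b) z = \<one>\<^bsub>gr G\<^esub>"
    if "p \<ge> 1" "a \<in> lower_central G p" "q \<ge> 1" "b \<in> lower_central G q" "z \<in> carrier (gr G)" for p q a b z
  proof -
    have "J z (gr_class G p a) (gr_class G q b) = \<one>\<^bsub>gr G\<^esub>"
    proof (rule ext)
      fix r c assume rc: "r \<ge> 1" "c \<in> lower_central G r"
      have "J (gr_class G r c) (gr_class G p a) (gr_class G q b) = J (gr_class G p a) (gr_class G q b) (gr_class G r c)"
        by (rule cyc) (use that rc in \<open>auto intro: gr_class_carrier\<close>)
      then show "J (gr_class G r c) (gr_class G p a) (gr_class G q b) = \<one>\<^bsub>gr G\<^esub>"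
        using J3 that rc by simp
    qed (use that in \<open>auto intro: gr_class_carrier\<close>)
    moreover have "J z (gr_class G p a) (gr_class G q b) = J (gr_class G p a) (gr_class G q b) z"
      by (rule cyc) (use that in \<open>auto intro: gr_class_carrier\<close>)
    ultimately show ?thesis by simp
  qed
  have J1: "J (gr_class G p a) y z = \<one>\<^bsub>gr G\<^esub>"
    if "p \<ge> 1" "a \<in> lower_central G p" "y \<in> carrier (gr G)" "z \<in> carrier (gr G)" for p a y z
  proof -
    have "J y z (gr_class G p a) = \<one>\<^bsub>gr G\<^esub>"
    proof (rule ext)
      fix q b assume qb: "q \<ge> 1" "b \<in> lower_central G q"
      have "J (gr_class G p a) (gr_class G q b) z = J (gr_class G q b) z (gr_class G p a)"
        by (rule cyc) (use that qb in \<open>auto intro: gr_class_carrier\<close>)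
      then show "J (gr_class G q b) z (gr_class G p a) = \<one>\<^bsub>gr G\<^esub>" using J2 that qb by simp
    qed (use that in \<open>auto intro: gr_class_carrier\<close>)
    moreover have "J (gr_class G p a) y z = J y z (gr_class G p a)"
      by (rule cyc) (use that in \<open>auto intro: gr_class_carrier\<close>)
    ultimately show ?thesis by simp
  qed
  have "J x y z = \<one>\<^bsub>gr G\<^esub>" by (rule ext) (use assms J1 in auto)
  then show ?thesis by (simp add: J_def)
qed

theorem gr_lie_ring: "lie_ring (gr G)"
proof -
  interpret L: comm_group "gr G" by (rule gr_comm_group)
  show ?thesis
    by unfold_locales
      (auto simp: gr_bracket_closed gr_bracket_mult_left gr_bracket_mult_right gr_bracket_self gr_jacobi)
qed

end

declare One_nat_def [simp]

section \<open>Noncommutative power series\<close>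

typedef 'a nc_series = "UNIV :: ('a list \<Rightarrow> int) set"
  morphisms nc_coeff Abs_nc ..

lemma nc_coeff_Abs [simp]: "nc_coeff (Abs_nc f) = f"
  by (simp add: Abs_nc_inverse)

lemma nc_eqI: "(\<And>w. nc_coeff f w = nc_coeff g w) \<Longrightarrow> f = g"
  by (metis nc_coeff_inject ext)

text \<open>The Cauchy product over all splittings of a word into a prefix and a suffix: the first
  summand takes the empty prefix, and shifting \<open>f\<close> past the letter \<open>x\<close>
  accounts for the others. Recursion over the word makes the ring laws plain inductions.\<close>

fun conv :: "('a list \<Rightarrow> int) \<Rightarrow> ('a list \<Rightarrow> int) \<Rightarrow> 'a list \<Rightarrow> int" where
  "conv f g [] = f [] * g []"
| "conv f g (x # w) = f [] * g (x # w) + conv (\<lambda>u. f (x # u)) g w"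

lemma conv_add_left: "conv (\<lambda>u. f u + f' u) g w = conv f g w + conv f' g w"
  by (induction w arbitrary: f f') (simp_all add: algebra_simps)

lemma conv_add_right: "conv f (\<lambda>u. g u + g' u) w = conv f g w + conv f g' w"
  by (induction w arbitrary: f) (simp_all add: algebra_simps)

lemma conv_scale_left: "conv (\<lambda>u. c * f u) g w = c * conv f g w"
  by (induction w arbitrary: f) (simp_all add: algebra_simps)

lemma conv_zero_left [simp]: "conv (\<lambda>u. 0) g w = 0"
  by (induction w) simp_all

lemma conv_assoc: "conv (conv f g) h w = conv f (conv g h) w"
proof (induction w arbitrary: f)
  case (Cons x w)
  have "conv (\<lambda>u. conv f g (x # u)) h w = f [] * conv (\<lambda>u. g (x # u)) h w + conv (conv (\<lambda>u. f (x # u)) g) h w"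
    by (simp add: conv_add_left conv_scale_left)
  then show ?case by (simp add: Cons algebra_simps)
qed simp

lemma conv_one_left: "conv (\<lambda>u. if u = [] then 1 else 0) g w = g w"
  by (cases w) simp_all

lemma conv_one_right: "conv f (\<lambda>u. if u = [] then 1 else 0) w = f w"
  by (induction w arbitrary: f) simp_all

lemma conv_nonzeroE:
  assumes "conv f g w \<noteq> 0"
  obtains u v where "w = u @ v" "f u \<noteq> 0" "g v \<noteq> 0"
proof -
  have "\<exists>u v. w = u @ v \<and> f u \<noteq> 0 \<and> g v \<noteq> 0"
    using assms
  proof (induction w arbitrary: f)
    case (Cons x w)
    show ?case
    proof (cases "conv (\<lambda>u. f (x # u)) g w = 0")
      case True
      then show ?thesis using Cons.prems by (intro exI[of _ "[]"] exI[of _ "x # w"]) auto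
    next
      case False
      from Cons.IH[OF this] obtain u v where "w = u @ v" "f (x # u) \<noteq> 0" "g v \<noteq> 0" by blast
      then show ?thesis by (intro exI[of _ "x # u"] exI[of _ v]) simp
    qed
  qed auto
  then show ?thesis using that by blast
qed

text \<open>A left factor that is homogeneous of degree \<open>length u\<close> leaves a single
  splitting of the word with a possibly nonzero contribution.\<close>

lemma conv_append:
  assumes "\<And>u'. f u' \<noteq> 0 \<Longrightarrow> length u' = length u"
  shows "conv f g (u @ v) = f u * g v"
  using assms
proof (induction u arbitrary: f)
  case Nil
  then have f: "f (x # w) = 0" for x w by fastforce
  then show ?case by (cases v) simp_all
next
  case (Cons x u)
  have "conv (\<lambda>u. f (x # u)) g (u @ v) = f (x # u) * g v"
    by (rule Cons.IH) (use Cons.prems in fastforce)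
  moreover have "f [] = 0" using Cons.prems[of "[]"] by fastforce
  ultimately show ?case by simp
qed

instantiation nc_series :: (type) ring_1
begin

definition "0 = Abs_nc (\<lambda>_. 0)"
definition "1 = Abs_nc (\<lambda>u. if u = [] then 1 else 0)"
definition "f + g = Abs_nc (\<lambda>u. nc_coeff f u + nc_coeff g u)"
definition "f - g = Abs_nc (\<lambda>u. nc_coeff f u - nc_coeff g u)"
definition "- f = Abs_nc (\<lambda>u. - nc_coeff f u)"
definition "f * g = Abs_nc (conv (nc_coeff f) (nc_coeff g))"

instance
proof
  fix f g h :: "'a nc_series"
  show "f * g * h = f * (g * h)" by (rule nc_eqI) (simp add: times_nc_series_def conv_assoc)
  show "1 * f = f" by (rule nc_eqI) (simp add: times_nc_series_def one_nc_series_def conv_one_left)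
  show "f * 1 = f" by (rule nc_eqI) (simp add: times_nc_series_def one_nc_series_def conv_one_right)
  show "(f + g) * h = f * h + g * h"
    by (rule nc_eqI) (simp add: times_nc_series_def plus_nc_series_def conv_add_left)
  show "f * (g + h) = f * g + f * h"
    by (rule nc_eqI) (simp add: times_nc_series_def plus_nc_series_def conv_add_right)
  show "(0 :: 'a nc_series) \<noteq> 1"
    by (metis (mono_tags) nc_coeff_Abs one_nc_series_def zero_neq_one zero_nc_series_def)
qed (auto intro!: nc_eqI simp: zero_nc_series_def plus_nc_series_def minus_nc_series_def uminus_nc_series_def)

end

lemma nc_coeff_simps [simp]:
  "nc_coeff 0 w = 0" "nc_coeff (f + g) w = nc_coeff f w + nc_coeff g w"
  "nc_coeff (f - g) w = nc_coeff f w - nc_coeff g w" "nc_coeff (- f) w = - nc_coeff f w"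
  "nc_coeff 1 w = (if w = [] then 1 else 0)"
  by (simp_all add: zero_nc_series_def plus_nc_series_def minus_nc_series_def uminus_nc_series_def one_nc_series_def)

lemma nc_coeff_mult: "nc_coeff (f * g) w = conv (nc_coeff f) (nc_coeff g) w"
  by (simp add: times_nc_series_def)

lemma nc_coeff_sum: "nc_coeff (sum f A) w = (\<Sum>a\<in>A. nc_coeff (f a) w)"
  by (induction A rule: infinite_finite_induct) simp_all

lemma nc_coeff_of_int_mult: "nc_coeff (of_int c * f) w = c * nc_coeff f w"
proof -
  have "nc_coeff (of_nat k * f) w = int k * nc_coeff f w" for k
    by (induction k) (simp_all add: algebra_simps)
  moreover obtain a b where "c = int a - int b" by (metis int_diff_cases)
  ultimately show ?thesis by (simp add: left_diff_distrib)
qed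

definition nc_var :: "'a \<Rightarrow> 'a nc_series" where
  "nc_var k = Abs_nc (\<lambda>u. if u = [k] then 1 else 0)"

lemma nc_coeff_var [simp]: "nc_coeff (nc_var k) w = (if w = [k] then 1 else 0)"
  by (simp add: nc_var_def)

lemma nc_coeff_var_mult:
  "nc_coeff (nc_var k * f) [] = 0"
  "nc_coeff (nc_var k * f) (x # w) = (if x = k then nc_coeff f w else 0)"
proof -
  have "(\<lambda>u. if x = k \<and> u = [] then 1 else 0) = (if x = k then (\<lambda>u. if u = [] then 1 else 0) else (\<lambda>_. 0 :: int))"
    by auto
  then show "nc_coeff (nc_var k * f) (x # w) = (if x = k then nc_coeff f w else 0)"
    by (simp add: nc_coeff_mult nc_var_def conv_one_left)
qed (simp add: nc_coeff_mult)

lemma nc_coeff_mult_var: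
  "nc_coeff (f * nc_var k) [] = 0"
  "nc_coeff (f * nc_var k) (w @ [x]) = (if x = k then nc_coeff f w else 0)"
proof -
  have "conv f (\<lambda>u. if u = [k] then 1 else 0) (w @ [x]) = (if x = k then f w else 0)" for f
    by (induction w arbitrary: f) auto
  then show "nc_coeff (f * nc_var k) (w @ [x]) = (if x = k then nc_coeff f w else 0)"
    by (simp add: nc_coeff_mult nc_var_def)
qed (simp add: nc_coeff_mult)

text \<open>Comparing the coefficients of the word \<open>k # v\<close> on both sides shows that a
  nonempty word \<open>v\<close> in the support of \<open>f\<close> ends in \<open>k\<close>, and
  that moving this last letter to the front stays in the support. Under repeated rotation every
  letter of \<open>w\<close> comes last in its turn, so all of them are \<open>k\<close>.\<close>

lemma commutes_nc_var:
  assumes comm: "nc_var k * f = f * nc_var k" and w: "nc_coeff f w \<noteq> 0"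
  shows "w = replicate (length w) k"
proof -
  have step: "last v = k \<and> nc_coeff f (k # butlast v) \<noteq> 0" if "nc_coeff f v \<noteq> 0" "v \<noteq> []" for v
  proof -
    have v: "v = butlast v @ [last v]" using that by simp
    have "nc_coeff f v = nc_coeff (nc_var k * f) (k # v)" by (simp add: nc_coeff_var_mult)
    also have "\<dots> = nc_coeff (f * nc_var k) ((k # butlast v) @ [last v])"
      using v comm by simp
    also have "\<dots> = (if last v = k then nc_coeff f (k # butlast v) else 0)"
      by (rule nc_coeff_mult_var)
    finally show ?thesis using that by (auto split: if_splits)
  qed
  have "\<exists>v. w = v @ replicate j k \<and> nc_coeff f (replicate j k @ v) \<noteq> 0" if "j \<le> length w" for j
    using that
  proof (induction j)
    case 0
    then show ?case using w by simp
  next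
    case (Suc j)
    then obtain v where v: "w = v @ replicate j k" "nc_coeff f (replicate j k @ v) \<noteq> 0" by auto
    then have ne: "v \<noteq> []" using Suc.prems by auto
    then have "last v = k" "nc_coeff f (k # replicate j k @ butlast v) \<noteq> 0"
      using step[OF v(2)] by (auto simp: butlast_append)
    moreover have "v = butlast v @ [last v]" using ne by simp
    ultimately have "w = butlast v @ replicate (Suc j) k"
      using v(1) by (metis append.assoc append_Cons append_Nil replicate_Suc)
    then show ?case using \<open>nc_coeff f (k # replicate j k @ butlast v) \<noteq> 0\<close> by auto
  qed
  from this[of "length w"] obtain v where v: "w = v @ replicate (length w) k" by auto
  then have "length w = length v + length w" by (metis length_append length_replicate)
  then show ?thesis using v by simp
qed

section \<open>The filtration by order and the commutator Lie ring\<close>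

definition nc_order :: "nat \<Rightarrow> 'a nc_series set" where
  "nc_order d = {f. \<forall>w. length w < d \<longrightarrow> nc_coeff f w = 0}"

lemma nc_order_zero [simp]: "0 \<in> nc_order d"
  and nc_order_add: "\<lbrakk>f \<in> nc_order d; g \<in> nc_order d\<rbrakk> \<Longrightarrow> f + g \<in> nc_order d"
  and nc_order_diff: "\<lbrakk>f \<in> nc_order d; g \<in> nc_order d\<rbrakk> \<Longrightarrow> f - g \<in> nc_order d"
  and nc_order_uminus: "f \<in> nc_order d \<Longrightarrow> - f \<in> nc_order d"
  and nc_order_mono: "\<lbrakk>f \<in> nc_order d; e \<le> d\<rbrakk> \<Longrightarrow> f \<in> nc_order e"
  and nc_order_0 [simp]: "nc_order 0 = UNIV"
  and nc_order_var: "nc_var k \<in> nc_order 1"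
  by (auto simp: nc_order_def)

lemma nc_order_mult:
  assumes "f \<in> nc_order d" "g \<in> nc_order e"
  shows "f * g \<in> nc_order (d + e)"
proof -
  have "nc_coeff (f * g) w = 0" if "length w < d + e" for w
  proof (rule ccontr)
    assume "nc_coeff (f * g) w \<noteq> 0"
    then obtain u v where "w = u @ v" "nc_coeff f u \<noteq> 0" "nc_coeff g v \<noteq> 0"
      unfolding nc_coeff_mult by (rule conv_nonzeroE)
    then show False using assms that by (auto simp: nc_order_def) (meson add_less_mono not_le add_mono leD leI)
  qed
  then show ?thesis by (simp add: nc_order_def)
qed

lemma nc_order_mult_left: "g \<in> nc_order e \<Longrightarrow> f * g \<in> nc_order e"
  and nc_order_mult_right: "g \<in> nc_order e \<Longrightarrow> g * f \<in> nc_order e"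
  using nc_order_mult[of f 0 g e] nc_order_mult[of g e f 0] by simp_all

definition nc_lie :: "'a nc_series lie_ring" where
  "nc_lie = \<lparr>carrier = UNIV, monoid.mult = (+), one = 0, bracket = (\<lambda>f g. f * g - g * f)\<rparr>"

lemma nc_lie_simps [simp]:
  "carrier nc_lie = UNIV" "x \<otimes>\<^bsub>nc_lie\<^esub> y = x + y" "\<one>\<^bsub>nc_lie\<^esub> = 0"
  "bracket nc_lie x y = x * y - y * x"
  by (simp_all add: nc_lie_def)

lemma nc_lie_ring: "lie_ring nc_lie"
proof (rule lie_ring.intro)
  show "comm_group (nc_lie :: 'a nc_series lie_ring)"
  proof (rule comm_groupI)
    show "\<exists>y\<in>carrier nc_lie. y \<otimes>\<^bsub>nc_lie\<^esub> x = \<one>\<^bsub>nc_lie\<^esub>" for x :: "'a nc_series"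
      by (rule bexI[of _ "- x"]) simp_all
  qed (simp_all add: algebra_simps)
  show "lie_ring_axioms (nc_lie :: 'a nc_series lie_ring)"
    by unfold_locales (simp_all add: algebra_simps)
qed

section \<open>Lyndon words\<close>

lemma list_less_iff:
  fixes u v :: "'a::linorder list"
  shows "u < v \<longleftrightarrow> (\<exists>a v'. v = u @ a # v') \<or> (\<exists>p a b u' v'. a < b \<and> u = p @ a # u' \<and> v = p @ b # v')"
  by (auto simp: list_less_def lexord_def)

lemma list_less_append: "v \<noteq> [] \<Longrightarrow> u < u @ v" for u v :: "'a::linorder list"
  by (cases v) (auto simp: list_less_iff)

lemma append_less_append_iff [simp]: "w @ u < w @ v \<longleftrightarrow> u < v" for u v w :: "'a::linorder list"
  by (induction w) simp_all

text \<open>The length bound keeps \<open>u\<close> from being a proper prefix of \<open>v\<close>,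
  so the comparison is settled at a letter and no continuation can reverse it.\<close>

lemma less_append_appendI:
  fixes u v :: "'a::linorder list"
  assumes "u < v" "length v \<le> length u"
  shows "u @ x < v @ y"
proof -
  have "\<not> (\<exists>a v'. v = u @ a # v')" using assms(2) by auto
  then obtain p a b u' v' where "a < b" "u = p @ a # u'" "v = p @ b # v'"
    using assms(1) by (auto simp: list_less_iff)
  then show ?thesis unfolding list_less_iff by fastforce
qed

lemma le_append_appendI:
  fixes u v :: "'a::linorder list"
  assumes "u \<le> u'" "v \<le> v'" "length u' = length u"
  shows "u @ v \<le> u' @ v'"
proof (cases "u = u'")
  case True
  then show ?thesis using assms(2) by (cases "v = v'") (auto simp: order.order_iff_strict)
next
  case False
  then have "u @ v < u' @ v'" using assms by (intro less_append_appendI) auto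
  then show ?thesis by simp
qed

definition lyndon_word :: "'a::linorder list \<Rightarrow> bool" where
  "lyndon_word w \<longleftrightarrow> w \<noteq> [] \<and> (\<forall>u v. w = u @ v \<longrightarrow> u \<noteq> [] \<longrightarrow> v \<noteq> [] \<longrightarrow> w < v)"

text \<open>If \<open>u\<close> is a proper prefix of \<open>v\<close>, the rest of \<open>v\<close>
  is a proper suffix and exceeds the Lyndon word \<open>v\<close>; prefixing \<open>u\<close> to
  both gives the claim. Otherwise a mismatched letter decides.\<close>

lemma lyndon_append_less:
  assumes "lyndon_word v" "u \<noteq> []" "u < v"
  shows "u @ v < v"
  using assms(3) unfolding list_less_iff[of u v]
proof (elim disjE exE conjE)
  fix a v' assume v: "v = u @ a # v'"
  then have "v < a # v'" using assms(1,2) by (auto simp: lyndon_word_def)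
  then have "u @ v < u @ a # v'" by simp
  then show ?thesis by (simp add: v)
next
  fix p a b u' v' assume "a < b" "u = p @ a # u'" "v = p @ b # v'"
  then show ?thesis unfolding list_less_iff by fastforce
qed

text \<open>A suffix that starts inside \<open>u\<close> is compared by means of \<open>u\<close>,
  and one that starts inside \<open>v\<close> is larger than \<open>v\<close>, which already exceeds
  \<open>u @ v\<close>.\<close>

lemma lyndon_word_append:
  assumes u: "lyndon_word u" and v: "lyndon_word v" and "u < v"
  shows "lyndon_word (u @ v)"
  unfolding lyndon_word_def
proof (intro conjI allI impI)
  show "u @ v \<noteq> []" using u by (simp add: lyndon_word_def)
  fix p q assume pq: "u @ v = p @ q" "p \<noteq> []" "q \<noteq> []"
  have uv: "u @ v < v" using assms by (intro lyndon_append_less) (auto simp: lyndon_word_def)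
  from pq(1) consider r where "u = p @ r" "r @ v = q" | r where "u @ r = p" "v = r @ q"
    by (auto simp: append_eq_append_conv2)
  then show "u @ v < q"
  proof cases
    case 1
    show ?thesis
    proof (cases "r = []")
      case False
      then have "u < r" using u 1 pq by (auto simp: lyndon_word_def)
      then have "u @ v < r @ v" by (rule less_append_appendI) (simp add: 1)
      then show ?thesis using 1 by simp
    qed (use 1 uv in simp)
  next
    case 2
    show ?thesis
    proof (cases "r = []")
      case False
      then have "v < q" using v 2 pq by (auto simp: lyndon_word_def)
      then show ?thesis using uv by simp
    qed (use 2 uv in simp)
  qed
qed

fun lie_word :: "'x lie_term \<Rightarrow> 'x list" where
  "lie_word (LGen x) = [x]"
| "lie_word (LBr s t) = lie_word s @ lie_word t"
| "lie_word _ = []"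

text \<open>The bracketings of Lyndon words by their standard factorizations: the last condition makes
  \<open>lie_word t\<close> the smallest proper suffix.\<close>

inductive lyndon :: "'x::linorder lie_term \<Rightarrow> bool" where
  LGen: "lyndon (LGen x)"
| LBr: "\<lbrakk>lyndon s; lyndon t; lie_word s < lie_word t; \<And>a b. s = LBr a b \<Longrightarrow> lie_word t \<le> lie_word b\<rbrakk>
    \<Longrightarrow> lyndon (LBr s t)"

inductive_cases lyndon_LBrE: "lyndon (LBr s t)"

lemma lyndon_word_lie_word: "lyndon t \<Longrightarrow> lyndon_word (lie_word t)"
proof (induction rule: lyndon.induct)
  case (LGen x)
  then show ?case by (auto simp: lyndon_word_def Cons_eq_append_conv)
qed (auto intro: lyndon_word_append)

lemma lie_word_nonempty: "lyndon t \<Longrightarrow> lie_word t \<noteq> []"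
  using lyndon_word_lie_word by (auto simp: lyndon_word_def)

lemma lyndon_LBr_less: "lyndon (LBr s t) \<Longrightarrow> lie_word s @ lie_word t < lie_word t"
  by (elim lyndon_LBrE) (intro lyndon_append_less lyndon_word_lie_word lie_word_nonempty)

text \<open>A proper suffix that starts strictly inside \<open>lie_word s\<close> is
  \<open>r @ lie_word t\<close>, where \<open>s = LBr a b\<close>; the induction gives
  \<open>lie_word b \<le> r\<close>, and the side condition of \<open>lyndon\<close> gives
  \<open>lie_word t \<le> lie_word b\<close>. A suffix inside \<open>lie_word t\<close> is no
  smaller because that word is Lyndon.\<close>

lemma lyndon_smallest_suffix:
  assumes "lyndon (LBr s t)" "lie_word s @ lie_word t = p @ q" "p \<noteq> []" "q \<noteq> []"
  shows "lie_word t \<le> q"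
  using assms
proof (induction "LBr s t" arbitrary: s t p q rule: lyndon.induct)
  case (LBr s t)
  from LBr.prems(1) consider r where "lie_word s = p @ r" "r @ lie_word t = q" | r where "lie_word t = r @ q"
    by (auto simp: append_eq_append_conv2)
  then show ?case
  proof cases
    case 1
    show ?thesis
    proof (cases "r = []")
      case False
      have "\<exists>a b. s = LBr a b"
      proof (cases s)
        case (LGen x)
        then show ?thesis using 1 LBr.prems False by (auto simp: Cons_eq_append_conv)
      qed (use LBr.hyps(1) in \<open>auto elim: lyndon.cases\<close>)
      then obtain a b where s: "s = LBr a b" by blast
      have "lie_word t \<le> lie_word b" using LBr.hyps s by blast
      also have "\<dots> \<le> r" using LBr.hyps(2)[OF s, of p r] 1 LBr.prems False s by simp
      also have "\<dots> < q" using 1 list_less_append[of "lie_word t" r] lie_word_nonempty[OF LBr.hyps(3)] by simp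
      finally show ?thesis by simp
    qed (use 1 in simp)
  next
    case 2
    then show ?thesis
      using lyndon_word_lie_word[OF LBr.hyps(3)] LBr.prems(3)
      by (cases "r = []") (auto simp: lyndon_word_def intro: less_imp_le)
  qed
qed

text \<open>The right factor of a Lyndon bracket carries the smallest proper suffix of the word. So
  the word determines where it is split and, recursively, the whole bracketing.\<close>

lemma lie_word_inj:
  assumes "lyndon s" "lyndon t" "lie_word s = lie_word t"
  shows "s = t"
  using assms
proof (induction arbitrary: t rule: lyndon.induct)
  case (LGen x)
  from LGen.prems(1) show ?case
  proof cases
    case (LBr a b)
    then have "[x] = lie_word a @ lie_word b" using LGen.prems(2) by simp
    moreover have "lie_word a \<noteq> []" "lie_word b \<noteq> []"
      using LBr lie_word_nonempty by auto
    ultimately show ?thesis by (auto simp: Cons_eq_append_conv)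
  qed (use LGen in simp)
next
  case (LBr a b)
  from LBr.prems(1) show ?case
  proof cases
    case (LGen x)
    then have "[x] = lie_word a @ lie_word b" using LBr.prems(2) by simp
    moreover have "lie_word a \<noteq> []" "lie_word b \<noteq> []"
      using LBr.hyps lie_word_nonempty by auto
    ultimately show ?thesis by (auto simp: Cons_eq_append_conv)
  next
    case (LBr c d)
    have ab: "lyndon (LBr a b)" by (rule lyndon.LBr) (use \<open>lyndon a\<close> LBr.hyps in auto)
    have eq: "lie_word a @ lie_word b = lie_word c @ lie_word d" using LBr.prems LBr by simp
    have ne: "lie_word a \<noteq> []" "lie_word b \<noteq> []" "lie_word c \<noteq> []" "lie_word d \<noteq> []"
      using \<open>lyndon a\<close> \<open>lyndon b\<close> LBr lie_word_nonempty by auto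
    have "lie_word b \<le> lie_word d" by (rule lyndon_smallest_suffix[OF ab eq]) (use ne in auto)
    moreover have "lie_word d \<le> lie_word b"
      using LBr.prems(1) eq ne unfolding LBr(1) by (intro lyndon_smallest_suffix[of c d]) auto
    ultimately have "lie_word b = lie_word d" by simp
    with eq have "lie_word a = lie_word c" by simp
    then show ?thesis using LBr \<open>lie_word b = lie_word d\<close> LBr.IH by auto
  qed
qed

section \<open>Leading words of Lyndon brackets\<close>

abbreviation nc_eval :: "'x lie_term \<Rightarrow> 'x nc_series" where
  "nc_eval \<equiv> lie_eval nc_lie nc_var"

text \<open>For a bracket the product in the given order has least word
  \<open>lie_word s @ lie_word t\<close>, with coefficient 1. Every word of the opposite product is
  at least \<open>lie_word t @ lie_word s\<close>, which is larger because
  \<open>lie_word s @ lie_word t < lie_word t\<close>. So nothing cancels at the leading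
  word.\<close>

lemma lyndon_leading_word:
  assumes "lyndon t"
  shows "nc_coeff (nc_eval t) (lie_word t) = 1"
    and "nc_coeff (nc_eval t) w \<noteq> 0 \<Longrightarrow> length w = length (lie_word t) \<and> lie_word t \<le> w"
proof -
  have "nc_coeff (nc_eval t) (lie_word t) = 1 \<and>
    (\<forall>w. nc_coeff (nc_eval t) w \<noteq> 0 \<longrightarrow> length w = length (lie_word t) \<and> lie_word t \<le> w)"
    using assms
  proof (induction rule: lyndon.induct)
    case (LBr s t)
    have "lyndon (LBr s t)" by (rule lyndon.LBr) (use LBr.hyps in auto)
    then have "lie_word s @ lie_word t < lie_word t" by (rule lyndon_LBr_less)
    also have "\<dots> < lie_word t @ lie_word s"
      using list_less_append lie_word_nonempty LBr.hyps by blast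
    finally have less: "lie_word s @ lie_word t < lie_word t @ lie_word s" .
    have prod: "length w = length (lie_word a) + length (lie_word b) \<and> lie_word a @ lie_word b \<le> w"
      if "nc_coeff (nc_eval a * nc_eval b) w \<noteq> 0" and
        "\<And>w. nc_coeff (nc_eval a) w \<noteq> 0 \<Longrightarrow> length w = length (lie_word a) \<and> lie_word a \<le> w"
        "\<And>w. nc_coeff (nc_eval b) w \<noteq> 0 \<Longrightarrow> length w = length (lie_word b) \<and> lie_word b \<le> w"
      for a b :: "'a lie_term" and w
    proof -
      from that(1) obtain u v where "w = u @ v" "nc_coeff (nc_eval a) u \<noteq> 0" "nc_coeff (nc_eval b) v \<noteq> 0"
        unfolding nc_coeff_mult by (rule conv_nonzeroE)
      with that(2)[of u] that(3)[of v] show ?thesis by (auto intro: le_append_appendI)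
    qed
    have st: "length w = length (lie_word s) + length (lie_word t) \<and> lie_word s @ lie_word t \<le> w"
      if "nc_coeff (nc_eval s * nc_eval t) w \<noteq> 0" for w
      using prod[OF that] LBr.IH by blast
    have ts: "length w = length (lie_word t) + length (lie_word s) \<and> lie_word t @ lie_word s \<le> w"
      if "nc_coeff (nc_eval t * nc_eval s) w \<noteq> 0" for w
      using prod[OF that] LBr.IH by blast
    have "nc_coeff (nc_eval t * nc_eval s) (lie_word s @ lie_word t) = 0"
    proof (rule ccontr)
      assume "nc_coeff (nc_eval t * nc_eval s) (lie_word s @ lie_word t) \<noteq> 0"
      from ts[OF this] have "lie_word t @ lie_word s \<le> lie_word s @ lie_word t" by blast
      with less show False using leD by blast
    qed
    moreover have "nc_coeff (nc_eval s * nc_eval t) (lie_word s @ lie_word t) = 1"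
    proof -
      have "nc_coeff (nc_eval s * nc_eval t) (lie_word s @ lie_word t) =
          nc_coeff (nc_eval s) (lie_word s) * nc_coeff (nc_eval t) (lie_word t)"
        unfolding nc_coeff_mult by (rule conv_append) (use LBr.IH in blast)
      moreover have "nc_coeff (nc_eval s) (lie_word s) = 1" "nc_coeff (nc_eval t) (lie_word t) = 1"
        using LBr.IH by blast+
      ultimately show ?thesis by simp
    qed
    moreover have "length w = length (lie_word s) + length (lie_word t) \<and> lie_word s @ lie_word t \<le> w"
      if "nc_coeff (nc_eval s * nc_eval t) w \<noteq> nc_coeff (nc_eval t * nc_eval s) w" for w
    proof (cases "nc_coeff (nc_eval s * nc_eval t) w = 0")
      case True
      with that have "nc_coeff (nc_eval t * nc_eval s) w \<noteq> 0" by simp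
      from ts[OF this] less_imp_le[OF less] show ?thesis
        using order.trans add.commute by metis
    qed (use st in blast)
    ultimately show ?case by (simp add: order.trans)
  qed (auto split: if_splits)
  then show "nc_coeff (nc_eval t) (lie_word t) = 1"
    and "nc_coeff (nc_eval t) w \<noteq> 0 \<Longrightarrow> length w = length (lie_word t) \<and> lie_word t \<le> w"
    by blast+
qed

lemma nc_eval_support:
  assumes "nc_coeff (nc_eval t) w \<noteq> 0"
  shows "w \<noteq> [] \<and> set w \<subseteq> lie_term_gens t"
  using assms
proof (induction t arbitrary: w)
  case (LNeg t)
  interpret L: lie_ring nc_lie by (rule nc_lie_ring)
  have "inv\<^bsub>nc_lie\<^esub> (nc_eval t) = - nc_eval t" by (rule L.inv_equality) simp_all
  then show ?case using LNeg by simp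
next
  case (LAdd s t)
  then have "nc_coeff (nc_eval s) w \<noteq> 0 \<or> nc_coeff (nc_eval t) w \<noteq> 0" by auto
  then show ?case using LAdd.IH by auto
next
  case (LBr s t)
  have "nc_coeff (nc_eval s * nc_eval t) w \<noteq> 0 \<or> nc_coeff (nc_eval t * nc_eval s) w \<noteq> 0"
    using LBr.prems by auto
  then obtain u v where "w = u @ v"
    "nc_coeff (nc_eval s) u \<noteq> 0 \<and> nc_coeff (nc_eval t) v \<noteq> 0 \<or> nc_coeff (nc_eval t) u \<noteq> 0 \<and> nc_coeff (nc_eval s) v \<noteq> 0"
    unfolding nc_coeff_mult by (metis conv_nonzeroE)
  then show ?case using LBr.IH[of u] LBr.IH[of v] LBr.IH(1)[of v] LBr.IH(2)[of u] by auto
qed (auto split: if_splits)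

definition lyndon_terms :: "'x::linorder set \<Rightarrow> 'x lie_term set" where
  "lyndon_terms A = {t. lyndon t \<and> lie_term_gens t \<subseteq> A}"

lemma set_lie_word: "set (lie_word t) \<subseteq> lie_term_gens t"
  by (induction t rule: lie_word.induct) auto

lemma (in group) generate_hom_subset:
  assumes "group_hom G H h" "subgroup K H" "h ` B \<subseteq> K" "B \<subseteq> carrier G"
  shows "h ` generate G B \<subseteq> K"
proof -
  interpret h: group_hom G H h by fact
  have "h ` generate G B = generate H (h ` B)" using assms(4) by (rule h.generate_img[symmetric])
  also have "\<dots> \<subseteq> K" using assms(2,3) h.H.generate_subgroup_incl by blast
  finally show ?thesis .
qed

section \<open>Integer combinations of Lyndon brackets are closed under the bracket\<close>

context lie_ring
begin

lemma bracket_hom_left: "y \<in> carrier L \<Longrightarrow> group_hom L L (\<lambda>x. bracket L x y)"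
  by unfold_locales (auto simp: hom_def bracket_closed bracket_add_left)

lemma bracket_hom_right: "x \<in> carrier L \<Longrightarrow> group_hom L L (bracket L x)"
  by unfold_locales (auto simp: hom_def bracket_closed bracket_add_right)

lemma bracket_one [simp]:
  "x \<in> carrier L \<Longrightarrow> bracket L x \<one> = \<one>" "x \<in> carrier L \<Longrightarrow> bracket L \<one> x = \<one>"
  using group_hom.hom_one[OF bracket_hom_right] group_hom.hom_one[OF bracket_hom_left] by blast+

lemma bracket_inv:
  "\<lbrakk>x \<in> carrier L; y \<in> carrier L\<rbrakk> \<Longrightarrow> bracket L x (inv y) = inv (bracket L x y)"
  "\<lbrakk>x \<in> carrier L; y \<in> carrier L\<rbrakk> \<Longrightarrow> bracket L (inv y) x = inv (bracket L y x)"
  using group_hom.hom_inv[OF bracket_hom_right] group_hom.hom_inv[OF bracket_hom_left] by blast+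

lemma bracket_antisym:
  assumes "x \<in> carrier L" "y \<in> carrier L"
  shows "bracket L y x = inv (bracket L x y)"
proof -
  have "bracket L (x \<otimes> y) (x \<otimes> y) = \<one>" using assms by (intro bracket_self) simp
  moreover have "bracket L (x \<otimes> y) (x \<otimes> y) = bracket L x (x \<otimes> y) \<otimes> bracket L y (x \<otimes> y)"
    using assms by (intro bracket_add_left) auto
  ultimately have "bracket L y x \<otimes> bracket L x y = \<one>"
    using assms by (simp add: bracket_add_right bracket_closed bracket_self m_comm)
  then show ?thesis
    using assms by (intro inv_equality[symmetric]) (simp_all add: bracket_closed m_comm)
qed

text \<open>The Jacobi identity as a derivation rule for bracketing with \<open>z\<close> on the
  right, the form in which nested brackets are rewritten later.\<close>

lemma bracket_bracket_left:
  assumes "x \<in> carrier L" "y \<in> carrier L" "z \<in> carrier L"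
  shows "bracket L (bracket L x y) z = bracket L (bracket L x z) y \<otimes> bracket L x (bracket L y z)"
proof -
  have "bracket L (bracket L x z) y = bracket L y (bracket L z x)"
    using assms bracket_antisym[of z x] bracket_antisym[of y "bracket L z x"]
    by (simp add: bracket_closed bracket_inv)
  moreover have "bracket L z (bracket L x y) = inv (bracket L (bracket L x y) z)"
    using assms by (intro bracket_antisym) (auto intro: bracket_closed)
  ultimately have "bracket L x (bracket L y z) \<otimes> bracket L (bracket L x z) y \<otimes> inv (bracket L (bracket L x y) z) = \<one>"
    using jacobi[OF assms] by simp
  then have "bracket L x (bracket L y z) \<otimes> bracket L (bracket L x z) y = bracket L (bracket L x y) z"
    using assms by (simp add: bracket_closed inv_solve_right')
  then show ?thesis using assms by (simp add: bracket_closed m_comm)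
qed

lemma bracket_generate_left:
  assumes "z \<in> generate L B" "B \<subseteq> carrier L" "v \<in> carrier L" "subgroup K L"
    and "\<And>b. b \<in> B \<Longrightarrow> bracket L b v \<in> K"
  shows "bracket L z v \<in> K"
  using generate_hom_subset[OF bracket_hom_left[OF assms(3)] assms(4) _ assms(2)] assms(1,5) by blast

lemma bracket_generate_right:
  assumes "z \<in> generate L B" "B \<subseteq> carrier L" "v \<in> carrier L" "subgroup K L"
    and "\<And>b. b \<in> B \<Longrightarrow> bracket L v b \<in> K"
  shows "bracket L v z \<in> K"
  using generate_hom_subset[OF bracket_hom_right[OF assms(3)] assms(4) _ assms(2)] assms(1,5) by blast

text \<open>The induction is on the total length first and then on the greater of the two words; the
  critical case rewrites \<open>[[x, y], t]\<close> by the Jacobi identity.\<close>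

lemma bracket_lyndon:
  assumes A: "finite A" and g: "\<And>x. g x \<in> carrier L"
    and "s \<in> lyndon_terms A" "t \<in> lyndon_terms A"
  shows "bracket L (lie_eval L g s) (lie_eval L g t) \<in> generate L (lie_eval L g ` {r \<in> lyndon_terms A.
    length (lie_word r) = length (lie_word s) + length (lie_word t) \<and> lie_word r < max (lie_word s) (lie_word t)})"
proof -
  let ?e = "lie_eval L g"
  note cl = lie_eval_closed[of g, OF g]
  define Sp where "Sp n b = generate L (?e ` {r \<in> lyndon_terms A. length (lie_word r) = n \<and> lie_word r < b})" for n b
  have sub: "?e ` R \<subseteq> carrier L" for R using cl by blast
  have Sp: "subgroup (Sp n b) L" for n b unfolding Sp_def by (intro generate_is_subgroup sub)
  have Sp_mono: "Sp n b \<subseteq> Sp n b'" if "b \<le> b'" for n b b'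
    unfolding Sp_def using that by (intro mono_generate) auto
  have Sp_one: "\<one> \<in> Sp n b" for n b using Sp by (rule subgroup.one_closed)
  have "bracket L (?e s) (?e t) \<in> Sp (length (lie_word s) + length (lie_word t)) (max (lie_word s) (lie_word t))"
    using assms(3,4)
  proof (induction "length (lie_word s) + length (lie_word t)" arbitrary: s t rule: less_induct)
    case outer: (less s t)
    define N where "N = length (lie_word s) + length (lie_word t)"
    \<comment> \<open>The lexicographic order on words is not well founded in general. Restricted to
      the finitely many words over \<open>A\<close> of length at most \<open>N\<close> it yields a
      measure for the inner induction.\<close>
    define below where "below b = {w. set w \<subseteq> A \<and> length w \<le> N \<and> w < b}" for b
    have fin: "finite (below b)" for b
      by (rule finite_subset[OF _ finite_lists_length_le[OF A, of N]]) (auto simp: below_def)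
    have main: "bracket L (?e s') (?e t') \<in> Sp N (max (lie_word s') (lie_word t'))"
      if "s' \<in> lyndon_terms A" "t' \<in> lyndon_terms A" "length (lie_word s') + length (lie_word t') = N" for s' t'
      using that
    proof (induction "card (below (max (lie_word s') (lie_word t')))" arbitrary: s' t' rule: less_induct)
      case inner: (less s t)
      have IH: "bracket L (?e x) (?e y) \<in> Sp N b"
        if "x \<in> lyndon_terms A" "y \<in> lyndon_terms A" "length (lie_word x) + length (lie_word y) = N"
          "lie_word x < b" "lie_word y < b" "b = max (lie_word s) (lie_word t)" for x y b
      proof -
        let ?m = "max (lie_word x) (lie_word y)"
        have m: "?m < b" using that by simp
        have mono: "w \<in> below b" if "w \<in> below ?m" for w
          using that m unfolding below_def by (blast intro: less_trans)
        have "below ?m \<subset> below b"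
        proof (rule psubsetI)
          have "?m \<in> below b" using that m set_lie_word[of x] set_lie_word[of y]
            by (auto simp: below_def lyndon_terms_def max_def)
          then show "below ?m \<noteq> below b" by (auto simp: below_def)
        qed (use mono in blast)
        then have "card (below ?m) < card (below b)" by (intro psubset_card_mono fin)
        then have "bracket L (?e x) (?e y) \<in> Sp N ?m" using that by (intro inner.hyps) auto
        then show ?thesis using Sp_mono[OF less_imp_le[OF m]] by blast
      qed
      have less: "bracket L (?e s') (?e t') \<in> Sp N (lie_word t')"
        if st: "s' \<in> lyndon_terms A" "t' \<in> lyndon_terms A" "length (lie_word s') + length (lie_word t') = N"
          and lt: "lie_word s' < lie_word t'" and m: "lie_word t' = max (lie_word s) (lie_word t)" for s' t'
      proof (cases "lyndon (LBr s' t')")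
        case True
        then show ?thesis
          using lyndon_LBr_less[OF True] st unfolding Sp_def
          by (intro generate.incl image_eqI[of _ _ "LBr s' t'"]) (auto simp: lyndon_terms_def)
      next
        case False
        have st': "lyndon s'" "lyndon t'" using st by (auto simp: lyndon_terms_def)
        \<comment> \<open>Only the side condition of \<open>lyndon\<close> can fail here, so
          \<open>s'\<close> is a bracket whose right factor has a smaller word than
          \<open>t'\<close>. This is the critical case.\<close>
        with False lt obtain x y where s': "s' = LBr x y" and yt: "lie_word y < lie_word t'"
          using lyndon.LBr[of s' t'] by (metis not_le)
        have xy: "lyndon x" "lyndon y" "lie_word x < lie_word y"
          using st'(1) unfolding s' by (auto elim: lyndon_LBrE)
        then have xyA: "x \<in> lyndon_terms A" "y \<in> lyndon_terms A"
          using st(1) by (auto simp: s' lyndon_terms_def)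
        have len: "length (lie_word x) + length (lie_word y) + length (lie_word t') = N"
          using st(3) by (simp add: s')
        have pos: "length (lie_word x) > 0" "length (lie_word y) > 0"
          using xy lie_word_nonempty by auto
        have xt: "lie_word x < lie_word t'" using xy(3) yt by simp
        have 1: "bracket L (?e x) (?e t') \<in> Sp (length (lie_word x) + length (lie_word t')) (lie_word t')"
          using outer.hyps[of x t'] len pos xyA st(2) max_absorb2[OF less_imp_le[OF xt]] by (simp add: N_def[symmetric])
        have 2: "bracket L (?e y) (?e t') \<in> Sp (length (lie_word y) + length (lie_word t')) (lie_word t')"
          using outer.hyps[of y t'] len pos xyA st(2) max_absorb2[OF less_imp_le[OF yt]] by (simp add: N_def[symmetric])
        \<comment> \<open>The Lyndon terms that span \<open>[x, t']\<close> have words below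
          \<open>lie_word t'\<close>, and so has \<open>y\<close>. Their brackets with
          \<open>y\<close> have total length \<open>N\<close> again but a smaller maximum, as the
          inner hypothesis requires. The next step treats \<open>[x, [y, t']]\<close> in the same
          way.\<close>
        have 3: "bracket L (bracket L (?e x) (?e t')) (?e y) \<in> Sp N (lie_word t')"
          by (rule bracket_generate_left[OF 1[unfolded Sp_def] sub cl Sp])
            (use IH xyA yt m len in auto)
        have 4: "bracket L (?e x) (bracket L (?e y) (?e t')) \<in> Sp N (lie_word t')"
          by (rule bracket_generate_right[OF 2[unfolded Sp_def] sub cl Sp])
            (use IH xyA xt m len in auto)
        show ?thesis
          using subgroup.m_closed[OF Sp 3 4] cl
          by (simp add: s' bracket_bracket_left[of "?e x" "?e y" "?e t'"])
      qed
      consider "lie_word s < lie_word t" | "lie_word t < lie_word s" | "lie_word s = lie_word t"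
        by (meson linorder_less_linear)
      then show ?case
      proof cases
        case 1
        then have "max (lie_word s) (lie_word t) = lie_word t" by (intro max_absorb2 less_imp_le)
        then show ?thesis using less[of s t] inner.prems 1 by simp
      next
        case 2
        then have m: "max (lie_word s) (lie_word t) = lie_word s" by (intro max_absorb1 less_imp_le)
        then have "bracket L (?e t) (?e s) \<in> Sp N (lie_word s)"
          using less[of t s] inner.prems 2 by (simp add: add.commute)
        then have "bracket L (?e s) (?e t) \<in> Sp N (lie_word s)"
          using bracket_antisym[of "?e t" "?e s"] cl subgroup.m_inv_closed[OF Sp] by simp
        then show ?thesis by (simp add: m)
      next
        case 3
        then have "s = t" using inner.prems lie_word_inj by (auto simp: lyndon_terms_def)
        then show ?thesis using cl Sp_one by (simp add: bracket_self)
      qed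
    qed
    show ?case using main[OF outer.prems] by (simp add: N_def)
  qed
  then show ?thesis by (simp add: Sp_def)
qed

lemma bracket_generate_lyndon:
  assumes "finite A" "\<And>x. g x \<in> carrier L" "s \<in> lyndon_terms A" "t \<in> lyndon_terms A"
  shows "bracket L (lie_eval L g s) (lie_eval L g t) \<in> generate L (lie_eval L g ` lyndon_terms A)"
  using bracket_lyndon[OF assms] by (rule subsetD[OF mono_generate, rotated]) auto

end

section \<open>Linear independence of Lyndon brackets\<close>

lemma (in comm_group) finprod_one_point: "f a \<in> carrier G \<Longrightarrow> finprod G f {a} = f a"
  using finprod_insert[of "{}" a f] by simp

lemma (in comm_group) generate_finprod:
  assumes "z \<in> generate G (f ` A)" "f \<in> A \<rightarrow> carrier G"
  shows "\<exists>T c. finite T \<and> T \<subseteq> A \<and> z = finprod G (\<lambda>t. f t [^] (c t :: int)) T"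
  using assms(1)
proof (induction rule: generate.induct)
  case one
  then show ?case by (intro exI[of _ "{}"]) auto
next
  case (incl h)
  then obtain a where a: "a \<in> A" "h = f a" by auto
  then have fa: "f a \<in> carrier G" using assms(2) by auto
  have "h = finprod G (\<lambda>t. f t [^] (1 :: int)) {a}"
    unfolding a(2) using fa by (subst finprod_one_point) (simp_all only: int_pow_1)
  then have "finite {a} \<and> {a} \<subseteq> A \<and> h = finprod G (\<lambda>t. f t [^] (1 :: int)) {a}"
    using a(1) by blast
  then show ?case by (intro exI[where x="{a}"] exI[where x="\<lambda>_. 1 :: int"])
next
  case (inv h)
  then obtain a where a: "a \<in> A" "h = f a" by auto
  then have fa: "f a \<in> carrier G" using assms(2) by auto
  have "inv h = finprod G (\<lambda>t. f t [^] (- 1 :: int)) {a}"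
    unfolding a(2) using fa by (subst finprod_one_point) (simp_all only: int_pow_1 int_pow_neg inv_closed)
  then have "finite {a} \<and> {a} \<subseteq> A \<and> inv h = finprod G (\<lambda>t. f t [^] (- 1 :: int)) {a}"
    using a(1) by blast
  then show ?case by (intro exI[where x="{a}"] exI[where x="\<lambda>_. - 1 :: int"])
next
  case (eng h1 h2)
  then obtain T1 c1 T2 c2 where 1: "finite T1" "T1 \<subseteq> A" "h1 = finprod G (\<lambda>t. f t [^] (c1 t :: int)) T1"
    and 2: "finite T2" "T2 \<subseteq> A" "h2 = finprod G (\<lambda>t. f t [^] (c2 t :: int)) T2" by blast
  \<comment> \<open>Extending both exponent functions by zero to the union of the two index sets
    lets the exponents be added termwise.\<close>
  define d1 where "d1 t = (if t \<in> T1 then c1 t else 0)" for t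
  define d2 where "d2 t = (if t \<in> T2 then c2 t else 0)" for t
  have fc: "f t \<in> carrier G" if "t \<in> T1 \<union> T2" for t using that 1 2 assms(2) by auto
  have "h1 = finprod G (\<lambda>t. f t [^] d1 t) (T1 \<union> T2)"
    unfolding 1(3) by (rule finprod_mono_neutral_cong_left) (use 1 2 fc in \<open>auto simp: d1_def\<close>)
  moreover have "h2 = finprod G (\<lambda>t. f t [^] d2 t) (T1 \<union> T2)"
    unfolding 2(3) by (rule finprod_mono_neutral_cong_left) (use 1 2 fc in \<open>auto simp: d2_def\<close>)
  ultimately have "h1 \<otimes> h2 = finprod G (\<lambda>t. f t [^] d1 t \<otimes> f t [^] d2 t) (T1 \<union> T2)"
    using fc by (simp add: finprod_multf Pi_iff)
  also have "\<dots> = finprod G (\<lambda>t. f t [^] (d1 t + d2 t)) (T1 \<union> T2)"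
    by (rule finprod_cong') (use fc in \<open>auto simp: int_pow_mult\<close>)
  finally have "finite (T1 \<union> T2) \<and> T1 \<union> T2 \<subseteq> A \<and> h1 \<otimes> h2 = finprod G (\<lambda>t. f t [^] (d1 t + d2 t)) (T1 \<union> T2)"
    using 1(1,2) 2(1,2) by blast
  then show ?case by (intro exI[where x="T1 \<union> T2"] exI[where x="\<lambda>t. d1 t + d2 t"])
qed

lemma hom_finprod_nc_lie:
  assumes "lie_ring L" "group_hom L nc_lie e" "f \<in> T \<rightarrow> carrier L"
  shows "e (finprod L f T) = (\<Sum>t\<in>T. e (f t))"
proof -
  interpret L: lie_ring L by fact
  interpret e: group_hom L nc_lie e by fact
  show ?thesis
    using assms(3) by (induction T rule: infinite_finite_induct) (simp_all add: Pi_iff)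
qed

lemma nc_lie_int_pow: "x [^]\<^bsub>nc_lie\<^esub> (c :: int) = of_int c * x"
proof -
  interpret L: lie_ring "nc_lie :: 'a nc_series lie_ring" by (rule nc_lie_ring)
  have inv: "inv\<^bsub>nc_lie\<^esub> y = - y" for y :: "'a nc_series" by (rule L.inv_equality) simp_all
  have nat: "x [^]\<^bsub>nc_lie\<^esub> (k :: nat) = of_nat k * x" for k
    by (induction k) (simp_all add: algebra_simps)
  show ?thesis
  proof (cases c rule: int_cases)
    case (nonneg k)
    then show ?thesis using nat by (simp add: int_pow_int)
  next
    case (neg k)
    have "x [^]\<^bsub>nc_lie\<^esub> c = - (of_nat (Suc k) * x)"
      unfolding neg using L.int_pow_neg_int[of x "Suc k"] by (simp only: nat inv nc_lie_simps UNIV_I)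
    then show ?thesis unfolding neg by (simp only: of_int_minus of_int_of_nat_eq minus_mult_left)
  qed
qed

text \<open>Witt's theorem: the Lie subring of the power series ring generated by the variables is free.
  The words of the Lyndon terms are the leading words of their images.\<close>

lemma lyndon_span_injective:
  assumes L: "lie_ring L" and e: "group_hom L nc_lie e" and g: "\<And>x. g x \<in> carrier L"
    and eval: "\<And>t. t \<in> lyndon_terms A \<Longrightarrow> e (lie_eval L g t) = nc_eval t"
    and z: "z \<in> generate L (lie_eval L g ` lyndon_terms A)" and ez: "e z = 0"
  shows "z = \<one>\<^bsub>L\<^esub>"
proof -
  interpret L: lie_ring L by fact
  interpret e: group_hom L nc_lie e by fact
  have cl: "lie_eval L g t \<in> carrier L" for t using g by (rule L.lie_eval_closed)
  obtain T c where T: "finite T" "T \<subseteq> lyndon_terms A"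
    and z_eq: "z = finprod L (\<lambda>t. lie_eval L g t [^]\<^bsub>L\<^esub> (c t :: int)) T"
    using L.generate_finprod[OF z] cl by blast
  have "e z = (\<Sum>t\<in>T. e (lie_eval L g t [^]\<^bsub>L\<^esub> (c t :: int)))"
    unfolding z_eq by (rule hom_finprod_nc_lie[OF L e]) (use cl in auto)
  also have "\<dots> = (\<Sum>t\<in>T. of_int (c t) * nc_eval t)"
    using T cl by (intro sum.cong) (auto simp: eval e.hom_int_pow nc_lie_int_pow)
  finally have sum0: "(\<Sum>t\<in>T. of_int (c t) * nc_eval t) = 0" using ez by simp
  have "c t = 0" if "t \<in> T" for t
  proof (rule ccontr)
    assume "c t \<noteq> 0"
    \<comment> \<open>Among the terms with nonzero coefficient take the one whose word is smallest.
      At that word the others vanish, their leading words being larger, and the leading coefficient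
      1 returns \<open>c m\<close> itself, so the argument works over the integers.\<close>
    define T' where "T' = {t \<in> T. c t \<noteq> 0}"
    have "finite (lie_word ` T')" "lie_word ` T' \<noteq> {}" using T that \<open>c t \<noteq> 0\<close> by (auto simp: T'_def)
    then have "Min (lie_word ` T') \<in> lie_word ` T'" by (rule Min_in)
    then obtain m where m: "m \<in> T'" "lie_word m = Min (lie_word ` T')" by auto
    have min: "lie_word m \<le> lie_word t" if "t \<in> T'" for t
      using that T by (auto simp: m(2) T'_def)
    have lyn: "lyndon t" if "t \<in> T" for t using that T by (auto simp: lyndon_terms_def)
    have "0 = nc_coeff (\<Sum>t\<in>T. of_int (c t) * nc_eval t) (lie_word m)" by (simp add: sum0)
    also have "\<dots> = (\<Sum>t\<in>T. c t * nc_coeff (nc_eval t) (lie_word m))"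
      by (simp add: nc_coeff_sum nc_coeff_of_int_mult)
    also have "\<dots> = (\<Sum>t\<in>T. if t = m then c m else 0)"
    proof (rule sum.cong)
      fix t assume t: "t \<in> T"
      show "c t * nc_coeff (nc_eval t) (lie_word m) = (if t = m then c m else 0)"
      proof (cases "t = m")
        case False
        show ?thesis
        proof (rule ccontr)
          assume "\<not> ?thesis"
          then have "c t \<noteq> 0" "nc_coeff (nc_eval t) (lie_word m) \<noteq> 0" using False by auto
          then have "lie_word t \<le> lie_word m" "t \<in> T'"
            using t lyn lyndon_leading_word(2) by (auto simp: T'_def)
          then have "lie_word t = lie_word m" using min by (simp add: order.antisym)
          then have "t = m" using t m lyn by (intro lie_word_inj) (auto simp: T'_def)
          with False show False by simp
        qed
      qed (use m(1) lyn lyndon_leading_word(1)[of m] in \<open>simp add: T'_def\<close>)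
    qed simp
    also have "\<dots> = c m" using m T by (simp add: T'_def)
    finally show False using m by (simp add: T'_def)
  qed
  then show ?thesis unfolding z_eq using L.finprod_one_eqI[of T] by simp
qed

section \<open>The Magnus expansion\<close>

text \<open>The alternating geometric series, inverse to \<open>1 + nc_var x\<close>.\<close>

definition nc_inv_var :: "'a \<Rightarrow> 'a nc_series" where
  "nc_inv_var x = Abs_nc (\<lambda>u. if set u \<subseteq> {x} then (- 1) ^ length u else 0)"

lemma nc_inv_var_mult:
  "nc_inv_var x * (1 + nc_var x) = 1" "(1 + nc_var x) * nc_inv_var x = 1"
proof -
  have c: "nc_coeff (nc_inv_var x) u = (if set u \<subseteq> {x} then (- 1) ^ length u else 0)" for u
    by (simp add: nc_inv_var_def)
  show "(1 + nc_var x) * nc_inv_var x = 1"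
  proof (rule nc_eqI)
    fix w show "nc_coeff ((1 + nc_var x) * nc_inv_var x) w = nc_coeff 1 w"
      by (cases w) (auto simp: distrib_right nc_coeff_var_mult c)
  qed
  show "nc_inv_var x * (1 + nc_var x) = 1"
  proof (rule nc_eqI)
    fix w show "nc_coeff (nc_inv_var x * (1 + nc_var x)) w = nc_coeff 1 w"
      by (cases w rule: rev_cases) (auto simp: distrib_left nc_coeff_mult_var c)
  qed
qed

text \<open>The variable \<open>X\<close> is shifted into the expansion of the inverse of the generator, because the
  automorphism \<open>yaut n m i\<close> is the conjugation \<open>w \<mapsto> u w u\<inverse>\<close> by \<open>u = x_i\<inverse>\<close>.\<close>

definition magnus_letter :: "'a letter \<Rightarrow> 'a nc_series" where
  "magnus_letter a = (if snd a then nc_inv_var (fst a) else 1 + nc_var (fst a))"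

definition magnus :: "'a letter list \<Rightarrow> 'a nc_series" where
  "magnus w = foldr (\<lambda>a f. magnus_letter a * f) w 1"

lemma magnus_simps [simp]: "magnus [] = 1" "magnus (a # w) = magnus_letter a * magnus w"
  by (simp_all add: magnus_def)

lemma magnus_letter_inv: "magnus_letter a * magnus_letter (letter_inv a) = 1"
  by (simp add: magnus_letter_def letter_inv_def nc_inv_var_mult)

lemma magnus_push: "magnus (push a w) = magnus_letter a * magnus w"
  by (cases w) (simp_all add: mult.assoc[symmetric] magnus_letter_inv)

lemma magnus_mult: "magnus (u \<otimes>\<^bsub>free_group S\<^esub> v) = magnus u * magnus v"
proof -
  have "magnus (foldr push u v) = magnus u * magnus v"
    by (induction u) (simp_all add: magnus_push mult.assoc)
  then show ?thesis by (simp add: free_group_def)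
qed

lemma magnus_one: "magnus \<one>\<^bsub>free_group S\<^esub> = 1"
  by (simp add: free_group_def)

lemma magnus_inv:
  assumes "u \<in> carrier (free_group S)"
  shows "magnus (inv\<^bsub>free_group S\<^esub> u) * magnus u = 1" "magnus u * magnus (inv\<^bsub>free_group S\<^esub> u) = 1"
proof -
  interpret F: group "free_group S" by (rule free_group_group)
  show "magnus (inv\<^bsub>free_group S\<^esub> u) * magnus u = 1" "magnus u * magnus (inv\<^bsub>free_group S\<^esub> u) = 1"
    using assms by (simp_all add: magnus_mult[where S = S, symmetric] magnus_one)
qed

lemma magnus_fgen: "magnus (fgen x) = nc_inv_var x"
  by (simp add: fgen_def magnus_letter_def)

lemma magnus_inv_fgen: "x \<in> S \<Longrightarrow> magnus (inv\<^bsub>free_group S\<^esub> (fgen x)) = 1 + nc_var x"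
  by (subst group.inv_fgen[OF free_group_group]) (simp_all add: magnus_letter_def)

lemma magnus_minus_one: "magnus w - 1 \<in> nc_order 1"
proof -
  have letter: "nc_coeff (magnus_letter a) [] = 1" for a :: "'a letter"
    by (simp add: magnus_letter_def nc_inv_var_def)
  have "nc_coeff (magnus w) [] = 1"
    by (induction w) (simp_all add: nc_coeff_mult letter)
  then show ?thesis by (simp add: nc_order_def)
qed

lemma nc_inv_var_order: "nc_inv_var x - 1 + nc_var x \<in> nc_order 2"
proof -
  have "nc_coeff (nc_inv_var x - 1 + nc_var x) w = 0" if "length w < 2" for w
    using that by (cases w) (auto simp: nc_inv_var_def)
  then show ?thesis by (simp add: nc_order_def)
qed

lemma magnus_inv_left_cancel:
  assumes "u \<in> carrier (free_group S)"
  shows "magnus (inv\<^bsub>free_group S\<^esub> u) * (magnus u * f) = f"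
  using magnus_inv(1)[OF assms] by (metis mult.assoc mult_1)

text \<open>\<open>inv a\<close> and \<open>inv b\<close> are split off in front of the difference
  of the two products of \<open>a\<close> and \<open>b\<close>. Subtracting 1 from both factors does
  not change that difference, and in this form orders add up.\<close>

lemma magnus_commutator:
  assumes "a \<in> carrier (free_group S)" "b \<in> carrier (free_group S)"
  shows "magnus (commutator (free_group S) a b) - 1 =
    magnus (inv\<^bsub>free_group S\<^esub> a) * magnus (inv\<^bsub>free_group S\<^esub> b) *
      ((magnus a - 1) * (magnus b - 1) - (magnus b - 1) * (magnus a - 1))"
proof -
  have "magnus (inv\<^bsub>free_group S\<^esub> a) * magnus (inv\<^bsub>free_group S\<^esub> b) * (magnus b * magnus a) = 1"
    using magnus_inv_left_cancel[OF assms(2), of "magnus a"] magnus_inv(1)[OF assms(1)]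
    by (simp add: mult.assoc)
  then show ?thesis
    by (simp add: commutator_def magnus_mult algebra_simps)
qed

lemma nc_bracket_order: "\<lbrakk>f \<in> nc_order p; g \<in> nc_order q\<rbrakk> \<Longrightarrow> f * g - g * f \<in> nc_order (p + q)"
  using nc_order_mult[of f p g q] nc_order_mult[of g q f p] by (simp add: add.commute nc_order_diff)

text \<open>The prefactor \<open>U\<close> of \<open>magnus_commutator\<close> differs from 1 only
  in positive order and so leaves the leading part alone; the errors in \<open>A\<close> and
  \<open>B\<close> contribute from degree \<open>p + q + 1\<close> on.\<close>

lemma magnus_commutator_leading:
  assumes "a \<in> carrier (free_group S)" "b \<in> carrier (free_group S)"
    and A: "A \<in> nc_order p" "magnus a - 1 - A \<in> nc_order (Suc p)"
    and B: "B \<in> nc_order q" "magnus b - 1 - B \<in> nc_order (Suc q)"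
  shows "magnus (commutator (free_group S) a b) - 1 - (A * B - B * A) \<in> nc_order (Suc (p + q))"
proof -
  define \<alpha> where "\<alpha> = magnus a - 1 - A"
  define \<beta> where "\<beta> = magnus b - 1 - B"
  define U where "U = magnus (inv\<^bsub>free_group S\<^esub> a \<otimes>\<^bsub>free_group S\<^esub> inv\<^bsub>free_group S\<^esub> b)"
  define K where "K = (A + \<alpha>) * (B + \<beta>) - (B + \<beta>) * (A + \<alpha>)"
  have \<alpha>: "\<alpha> \<in> nc_order (Suc p)" "magnus a - 1 = A + \<alpha>" and \<beta>: "\<beta> \<in> nc_order (Suc q)" "magnus b - 1 = B + \<beta>"
    using A B by (simp_all add: \<alpha>_def \<beta>_def)
  have a': "A + \<alpha> \<in> nc_order p" and b': "B + \<beta> \<in> nc_order q"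
    using A B \<alpha> \<beta> by (auto intro!: nc_order_add elim: nc_order_mono)
  have "K = (A * B - B * A) + ((A * \<beta> - \<beta> * A) + (\<alpha> * (B + \<beta>) - (B + \<beta>) * \<alpha>))"
    by (simp add: K_def algebra_simps)
  moreover have "A * \<beta> - \<beta> * A \<in> nc_order (Suc (p + q))" "\<alpha> * (B + \<beta>) - (B + \<beta>) * \<alpha> \<in> nc_order (Suc (p + q))"
    using nc_bracket_order[OF A(1) \<beta>(1)] nc_bracket_order[OF \<alpha>(1) b'] by simp_all
  ultimately have K: "K - (A * B - B * A) \<in> nc_order (Suc (p + q))"
    by (simp add: nc_order_add)
  have "K \<in> nc_order (p + q)" unfolding K_def by (rule nc_bracket_order[OF a' b'])
  then have UK: "(U - 1) * K \<in> nc_order (Suc (p + q))"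
    using nc_order_mult[OF magnus_minus_one] by (auto simp: U_def)
  have "magnus (commutator (free_group S) a b) - 1 = U * K"
    using magnus_commutator[OF assms(1,2)] by (simp add: U_def K_def \<alpha> \<beta> magnus_mult)
  also have "\<dots> - (A * B - B * A) = (U - 1) * K + (K - (A * B - B * A))"
    by (simp add: algebra_simps)
  also have "\<dots> \<in> nc_order (Suc (p + q))" using UK K by (rule nc_order_add)
  finally show ?thesis .
qed

text \<open>The words whose expansion is 1 up to a given order form a subgroup, so only the
  generating commutators have to be checked, and for these the orders add. The dummy index 0 imposes
  no condition.\<close>

lemma magnus_lower_central:
  assumes "w \<in> lower_central (free_group S) c"
  shows "magnus w - 1 \<in> nc_order c"
proof (cases "c \<ge> 1")
  case True
  interpret F: group "free_group S" by (rule free_group_group)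
  show ?thesis
    using True assms
  proof (induction c arbitrary: w rule: dec_induct)
    case base
    then show ?case using magnus_minus_one by simp
  next
    case (step c)
    define D where "D = {w \<in> carrier (free_group S). magnus w - 1 \<in> nc_order (Suc c)}"
    have "subgroup D (free_group S)"
    proof (rule F.subgroupI)
      have "\<one>\<^bsub>free_group S\<^esub> \<in> D" by (simp add: D_def magnus_one)
      then show "D \<noteq> {}" by blast
      fix u assume u: "u \<in> D"
      have "magnus (inv\<^bsub>free_group S\<^esub> u) - 1 = - (magnus (inv\<^bsub>free_group S\<^esub> u) * (magnus u - 1))"
        using u magnus_inv[of u S] by (simp add: D_def right_diff_distrib)
      then show "inv\<^bsub>free_group S\<^esub> u \<in> D"
        using u by (simp add: D_def nc_order_uminus nc_order_mult_left)
      fix v assume v: "v \<in> D"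
      have "magnus u * magnus v - 1 = magnus u * (magnus v - 1) + (magnus u - 1)"
        by (simp add: algebra_simps)
      also have "\<dots> \<in> nc_order (Suc c)"
        using u v unfolding D_def by (intro nc_order_add nc_order_mult_left) auto
      finally show "u \<otimes>\<^bsub>free_group S\<^esub> v \<in> D"
        using u v by (simp add: D_def magnus_mult)
    qed (simp add: D_def)
    moreover have "commutator (free_group S) a b \<in> D"
      if a: "a \<in> lower_central (free_group S) c" and b: "b \<in> carrier (free_group S)" for a b
    proof -
      have ac: "a \<in> carrier (free_group S)" using a by (rule F.lower_central_carrier)
      have "(magnus a - 1) * (magnus b - 1) - (magnus b - 1) * (magnus a - 1) \<in> nc_order (c + 1)"
        using step.IH[OF a] magnus_minus_one by (rule nc_bracket_order)
      then show ?thesis using ac b by (simp add: D_def magnus_commutator nc_order_mult_left)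
    qed
    ultimately have "lower_central (free_group S) (Suc c) \<subseteq> D"
      unfolding F.lower_central_Suc[OF step.hyps(1)] by (intro F.generate_subgroup_incl) auto
    then show ?case using step.prems by (auto simp: D_def)
  qed
qed (simp add: not_le)

section \<open>Groups acting trivially on the abelianization\<close>

text \<open>The setting of Johnson homomorphisms: a group acting by endomorphisms that are the
  identity on the abelianization, expressed by classes modulo the second term of the series. Words
  and freeness do not occur in it, which keeps the filtration argument purely group
  theoretic.\<close>

locale ia_action = F: group F + G: group G
  for F :: "('a, 'c) monoid_scheme" and G :: "('b, 'd) monoid_scheme" +
  fixes act :: "'b \<Rightarrow> 'a \<Rightarrow> 'a"
  assumes act_hom: "g \<in> carrier G \<Longrightarrow> act g \<in> hom F F"
    and act_mult: "\<lbrakk>g \<in> carrier G; h \<in> carrier G; w \<in> carrier F\<rbrakk> \<Longrightarrow> act (g \<otimes>\<^bsub>G\<^esub> h) w = act g (act h w)"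
    and act_one: "w \<in> carrier F \<Longrightarrow> act \<one>\<^bsub>G\<^esub> w = w"
    and act_ia: "\<lbrakk>g \<in> carrier G; w \<in> carrier F\<rbrakk> \<Longrightarrow> F.lc_class 1 (act g w) = F.lc_class 1 w"
begin

lemma act_group_hom: "g \<in> carrier G \<Longrightarrow> group_hom F F (act g)"
  by unfold_locales (rule act_hom)

lemma act_closed: "\<lbrakk>g \<in> carrier G; w \<in> carrier F\<rbrakk> \<Longrightarrow> act g w \<in> carrier F"
  using group_hom.hom_closed[OF act_group_hom] by blast

lemma act_inv_act: "\<lbrakk>g \<in> carrier G; w \<in> carrier F\<rbrakk> \<Longrightarrow> act (inv\<^bsub>G\<^esub> g) (act g w) = w"
  using act_mult[of "inv\<^bsub>G\<^esub> g" g w] by (simp add: act_one)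

text \<open>The graded pieces are generated by classes of commutators, and these depend only on the
  classes of the entries. So trivial action on the abelianization propagates to every
  degree.\<close>

lemma act_lower_central:
  assumes "g \<in> carrier G" "d \<ge> 1" "w \<in> lower_central F d"
  shows "act g w \<in> lower_central F d \<and> F.lc_class d (act g w) = F.lc_class d w"
  using assms(2,3)
proof (induction d arbitrary: w rule: dec_induct)
  case base
  then show ?case using act_ia act_closed assms(1) by simp
next
  case (step d)
  interpret h: group_hom F F "act g" using assms(1) by (rule act_group_hom)
  interpret pi: group_hom F "F Mod lower_central F (Suc (Suc d))" "F.lc_class (Suc d)" by (rule F.lc_class_hom)
  define K where "K = {w \<in> lower_central F (Suc d). act g w \<in> lower_central F (Suc d) \<and>
    F.lc_class (Suc d) (act g w) = F.lc_class (Suc d) w}"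
  have "subgroup K F"
  proof (rule F.subgroupI)
    have "\<one>\<^bsub>F\<^esub> \<in> K" by (simp add: K_def F.lower_central_closed)
    then show "K \<noteq> {}" by blast
  qed (use F.lower_central_closed F.lower_central_carrier in \<open>auto simp: K_def\<close>)
  moreover have "commutator F a b \<in> K" if a: "a \<in> lower_central F d" and b: "b \<in> carrier F" for a b
  proof -
    have ac: "a \<in> carrier F" using a by (rule F.lower_central_carrier)
    have b1: "b \<in> lower_central F 1" using b by simp
    have gb: "act g b \<in> lower_central F 1" "F.lc_class 1 (act g b) = F.lc_class 1 b"
      using act_ia act_closed assms(1) b by simp_all
    have ga: "act g a \<in> lower_central F d" "F.lc_class d (act g a) = F.lc_class d a"
      using step.IH[OF a] by auto
    have "F.lc_class (d + 1) (commutator F (act g a) (act g b)) = F.lc_class (d + 1) (commutator F a b)"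
      by (rule F.lc_class_commutator_cong[OF ga(1) a gb(1) b1 _ _ ga(2) gb(2)]) (use step.hyps in auto)
    moreover have "commutator F (act g a) (act g b) \<in> lower_central F (d + 1)" "commutator F a b \<in> lower_central F (d + 1)"
      using F.lower_central_commutator[OF ga(1) gb(1) step.hyps(1)] F.lower_central_commutator[OF a b1 step.hyps(1)]
      by simp_all
    ultimately show ?thesis using ac b by (simp add: K_def h.commutator_hom)
  qed
  ultimately have "lower_central F (Suc d) \<subseteq> K"
    unfolding F.lower_central_Suc[OF step.hyps(1)] by (intro F.generate_subgroup_incl) auto
  then show ?case using step.prems by (auto simp: K_def)
qed

text \<open>The Andreadakis-Johnson filtration, with the shift by \<open>c\<close> demanded on every
  term of the series and not on degree 1 alone: the commutator estimate applies it to elements of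
  degrees \<open>Suc d\<close> and \<open>c + d\<close>.\<close>

definition act_filtration :: "nat \<Rightarrow> 'b set" where
  "act_filtration c = {g \<in> carrier G. \<forall>d\<ge>1. \<forall>w\<in>lower_central F d.
     act g w \<otimes>\<^bsub>F\<^esub> inv\<^bsub>F\<^esub> w \<in> lower_central F (c + d)}"

lemma act_filtration_subgroup: "subgroup (act_filtration c) G"
proof (rule G.subgroupI)
  have "\<one>\<^bsub>G\<^esub> \<in> act_filtration c"
    by (simp add: act_filtration_def act_one F.lower_central_carrier F.lower_central_closed)
  then show "act_filtration c \<noteq> {}" by blast
  fix g assume g: "g \<in> act_filtration c"
  have gG: "g \<in> carrier G" using g by (simp add: act_filtration_def)
  show "inv\<^bsub>G\<^esub> g \<in> act_filtration c"
    unfolding act_filtration_def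
  proof (intro CollectI conjI allI impI ballI)
    fix d w assume d: "(d::nat) \<ge> 1" and w: "w \<in> lower_central F d"
    have wc: "w \<in> carrier F" using w by (rule F.lower_central_carrier)
    define w' where "w' = act (inv\<^bsub>G\<^esub> g) w"
    have w': "w' \<in> lower_central F d" "w' \<in> carrier F"
      using act_lower_central[OF _ d w] gG wc by (auto simp: w'_def act_closed)
    have "act g w' = w" using gG wc act_mult[of g "inv\<^bsub>G\<^esub> g" w] by (simp add: w'_def act_one)
    then have "w \<otimes>\<^bsub>F\<^esub> inv\<^bsub>F\<^esub> w' \<in> lower_central F (c + d)"
      using g d w' by (auto simp: act_filtration_def)
    then have "inv\<^bsub>F\<^esub> (w \<otimes>\<^bsub>F\<^esub> inv\<^bsub>F\<^esub> w') \<in> lower_central F (c + d)" by (rule F.lower_central_closed)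
    then show "act (inv\<^bsub>G\<^esub> g) w \<otimes>\<^bsub>F\<^esub> inv\<^bsub>F\<^esub> w \<in> lower_central F (c + d)"
      using wc w' by (simp add: F.inv_mult_group w'_def)
  qed (use gG in simp)
  fix h assume h: "h \<in> act_filtration c"
  have hG: "h \<in> carrier G" using h by (simp add: act_filtration_def)
  show "g \<otimes>\<^bsub>G\<^esub> h \<in> act_filtration c"
    unfolding act_filtration_def
  proof (intro CollectI conjI allI impI ballI)
    fix d w assume d: "(d::nat) \<ge> 1" and w: "w \<in> lower_central F d"
    have wc: "w \<in> carrier F" using w by (rule F.lower_central_carrier)
    define w' where "w' = act h w"
    have w': "w' \<in> lower_central F d" "w' \<in> carrier F"
      using act_lower_central[OF hG d w] hG wc by (auto simp: w'_def act_closed)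
    have "act g w' \<otimes>\<^bsub>F\<^esub> inv\<^bsub>F\<^esub> w' \<in> lower_central F (c + d)" "w' \<otimes>\<^bsub>F\<^esub> inv\<^bsub>F\<^esub> w \<in> lower_central F (c + d)"
      using g h d w w' by (auto simp: act_filtration_def w'_def)
    then have "(act g w' \<otimes>\<^bsub>F\<^esub> inv\<^bsub>F\<^esub> w') \<otimes>\<^bsub>F\<^esub> (w' \<otimes>\<^bsub>F\<^esub> inv\<^bsub>F\<^esub> w) \<in> lower_central F (c + d)"
      by (rule F.lower_central_closed)
    then show "act (g \<otimes>\<^bsub>G\<^esub> h) w \<otimes>\<^bsub>F\<^esub> inv\<^bsub>F\<^esub> w \<in> lower_central F (c + d)"
      using gG hG wc w' act_closed[of g w'] by (simp add: act_mult w'_def F.m_assoc F.inv_mult_cancel)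
  qed (use gG hG in simp)
qed (simp add: act_filtration_def)

lemma act_filtration_1: "act_filtration 1 = carrier G"
proof -
  have "act g w \<otimes>\<^bsub>F\<^esub> inv\<^bsub>F\<^esub> w \<in> lower_central F (Suc d)"
    if "g \<in> carrier G" "d \<ge> 1" "w \<in> lower_central F d" for g d w
    using act_lower_central[OF that] that(1) F.lower_central_carrier[OF that(3)] act_closed
    by (simp add: F.lc_class_eq_iff)
  then show ?thesis by (auto simp: act_filtration_def)
qed

lemma act_filtrationD:
  "\<lbrakk>g \<in> act_filtration c; d \<ge> 1; w \<in> lower_central F d\<rbrakk> \<Longrightarrow> act g w \<otimes>\<^bsub>F\<^esub> inv\<^bsub>F\<^esub> w \<in> lower_central F (c + d)"
  by (simp add: act_filtration_def)

text \<open>Applying \<open>g\<close> and \<open>h\<close> to \<open>w\<close> in either order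
  multiplies \<open>w\<close> by \<open>u\<close> and \<open>v\<close>, up to the deep factors
  \<open>u1\<close> and \<open>v1\<close>; exchanging \<open>u\<close> and \<open>v\<close> costs a
  commutator of degree at least \<open>c + d + 1\<close>. So both orders agree on \<open>w\<close>
  modulo that degree, and undoing one of them, which preserves the series, leaves the commutator of
  \<open>g\<close> and \<open>h\<close>.\<close>

lemma act_filtration_commutator:
  assumes g: "g \<in> act_filtration c" and h: "h \<in> carrier G"
  shows "commutator G g h \<in> act_filtration (Suc c)"
  unfolding act_filtration_def
proof (intro CollectI conjI allI impI ballI)
  have gG: "g \<in> carrier G" using g by (simp add: act_filtration_def)
  show kG: "commutator G g h \<in> carrier G" using gG h by simp
  fix d w assume d: "(d::nat) \<ge> 1" and w: "w \<in> lower_central F d"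
  have wc: "w \<in> carrier F" using w by (rule F.lower_central_carrier)
  define u where "u = act g w \<otimes>\<^bsub>F\<^esub> inv\<^bsub>F\<^esub> w"
  define v where "v = act h w \<otimes>\<^bsub>F\<^esub> inv\<^bsub>F\<^esub> w"
  have u: "u \<in> lower_central F (c + d)" using g d w by (auto simp: act_filtration_def u_def)
  have v: "v \<in> lower_central F (Suc d)" using act_filtrationD[of h 1, OF _ d w] h by (simp add: act_filtration_1[simplified] v_def)
  define u1 where "u1 = act h u \<otimes>\<^bsub>F\<^esub> inv\<^bsub>F\<^esub> u"
  define v1 where "v1 = act g v \<otimes>\<^bsub>F\<^esub> inv\<^bsub>F\<^esub> v"
  have u1: "u1 \<in> lower_central F (Suc c + d)"
    using act_filtrationD[of h 1 "c + d", OF _ _ u] h d by (simp add: act_filtration_1[simplified] u1_def)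
  have v1: "v1 \<in> lower_central F (Suc c + d)" using act_filtrationD[OF g _ v] by (simp add: v1_def)
  have cl: "u \<in> carrier F" "v \<in> carrier F" "u1 \<in> carrier F" "v1 \<in> carrier F"
    using u v u1 v1 F.lower_central_carrier by auto
  interpret g: group_hom F F "act g" using gG by (rule act_group_hom)
  interpret h: group_hom F F "act h" using h by (rule act_group_hom)
  have gw: "act g w = u \<otimes>\<^bsub>F\<^esub> w" and hw: "act h w = v \<otimes>\<^bsub>F\<^esub> w"
    using wc by (simp_all add: u_def v_def F.m_assoc)
  have gv: "act g v = v1 \<otimes>\<^bsub>F\<^esub> v" and hu: "act h u = u1 \<otimes>\<^bsub>F\<^esub> u"
    using cl by (simp_all add: u1_def v1_def F.m_assoc)
  have gh: "act (g \<otimes>\<^bsub>G\<^esub> h) w = v1 \<otimes>\<^bsub>F\<^esub> v \<otimes>\<^bsub>F\<^esub> (u \<otimes>\<^bsub>F\<^esub> w)"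
    using wc cl gG h by (simp add: act_mult hw gv gw)
  have hg: "act (h \<otimes>\<^bsub>G\<^esub> g) w = u1 \<otimes>\<^bsub>F\<^esub> u \<otimes>\<^bsub>F\<^esub> (v \<otimes>\<^bsub>F\<^esub> w)"
    using wc cl gG h by (simp add: act_mult hw hu gw)
  have "commutator F (inv\<^bsub>F\<^esub> v) (inv\<^bsub>F\<^esub> u) \<in> lower_central F (Suc d + (c + d))"
    using u v d by (intro F.lower_central_commutator F.lower_central_closed) auto
  then have "commutator F (inv\<^bsub>F\<^esub> v) (inv\<^bsub>F\<^esub> u) \<in> lower_central F (Suc c + d)"
    by (rule F.lower_central_mono) simp
  then have m1: "v1 \<otimes>\<^bsub>F\<^esub> commutator F (inv\<^bsub>F\<^esub> v) (inv\<^bsub>F\<^esub> u) \<otimes>\<^bsub>F\<^esub> inv\<^bsub>F\<^esub> u1 \<in> lower_central F (Suc c + d)"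
    using u1 v1 by (intro F.lower_central_closed)
  have m2: "v1 \<otimes>\<^bsub>F\<^esub> commutator F (inv\<^bsub>F\<^esub> v) (inv\<^bsub>F\<^esub> u) \<otimes>\<^bsub>F\<^esub> inv\<^bsub>F\<^esub> u1 =
    act (g \<otimes>\<^bsub>G\<^esub> h) w \<otimes>\<^bsub>F\<^esub> inv\<^bsub>F\<^esub> (act (h \<otimes>\<^bsub>G\<^esub> g) w)"
    using cl wc by (simp add: gh hg commutator_def F.inv_mult_group F.m_assoc F.inv_mult_cancel)
  define x where "x = act (commutator G g h) w"
  have hgG: "h \<otimes>\<^bsub>G\<^esub> g \<in> carrier G" using gG h by simp
  have xc: "x \<in> carrier F" using kG wc by (simp add: x_def act_closed)
  have m3: "act (g \<otimes>\<^bsub>G\<^esub> h) w = act (h \<otimes>\<^bsub>G\<^esub> g) x"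
    unfolding x_def using act_mult[OF hgG kG wc] G.mult_commutator[OF gG h] by simp
  interpret hg: group_hom F F "act (h \<otimes>\<^bsub>G\<^esub> g)" using hgG by (rule act_group_hom)
  have "act (h \<otimes>\<^bsub>G\<^esub> g) (x \<otimes>\<^bsub>F\<^esub> inv\<^bsub>F\<^esub> w) \<in> lower_central F (Suc c + d)"
    using m1 xc wc unfolding m2 m3 by simp
  then have "act (inv\<^bsub>G\<^esub> (h \<otimes>\<^bsub>G\<^esub> g)) (act (h \<otimes>\<^bsub>G\<^esub> g) (x \<otimes>\<^bsub>F\<^esub> inv\<^bsub>F\<^esub> w)) \<in> lower_central F (Suc c + d)"
    using act_lower_central hgG by auto
  moreover have "act (inv\<^bsub>G\<^esub> (h \<otimes>\<^bsub>G\<^esub> g)) (act (h \<otimes>\<^bsub>G\<^esub> g) (x \<otimes>\<^bsub>F\<^esub> inv\<^bsub>F\<^esub> w)) = x \<otimes>\<^bsub>F\<^esub> inv\<^bsub>F\<^esub> w"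
    by (rule act_inv_act) (use hgG xc wc in auto)
  ultimately show "act (commutator G g h) w \<otimes>\<^bsub>F\<^esub> inv\<^bsub>F\<^esub> w \<in> lower_central F (Suc c + d)"
    by (simp add: x_def)
qed

text \<open>The lower central series descends fastest among chains of subgroups that start with the
  whole group and gain a degree under commutators with it.\<close>

lemma lower_central_act_filtration: "c \<ge> 1 \<Longrightarrow> lower_central G c \<subseteq> act_filtration c"
proof (induction c rule: dec_induct)
  case (step c)
  have "generate G {commutator G a b |a b. a \<in> lower_central G c \<and> b \<in> carrier G} \<subseteq> act_filtration (Suc c)"
    by (rule G.generate_subgroup_incl) (use step act_filtration_commutator act_filtration_subgroup in auto)
  then show ?case by (simp only: G.lower_central_Suc[OF step.hyps(1)])
qed (simp add: act_filtration_1[simplified])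

lemma act_mult_inv_lower_central:
  assumes "g \<in> lower_central G c" "w \<in> lower_central F d" "c \<ge> 1" "d \<ge> 1"
  shows "act g w \<otimes>\<^bsub>F\<^esub> inv\<^bsub>F\<^esub> w \<in> lower_central F (c + d)"
  using lower_central_act_filtration[OF assms(3)] assms by (auto simp: act_filtration_def)

end

declare One_nat_def [simp del]

lemma lower_central_1: "lower_central G 1 = carrier G"
  by (simp add: One_nat_def)

section \<open>The action of the group on the free group\<close>

definition yauts :: "nat \<Rightarrow> (nat letter list \<Rightarrow> nat letter list) set" where
  "yauts n = {yaut n m i | m i. 2 \<le> m \<and> m \<le> n \<and> 1 \<le> i \<and> i \<le> m}"

lemma yauts_auto: "yauts n \<subseteq> carrier (AutoGroup (Fn n))"
  using yaut_auto by (auto simp: yauts_def AutoGroup_def)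

lemma AutoGroup_Fn: "group (AutoGroup (Fn n))"
  by (rule group.AutoGroup[OF free_group_group])

lemma I_group_group: "group (I_group n)"
  unfolding I_group_def by (rule group.group_subgroup_generated[OF AutoGroup_Fn])

lemma I_group_carrier: "carrier (I_group n) = generate (AutoGroup (Fn n)) (yauts n)"
  using yauts_auto by (simp add: I_group_def carrier_subgroup_generated yauts_def[symmetric] Int_absorb1)

lemma yaut_I_group: "\<lbrakk>2 \<le> m; m \<le> n; 1 \<le> i; i \<le> m\<rbrakk> \<Longrightarrow> yaut n m i \<in> carrier (I_group n)"
  unfolding I_group_carrier by (rule generate.incl) (auto simp: yauts_def)

lemma I_group_auto: "\<phi> \<in> carrier (I_group n) \<Longrightarrow> \<phi> \<in> auto (Fn n)"
  using group.generate_incl[OF AutoGroup_Fn yauts_auto] by (auto simp: I_group_carrier AutoGroup_def)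

lemma I_group_hom: "\<phi> \<in> carrier (I_group n) \<Longrightarrow> \<phi> \<in> hom (Fn n) (Fn n)"
  using I_group_auto by (auto simp: auto_def)

lemma I_group_mult_apply:
  assumes "\<phi> \<in> carrier (I_group n)" "\<psi> \<in> carrier (I_group n)" "w \<in> carrier (Fn n)"
  shows "(\<phi> \<otimes>\<^bsub>I_group n\<^esub> \<psi>) w = \<phi> (\<psi> w)"
proof -
  have "\<phi> \<in> Bij (carrier (Fn n))" "\<psi> \<in> Bij (carrier (Fn n))"
    using assms I_group_auto by (auto simp: auto_def)
  then show ?thesis
    using assms(3) by (simp add: I_group_def AutoGroup_def BijGroup_def compose_eq)
qed

lemma I_group_one_apply: "w \<in> carrier (Fn n) \<Longrightarrow> \<one>\<^bsub>I_group n\<^esub> w = w"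
  by (simp add: I_group_def AutoGroup_def BijGroup_def)

lemma I_group_generated:
  assumes "subgroup K (I_group n)"
    and K: "\<And>m i. \<lbrakk>2 \<le> m; m \<le> n; 1 \<le> i; i \<le> m\<rbrakk> \<Longrightarrow> yaut n m i \<in> K"
  shows "carrier (I_group n) \<subseteq> K"
proof
  interpret A: group "AutoGroup (Fn n)" by (rule AutoGroup_Fn)
  interpret K: subgroup K "I_group n" by fact
  fix \<phi> assume "\<phi> \<in> carrier (I_group n)"
  then have "\<phi> \<in> generate (AutoGroup (Fn n)) (yauts n)" by (simp only: I_group_carrier)
  then show "\<phi> \<in> K"
  proof (induction rule: generate.induct)
    case one
    then show ?case using K.one_closed by (simp add: I_group_def)
  next
    case (incl h)
    then show ?case using K by (auto simp: yauts_def)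
  next
    case (inv h)
    then have h: "h \<in> carrier (I_group n)" unfolding I_group_carrier by (rule generate.incl)
    then have "inv\<^bsub>I_group n\<^esub> h = inv\<^bsub>AutoGroup (Fn n)\<^esub> h"
      unfolding I_group_def by (rule A.inv_subgroup_generated)
    moreover have "h \<in> K" using inv K by (auto simp: yauts_def)
    then have "inv\<^bsub>I_group n\<^esub> h \<in> K" by (rule K.m_inv_closed)
    ultimately show ?case by simp
  next
    case (eng h1 h2)
    then show ?case using K.m_closed[of h1 h2] by (simp add: I_group_def)
  qed
qed

text \<open>A conjugation becomes trivial in an abelian quotient, and the automorphisms that act
  trivially there are closed under composition and inversion; so the generators decide.\<close>

lemma ia_action_I_group: "ia_action (Fn n) (I_group n) (\<lambda>\<phi>. \<phi>)"
proof -
  interpret F: group "Fn n" by (rule free_group_group)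
  interpret I: group "I_group n" by (rule I_group_group)
  let ?Q = "Fn n Mod lower_central (Fn n) (Suc 1)"
  interpret pi: group_hom "Fn n" ?Q "F.lc_class 1" by (rule F.lc_class_hom)
  define K where "K = {\<phi> \<in> carrier (I_group n). \<forall>w\<in>carrier (Fn n). F.lc_class 1 (\<phi> w) = F.lc_class 1 w}"
  have closed: "\<phi> w \<in> carrier (Fn n)" if "\<phi> \<in> carrier (I_group n)" "w \<in> carrier (Fn n)" for \<phi> w
    using I_group_hom[OF that(1)] that(2) by (auto simp: hom_def)
  have "subgroup K (I_group n)"
  proof (rule I.subgroupI)
    have "\<one>\<^bsub>I_group n\<^esub> \<in> K" by (simp add: K_def I_group_one_apply)
    then show "K \<noteq> {}" by blast
    fix \<phi> assume \<phi>: "\<phi> \<in> K"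
    have \<phi>c: "\<phi> \<in> carrier (I_group n)" using \<phi> by (simp add: K_def)
    have "F.lc_class 1 ((inv\<^bsub>I_group n\<^esub> \<phi>) w) = F.lc_class 1 w" if w: "w \<in> carrier (Fn n)" for w
    proof -
      have iw: "(inv\<^bsub>I_group n\<^esub> \<phi>) w \<in> carrier (Fn n)" using closed[OF I.inv_closed[OF \<phi>c] w] .
      have "\<phi> ((inv\<^bsub>I_group n\<^esub> \<phi>) w) = w"
        using I_group_mult_apply[of \<phi> n "inv\<^bsub>I_group n\<^esub> \<phi>" w] \<phi>c w by (simp add: I_group_one_apply)
      moreover have "F.lc_class 1 (\<phi> ((inv\<^bsub>I_group n\<^esub> \<phi>) w)) = F.lc_class 1 ((inv\<^bsub>I_group n\<^esub> \<phi>) w)"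
        using \<phi> iw unfolding K_def by blast
      ultimately show ?thesis by simp
    qed
    then show "inv\<^bsub>I_group n\<^esub> \<phi> \<in> K" using \<phi>c by (simp add: K_def)
    fix \<psi> assume \<psi>: "\<psi> \<in> K"
    then show "\<phi> \<otimes>\<^bsub>I_group n\<^esub> \<psi> \<in> K" using \<phi> closed by (simp add: K_def I_group_mult_apply)
  qed (auto simp: K_def)
  moreover have "yaut n m i \<in> K" if "2 \<le> m" "m \<le> n" "1 \<le> i" "i \<le> m" for m i
  proof -
    have y: "yaut n m i \<in> carrier (I_group n)" using that by (rule yaut_I_group)
    have "(F.lc_class 1 \<circ> yaut n m i) w = F.lc_class 1 w" if "w \<in> carrier (Fn n)" for w
    proof (rule group.free_group_hom_eqI[OF pi.H.is_group _ _ _ that])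
      show "F.lc_class 1 \<circ> yaut n m i \<in> hom (Fn n) ?Q"
        using I_group_hom[OF y] pi.homh by (rule hom_compose)
      show "F.lc_class 1 \<in> hom (Fn n) ?Q" by (rule pi.homh)
      fix k assume k: "k \<in> {1..n}"
      have i: "i \<in> {1..n}" using \<open>1 \<le> i\<close> \<open>i \<le> m\<close> \<open>m \<le> n\<close> by auto
      have c: "fgen i \<in> carrier (Fn n)" "fgen k \<in> carrier (Fn n)" by (rule fgen_carrier[OF i], rule fgen_carrier[OF k])
      have "F.lc_class 1 (inv\<^bsub>Fn n\<^esub> (fgen i) \<otimes>\<^bsub>Fn n\<^esub> (fgen k \<otimes>\<^bsub>Fn n\<^esub> fgen i)) =
         F.lc_class 1 (fgen k \<otimes>\<^bsub>Fn n\<^esub> fgen i \<otimes>\<^bsub>Fn n\<^esub> inv\<^bsub>Fn n\<^esub> (fgen i))"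
        by (rule F.lc_class_mult_commute) (use c in \<open>auto simp: lower_central_1\<close>)
      then show "(F.lc_class 1 \<circ> yaut n m i) (fgen k) = F.lc_class 1 (fgen k)"
        using c by (simp add: yaut_fgen[OF k i] F.m_assoc)
    qed
    then show ?thesis using y by (simp add: K_def)
  qed
  ultimately have "carrier (I_group n) \<subseteq> K" by (rule I_group_generated)
  then show ?thesis
    by unfold_locales (auto simp: K_def I_group_hom I_group_mult_apply I_group_one_apply)
qed

section \<open>Automorphisms that conjugate the first generators\<close>

lemma free_group_subgroup:
  assumes "S \<subseteq> T"
  shows "subgroup (carrier (free_group S)) (free_group T)"
proof -
  interpret S: group "free_group S" by (rule free_group_group)
  interpret T: group "free_group T" by (rule free_group_group)
  have sub: "carrier (free_group S) \<subseteq> carrier (free_group T)" using assms by (auto simp: free_group_def)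
  have mult: "u \<otimes>\<^bsub>free_group T\<^esub> v = u \<otimes>\<^bsub>free_group S\<^esub> v" for u v by (simp add: free_group_def)
  show ?thesis
  proof (rule T.subgroupI)
    show "carrier (free_group S) \<noteq> {}" using S.one_closed by blast
    fix u assume u: "u \<in> carrier (free_group S)"
    have "inv\<^bsub>free_group T\<^esub> u = inv\<^bsub>free_group S\<^esub> u"
    proof (rule T.inv_equality)
      show "inv\<^bsub>free_group S\<^esub> u \<otimes>\<^bsub>free_group T\<^esub> u = \<one>\<^bsub>free_group T\<^esub>"
        unfolding mult using u by (simp add: free_group_def[of T] free_group_def[of S, symmetric])
          (simp add: free_group_def)
    qed (use sub u S.inv_closed in blast)+
    then show "inv\<^bsub>free_group T\<^esub> u \<in> carrier (free_group S)" using u by simp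
    fix v assume "v \<in> carrier (free_group S)"
    then show "u \<otimes>\<^bsub>free_group T\<^esub> v \<in> carrier (free_group S)" unfolding mult using u by simp
  qed (rule sub)
qed

lemma yaut_conjugation:
  assumes "1 \<le> i" "i \<le> m" "m \<le> n" "w \<in> carrier (Fn m)"
  shows "yaut n m i w = inv\<^bsub>Fn n\<^esub> (fgen i) \<otimes>\<^bsub>Fn n\<^esub> w \<otimes>\<^bsub>Fn n\<^esub> fgen i"
proof -
  interpret F: group "Fn n" by (rule free_group_group)
  interpret M: subgroup "carrier (Fn m)" "Fn n" using assms by (intro free_group_subgroup) auto
  have mult: "u \<otimes>\<^bsub>Fn m\<^esub> v = u \<otimes>\<^bsub>Fn n\<^esub> v" for u v by (simp add: free_group_def)
  have i: "i \<in> {1..n}" using assms by auto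
  have ic: "fgen i \<in> carrier (Fn n)" using i by (rule fgen_carrier)
  have y: "yaut n m i \<in> hom (Fn n) (Fn n)" using yaut_auto[OF assms(1-3)] by (simp add: auto_def)
  show ?thesis
  proof (rule F.free_group_hom_eqI[OF _ _ _ assms(4)])
    show "yaut n m i \<in> hom (Fn m) (Fn n)" using y M.subset by (auto simp: hom_def mult Pi_iff subset_iff)
    show "(\<lambda>w. inv\<^bsub>Fn n\<^esub> (fgen i) \<otimes>\<^bsub>Fn n\<^esub> w \<otimes>\<^bsub>Fn n\<^esub> fgen i) \<in> hom (Fn m) (Fn n)"
      using ic M.subset by (auto simp: hom_def mult subset_iff F.m_assoc F.inv_mult_cancel)
    fix k assume "k \<in> {1..m}"
    then show "yaut n m i (fgen k) = inv\<^bsub>Fn n\<^esub> (fgen i) \<otimes>\<^bsub>Fn n\<^esub> fgen k \<otimes>\<^bsub>Fn n\<^esub> fgen i"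
      using yaut_fgen[OF _ i, of k m] assms by simp
  qed
qed

text \<open>The form \<open>u w u^-1\<close> makes the passage from \<open>u\<close> to the
  automorphism multiplicative, because products in \<open>I_group n\<close> apply the right factor
  first. A commutator in row \<open>m\<close> is thus governed by the same commutator of the
  conjugating elements. Requiring \<open>u\<close> to lie in \<open>Fn m\<close> keeps the images of
  \<open>Fn m\<close> inside it, where a second conjugation applies.\<close>

definition partial_conj :: "nat \<Rightarrow> nat \<Rightarrow> (nat letter list \<Rightarrow> nat letter list) \<Rightarrow> nat letter list \<Rightarrow> bool" where
  "partial_conj n m \<phi> u \<longleftrightarrow> \<phi> \<in> carrier (I_group n) \<and> u \<in> carrier (Fn m) \<and>
    (\<forall>w\<in>carrier (Fn m). \<phi> w = u \<otimes>\<^bsub>Fn n\<^esub> w \<otimes>\<^bsub>Fn n\<^esub> inv\<^bsub>Fn n\<^esub> u) \<and> (\<forall>k\<in>{m<..n}. \<phi> (fgen k) = fgen k)"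

lemma partial_conj_yaut:
  assumes "2 \<le> m" "m \<le> n" "1 \<le> i" "i \<le> m"
  shows "partial_conj n m (yaut n m i) (inv\<^bsub>Fn n\<^esub> (fgen i))"
proof -
  interpret F: group "Fn n" by (rule free_group_group)
  interpret M: subgroup "carrier (Fn m)" "Fn n" using assms by (intro free_group_subgroup) auto
  have i: "fgen i \<in> carrier (Fn m)" using assms by (intro fgen_carrier) auto
  then have ic: "fgen i \<in> carrier (Fn n)" by (rule M.mem_carrier)
  have "i \<in> {1..n}" using assms by auto
  then have "yaut n m i (fgen k) = fgen k" if "k \<in> {m<..n}" for k
    using yaut_fgen[of k n i m] that by auto
  then show ?thesis
    unfolding partial_conj_def
    using yaut_I_group[OF assms] yaut_conjugation[OF assms(3,4,2)] M.m_inv_closed[OF i] ic by simp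
qed

lemma partial_conj_mult:
  assumes "m \<le> n" "partial_conj n m \<phi> u" "partial_conj n m \<psi> v"
  shows "partial_conj n m (\<phi> \<otimes>\<^bsub>I_group n\<^esub> \<psi>) (u \<otimes>\<^bsub>Fn n\<^esub> v)"
proof -
  interpret F: group "Fn n" by (rule free_group_group)
  interpret I: group "I_group n" by (rule I_group_group)
  interpret M: subgroup "carrier (Fn m)" "Fn n" using assms by (intro free_group_subgroup) auto
  have \<phi>: "\<phi> \<in> carrier (I_group n)" "\<psi> \<in> carrier (I_group n)" and uv: "u \<in> carrier (Fn m)" "v \<in> carrier (Fn m)"
    using assms by (simp_all add: partial_conj_def)
  have "(\<phi> \<otimes>\<^bsub>I_group n\<^esub> \<psi>) w = u \<otimes>\<^bsub>Fn n\<^esub> v \<otimes>\<^bsub>Fn n\<^esub> w \<otimes>\<^bsub>Fn n\<^esub> inv\<^bsub>Fn n\<^esub> (u \<otimes>\<^bsub>Fn n\<^esub> v)"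
    if w: "w \<in> carrier (Fn m)" for w
  proof -
    have "\<psi> w = v \<otimes>\<^bsub>Fn n\<^esub> w \<otimes>\<^bsub>Fn n\<^esub> inv\<^bsub>Fn n\<^esub> v" using assms(3) w by (simp add: partial_conj_def)
    moreover have vw: "v \<otimes>\<^bsub>Fn n\<^esub> w \<otimes>\<^bsub>Fn n\<^esub> inv\<^bsub>Fn n\<^esub> v \<in> carrier (Fn m)" using uv w by simp
    ultimately show ?thesis
      using assms(2) \<phi> w uv
      by (simp add: I_group_mult_apply partial_conj_def F.inv_mult_group F.m_assoc)
  qed
  moreover have "(\<phi> \<otimes>\<^bsub>I_group n\<^esub> \<psi>) (fgen k) = fgen k" if "k \<in> {m<..n}" for k
  proof -
    have "fgen k \<in> carrier (Fn n)" using that by (intro fgen_carrier) auto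
    then show ?thesis using assms that \<phi> by (simp add: I_group_mult_apply partial_conj_def)
  qed
  ultimately show ?thesis using \<phi> uv by (simp add: partial_conj_def)
qed

lemma partial_conj_inv:
  assumes "m \<le> n" "partial_conj n m \<phi> u"
  shows "partial_conj n m (inv\<^bsub>I_group n\<^esub> \<phi>) (inv\<^bsub>Fn n\<^esub> u)"
proof -
  interpret act: ia_action "Fn n" "I_group n" "\<lambda>\<phi>. \<phi>" by (rule ia_action_I_group)
  interpret M: subgroup "carrier (Fn m)" "Fn n" using assms by (intro free_group_subgroup) auto
  have \<phi>: "\<phi> \<in> carrier (I_group n)" and u: "u \<in> carrier (Fn m)" using assms by (simp_all add: partial_conj_def)
  have uc: "u \<in> carrier (Fn n)" using u by (rule M.mem_carrier)
  have "(inv\<^bsub>I_group n\<^esub> \<phi>) w = inv\<^bsub>Fn n\<^esub> u \<otimes>\<^bsub>Fn n\<^esub> w \<otimes>\<^bsub>Fn n\<^esub> inv\<^bsub>Fn n\<^esub> (inv\<^bsub>Fn n\<^esub> u)" if w: "w \<in> carrier (Fn m)" for w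
  proof -
    define w' where "w' = inv\<^bsub>Fn n\<^esub> u \<otimes>\<^bsub>Fn n\<^esub> w \<otimes>\<^bsub>Fn n\<^esub> u"
    have w': "w' \<in> carrier (Fn m)" using u w by (simp add: w'_def)
    have wc: "w \<in> carrier (Fn n)" using w by (rule M.mem_carrier)
    have "\<phi> w' = u \<otimes>\<^bsub>Fn n\<^esub> w' \<otimes>\<^bsub>Fn n\<^esub> inv\<^bsub>Fn n\<^esub> u" using assms(2) w' unfolding partial_conj_def by blast
    also have "\<dots> = w" using uc wc by (simp add: w'_def act.F.m_assoc act.F.inv_mult_cancel)
    finally show ?thesis using act.act_inv_act[OF \<phi> M.mem_carrier[OF w']] uc by (simp add: w'_def)
  qed
  moreover have "(inv\<^bsub>I_group n\<^esub> \<phi>) (fgen k) = fgen k" if "k \<in> {m<..n}" for k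
  proof -
    have "fgen k \<in> carrier (Fn n)" using that by (intro fgen_carrier) auto
    from act.act_inv_act[OF \<phi> this] show ?thesis using assms(2) that by (simp add: partial_conj_def)
  qed
  ultimately show ?thesis using \<phi> u by (simp add: partial_conj_def)
qed

lemma partial_conj_commutator:
  "\<lbrakk>m \<le> n; partial_conj n m \<phi> u; partial_conj n m \<psi> v\<rbrakk>
    \<Longrightarrow> partial_conj n m (commutator (I_group n) \<phi> \<psi>) (commutator (Fn n) u v)"
  unfolding commutator_def by (intro partial_conj_mult partial_conj_inv)

text \<open>The iterated group commutator with the bracketing of a Lie monomial; the value on terms
  that are not monomials is a dummy.\<close>

fun commutator_eval :: "('a, 'b) monoid_scheme \<Rightarrow> ('x \<Rightarrow> 'a) \<Rightarrow> 'x lie_term \<Rightarrow> 'a" where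
  "commutator_eval G f (LGen x) = f x"
| "commutator_eval G f (LBr s t) = commutator G (commutator_eval G f s) (commutator_eval G f t)"
| "commutator_eval G f _ = \<one>\<^bsub>G\<^esub>"

lemma lyndon_terms_induct [consumes 1, case_names LGen LBr]:
  assumes "t \<in> lyndon_terms A" "\<And>x. x \<in> A \<Longrightarrow> P (LGen x)"
    "\<And>s t. \<lbrakk>s \<in> lyndon_terms A; t \<in> lyndon_terms A; P s; P t\<rbrakk> \<Longrightarrow> P (LBr s t)"
  shows "P t"
proof -
  have "lyndon t" "lie_term_gens t \<subseteq> A" using assms(1) by (auto simp: lyndon_terms_def)
  then show ?thesis
    by (induction rule: lyndon.induct) (use assms(2,3) in \<open>auto simp: lyndon_terms_def\<close>)
qed

lemma length_lie_word_pos: "t \<in> lyndon_terms A \<Longrightarrow> length (lie_word t) \<ge> 1"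
  using lie_word_nonempty[of t] by (cases "lie_word t") (auto simp: lyndon_terms_def)

lemma partial_conj_commutator_eval:
  assumes "2 \<le> m" "m \<le> n" "t \<in> lyndon_terms {1..m}"
  shows "partial_conj n m (commutator_eval (I_group n) (yaut n m) t)
    (commutator_eval (Fn n) (\<lambda>i. inv\<^bsub>Fn n\<^esub> (fgen i)) t)"
  using assms(3)
  by (induction t rule: lyndon_terms_induct) (use assms in \<open>auto intro: partial_conj_yaut partial_conj_commutator\<close>)

lemma commutator_eval_lower_central:
  assumes "group G" "\<And>x. x \<in> A \<Longrightarrow> f x \<in> carrier G" "t \<in> lyndon_terms A"
  shows "commutator_eval G f t \<in> lower_central G (length (lie_word t))"
  using assms(3)
proof (induction t rule: lyndon_terms_induct)
  case (LBr s t)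
  then show ?case
    using group.lower_central_commutator[OF assms(1) LBr.IH] length_lie_word_pos by auto
qed (simp add: assms(2) One_nat_def)

lemma nc_eval_lyndon_order:
  assumes "t \<in> lyndon_terms A"
  shows "nc_eval t \<in> nc_order (length (lie_word t))"
  using lyndon_leading_word(2)[of t] assms by (force simp: nc_order_def lyndon_terms_def)

text \<open>An inverse generator has expansion exactly \<open>1 + nc_var i\<close>, so the leading
  part of an iterated commutator of inverse generators is the Lie monomial itself, without
  signs.\<close>

lemma magnus_commutator_eval:
  assumes "A \<subseteq> S" "t \<in> lyndon_terms A"
  shows "magnus (commutator_eval (free_group S) (\<lambda>i. inv\<^bsub>free_group S\<^esub> (fgen i)) t) - 1 - nc_eval t
    \<in> nc_order (Suc (length (lie_word t)))"
  using assms(2)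
proof (induction t rule: lyndon_terms_induct)
  case (LGen x)
  then have "x \<in> S" using assms(1) by blast
  then show ?case by (simp add: magnus_inv_fgen)
next
  case (LBr s t)
  interpret F: group "free_group S" by (rule free_group_group)
  have "commutator_eval (free_group S) (\<lambda>i. inv\<^bsub>free_group S\<^esub> (fgen i)) r \<in> carrier (free_group S)"
    if "r \<in> lyndon_terms A" for r
    using that
    by (induction r rule: lyndon_terms_induct)
      (simp_all add: fgen_carrier[of _ S] subsetD[OF assms(1)])
  then show ?case
    using magnus_commutator_leading[OF _ _ nc_eval_lyndon_order LBr.IH(1) nc_eval_lyndon_order LBr.IH(2)] LBr.hyps
    by simp
qed

section \<open>Detecting elements of the associated graded ring\<close>

text \<open>An additive form of the Johnson homomorphism. If \<open>\<phi>\<close> multiplies the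
  generator \<open>k\<close> by \<open>u\<close> on the left, the difference is
  \<open>(magnus u - 1) * magnus (fgen k)\<close>, with the same leading part as
  \<open>magnus u - 1\<close>; as a plain difference it is easy to compute for sums and for
  conjugations.\<close>

definition magnus_diff :: "nat \<Rightarrow> (nat letter list \<Rightarrow> nat letter list) \<Rightarrow> nat nc_series" where
  "magnus_diff k \<phi> = magnus (\<phi> (fgen k)) - magnus (fgen k)"

lemma magnus_diff_order:
  assumes "\<phi> \<in> lower_central (I_group n) c" "c \<ge> 1" "k \<in> {1..n}"
  shows "magnus_diff k \<phi> \<in> nc_order (Suc c)"
proof -
  interpret act: ia_action "Fn n" "I_group n" "\<lambda>\<phi>. \<phi>" by (rule ia_action_I_group)
  have k: "fgen k \<in> carrier (Fn n)" using assms(3) by (rule fgen_carrier)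
  have \<phi>: "\<phi> \<in> carrier (I_group n)" using assms(1) by (rule act.G.lower_central_carrier)
  define u where "u = \<phi> (fgen k) \<otimes>\<^bsub>Fn n\<^esub> inv\<^bsub>Fn n\<^esub> (fgen k)"
  have "u \<in> lower_central (Fn n) (c + 1)"
    unfolding u_def using act.act_mult_inv_lower_central[OF assms(1) _ assms(2), of "fgen k" 1] k
    by (simp add: lower_central_1)
  then have u: "magnus u - 1 \<in> nc_order (Suc c)" using magnus_lower_central[of u "{1..n}" "c + 1"] by (simp add: Suc_eq_plus1[symmetric] del: Suc_eq_plus1)
  have "\<phi> (fgen k) = u \<otimes>\<^bsub>Fn n\<^esub> fgen k"
    using k act.act_closed[OF \<phi> k] by (simp add: u_def act.F.m_assoc)
  then have "magnus_diff k \<phi> = (magnus u - 1) * magnus (fgen k)"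
    by (simp add: magnus_diff_def magnus_mult left_diff_distrib)
  then show ?thesis using u by (simp add: nc_order_mult_right)
qed

text \<open>Let \<open>\<psi>\<close> multiply \<open>x\<close> by \<open>u\<close>, and let
  \<open>\<phi>\<close> multiply \<open>u\<close> by \<open>v\<close>. The deviation from additivity
  is a multiple of \<open>V\<close>, of order at least \<open>2c + 1\<close> as \<open>v\<close> has
  that degree, plus the product of \<open>U\<close> with a difference, each of order
  \<open>c + 1\<close>. Both reach order \<open>c + 2\<close> because
  \<open>c \<ge> 1\<close>.\<close>

lemma magnus_diff_mult:
  assumes "\<phi> \<in> lower_central (I_group n) c" "\<psi> \<in> lower_central (I_group n) c" "c \<ge> 1" "k \<in> {1..n}"
  shows "magnus_diff k (\<phi> \<otimes>\<^bsub>I_group n\<^esub> \<psi>) - (magnus_diff k \<phi> + magnus_diff k \<psi>) \<in> nc_order (Suc (Suc c))"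
proof -
  interpret act: ia_action "Fn n" "I_group n" "\<lambda>\<phi>. \<phi>" by (rule ia_action_I_group)
  define x where "x = (fgen k :: nat letter list)"
  have x: "x \<in> carrier (Fn n)" unfolding x_def using assms(4) by (rule fgen_carrier)
  have \<phi>: "\<phi> \<in> carrier (I_group n)" and \<psi>: "\<psi> \<in> carrier (I_group n)"
    using assms(1,2) by (auto intro: act.G.lower_central_carrier)
  interpret \<phi>: group_hom "Fn n" "Fn n" \<phi> using \<phi> by (rule act.act_group_hom)
  define u where "u = \<psi> x \<otimes>\<^bsub>Fn n\<^esub> inv\<^bsub>Fn n\<^esub> x"
  define v where "v = \<phi> u \<otimes>\<^bsub>Fn n\<^esub> inv\<^bsub>Fn n\<^esub> u"
  have u: "u \<in> lower_central (Fn n) (c + 1)"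
    unfolding u_def using act.act_mult_inv_lower_central[OF assms(2) _ assms(3), of x 1] x
    by (simp add: lower_central_1)
  then have uc: "u \<in> carrier (Fn n)" by (rule act.F.lower_central_carrier)
  have "v \<in> lower_central (Fn n) (c + (c + 1))"
    unfolding v_def using act.act_mult_inv_lower_central[OF assms(1) u assms(3)] by simp
  then have v: "v \<in> lower_central (Fn n) (Suc (Suc c))"
    by (rule act.F.lower_central_mono) (use assms(3) in simp)
  then have vc: "v \<in> carrier (Fn n)" by (rule act.F.lower_central_carrier)
  define V where "V = magnus v - 1"
  define U where "U = magnus u - 1"
  have V: "V \<in> nc_order (Suc (Suc c))" unfolding V_def using v by (rule magnus_lower_central)
  have U: "U \<in> nc_order (Suc c)" unfolding U_def using magnus_lower_central[OF u] by (simp add: Suc_eq_plus1[symmetric] del: Suc_eq_plus1)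
  have \<psi>x: "\<psi> x = u \<otimes>\<^bsub>Fn n\<^esub> x" using x act.act_closed[OF \<psi> x] by (simp add: u_def act.F.m_assoc)
  have \<phi>u: "\<phi> u = v \<otimes>\<^bsub>Fn n\<^esub> u" using uc by (simp add: v_def act.F.m_assoc)
  have "(\<phi> \<otimes>\<^bsub>I_group n\<^esub> \<psi>) x = v \<otimes>\<^bsub>Fn n\<^esub> u \<otimes>\<^bsub>Fn n\<^esub> \<phi> x"
    using act.act_mult[OF \<phi> \<psi> x] x uc by (simp add: \<psi>x \<phi>u)
  then have "magnus ((\<phi> \<otimes>\<^bsub>I_group n\<^esub> \<psi>) x) = (1 + V) * (1 + U) * magnus (\<phi> x)"
    by (simp add: magnus_mult V_def U_def)
  moreover have "magnus (\<phi> x) = magnus x + magnus_diff k \<phi>" by (simp add: magnus_diff_def x_def)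
  moreover have "magnus_diff k \<psi> = U * magnus x"
    using \<psi>x by (simp add: magnus_diff_def x_def magnus_mult U_def left_diff_distrib)
  ultimately have "magnus_diff k (\<phi> \<otimes>\<^bsub>I_group n\<^esub> \<psi>) - (magnus_diff k \<phi> + magnus_diff k \<psi>) =
      V * ((1 + U) * magnus (\<phi> x)) + U * magnus_diff k \<phi>"
    by (simp add: magnus_diff_def[of k "\<phi> \<otimes>\<^bsub>I_group n\<^esub> \<psi>"] x_def[symmetric] algebra_simps)
  moreover have "V * ((1 + U) * magnus (\<phi> x)) \<in> nc_order (Suc (Suc c))"
    using V by (rule nc_order_mult_right)
  moreover have "U * magnus_diff k \<phi> \<in> nc_order (Suc (Suc c))"
    using nc_order_mult[OF U magnus_diff_order[OF assms(1,3,4)]] by (rule nc_order_mono) simp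
  ultimately show ?thesis by (simp add: nc_order_add)
qed

lemma magnus_diff_coeff_mult:
  assumes "\<phi> \<in> lower_central (I_group n) c" "\<psi> \<in> lower_central (I_group n) c" "c \<ge> 1" "k \<in> {1..n}"
    and "length w = Suc c"
  shows "nc_coeff (magnus_diff k (\<phi> \<otimes>\<^bsub>I_group n\<^esub> \<psi>)) w = nc_coeff (magnus_diff k \<phi>) w + nc_coeff (magnus_diff k \<psi>) w"
  using magnus_diff_mult[OF assms(1-4)] assms(5) by (simp add: nc_order_def)

lemma magnus_diff_coeff_cong:
  assumes "\<phi> \<in> lower_central (I_group n) c" "\<psi> \<in> lower_central (I_group n) c" "c \<ge> 1" "k \<in> {1..n}"
    and "length w = Suc c" and eq: "group.lc_class (I_group n) c \<phi> = group.lc_class (I_group n) c \<psi>"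
  shows "nc_coeff (magnus_diff k \<phi>) w = nc_coeff (magnus_diff k \<psi>) w"
proof -
  interpret I: group "I_group n" by (rule I_group_group)
  define \<tau> where "\<tau> = \<phi> \<otimes>\<^bsub>I_group n\<^esub> inv\<^bsub>I_group n\<^esub> \<psi>"
  have c: "\<phi> \<in> carrier (I_group n)" "\<psi> \<in> carrier (I_group n)"
    using assms(1,2) by (auto intro: I.lower_central_carrier)
  have \<tau>: "\<tau> \<in> lower_central (I_group n) (Suc c)"
    using eq c by (simp add: \<tau>_def I.lc_class_eq_iff)
  have "\<phi> = \<tau> \<otimes>\<^bsub>I_group n\<^esub> \<psi>" using c by (simp add: \<tau>_def I.m_assoc)
  then have "nc_coeff (magnus_diff k \<phi>) w = nc_coeff (magnus_diff k \<tau>) w + nc_coeff (magnus_diff k \<psi>) w"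
    using magnus_diff_coeff_mult[OF I.lower_central_mono[OF \<tau>] assms(2-5)] by simp
  moreover have "nc_coeff (magnus_diff k \<tau>) w = 0"
    using magnus_diff_order[OF \<tau> _ assms(4)] assms(5) by (simp add: nc_order_def)
  ultimately show ?thesis by simp
qed

text \<open>All graded components are packed into one series: degree \<open>c\<close> is read off on
  words of length \<open>c + 1\<close>, since an element of degree \<open>c\<close> changes a
  generator, itself of degree 1, only from degree \<open>c + 1\<close> on. The representative is
  arbitrary; \<open>magnus_diff_coeff_cong\<close> makes the coefficient independent of the
  choice.\<close>

definition gr_magnus :: "nat \<Rightarrow> nat \<Rightarrow> (nat \<Rightarrow> (nat letter list \<Rightarrow> nat letter list) set) \<Rightarrow> nat nc_series" where
  "gr_magnus n k x = Abs_nc (\<lambda>w. if length w \<ge> 2 then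
     nc_coeff (magnus_diff k (SOME \<phi>. \<phi> \<in> lower_central (I_group n) (length w - 1) \<and>
       x (length w - 1) = group.lc_class (I_group n) (length w - 1) \<phi>)) w else 0)"

lemma gr_magnus_coeff:
  assumes "c \<ge> 1" "\<phi> \<in> lower_central (I_group n) c" "x c = group.lc_class (I_group n) c \<phi>" "k \<in> {1..n}"
    and "length w = Suc c"
  shows "nc_coeff (gr_magnus n k x) w = nc_coeff (magnus_diff k \<phi>) w"
proof -
  define \<psi> where "\<psi> = (SOME \<phi>. \<phi> \<in> lower_central (I_group n) c \<and> x c = group.lc_class (I_group n) c \<phi>)"
  have "\<psi> \<in> lower_central (I_group n) c \<and> x c = group.lc_class (I_group n) c \<psi>"
    unfolding \<psi>_def by (rule someI[of _ \<phi>]) (use assms in auto)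
  then have "nc_coeff (magnus_diff k \<psi>) w = nc_coeff (magnus_diff k \<phi>) w"
    using assms by (intro magnus_diff_coeff_cong[of _ n c]) auto
  moreover have "nc_coeff (gr_magnus n k x) w = nc_coeff (magnus_diff k \<psi>) w"
    using assms by (simp add: gr_magnus_def \<psi>_def)
  ultimately show ?thesis by simp
qed

lemma gr_magnus_coeff_0: "length w < 2 \<Longrightarrow> nc_coeff (gr_magnus n k x) w = 0"
  by (simp add: gr_magnus_def)

lemma gr_magnus_hom:
  assumes k: "k \<in> {1..n}"
  shows "group_hom (gr (I_group n)) nc_lie (gr_magnus n k)"
proof -
  interpret I: group "I_group n" by (rule I_group_group)
  interpret L: lie_ring "gr (I_group n)" by (rule I.gr_lie_ring)
  interpret N: lie_ring nc_lie by (rule nc_lie_ring)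
  have "gr_magnus n k (x \<otimes>\<^bsub>gr (I_group n)\<^esub> y) = gr_magnus n k x + gr_magnus n k y"
    if x: "x \<in> carrier (gr (I_group n))" and y: "y \<in> carrier (gr (I_group n))" for x y
  proof (rule nc_eqI)
    fix w :: "nat list"
    show "nc_coeff (gr_magnus n k (x \<otimes>\<^bsub>gr (I_group n)\<^esub> y)) w = nc_coeff (gr_magnus n k x + gr_magnus n k y) w"
    proof (cases "length w < 2")
      case False
      define c where "c = length w - 1"
      have c: "c \<ge> 1" "length w = Suc c" using False by (auto simp: c_def)
      obtain \<phi> where \<phi>: "\<phi> \<in> lower_central (I_group n) c" "x c = I.lc_class c \<phi>"
        using I.gr_component[OF x c(1)] by (rule I.gr_part_carrierE)
      obtain \<psi> where \<psi>: "\<psi> \<in> lower_central (I_group n) c" "y c = I.lc_class c \<psi>"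
        using I.gr_component[OF y c(1)] by (rule I.gr_part_carrierE)
      have xy: "(x \<otimes>\<^bsub>gr (I_group n)\<^esub> y) c = I.lc_class c (\<phi> \<otimes>\<^bsub>I_group n\<^esub> \<psi>)"
        using c \<phi> \<psi> by (simp add: I.gr_simps(2) I.gr_part_mult)
      have "nc_coeff (gr_magnus n k (x \<otimes>\<^bsub>gr (I_group n)\<^esub> y)) w = nc_coeff (magnus_diff k (\<phi> \<otimes>\<^bsub>I_group n\<^esub> \<psi>)) w"
        by (rule gr_magnus_coeff[OF c(1) I.lower_central_closed(2)[OF \<phi>(1) \<psi>(1)] _ k c(2)]) (rule xy)
      also have "\<dots> = nc_coeff (magnus_diff k \<phi>) w + nc_coeff (magnus_diff k \<psi>) w"
        by (rule magnus_diff_coeff_mult[OF \<phi>(1) \<psi>(1) c(1) k c(2)])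
      finally show ?thesis
        using gr_magnus_coeff[of c \<phi> n x k w, OF c(1) \<phi> k c(2)] gr_magnus_coeff[of c \<psi> n y k w, OF c(1) \<psi> k c(2)]
        by simp
    qed (simp add: gr_magnus_coeff_0)
  qed
  then show ?thesis by unfold_locales (auto simp: hom_def)
qed

lemma gr_magnus_class:
  assumes "c \<ge> 1" "\<phi> \<in> lower_central (I_group n) c" "k \<in> {1..n}"
  shows "nc_coeff (gr_magnus n k (gr_class (I_group n) c \<phi>)) w =
    (if length w = Suc c then nc_coeff (magnus_diff k \<phi>) w else 0)"
proof -
  interpret I: group "I_group n" by (rule I_group_group)
  have "length w = Suc c \<or> length w < 2 \<or> (\<exists>d. d \<ge> 1 \<and> d \<noteq> c \<and> length w = Suc d)" by presburger
  then consider "length w = Suc c" | "length w < 2" | d where "d \<ge> 1" "d \<noteq> c" "length w = Suc d"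
    by blast
  then show ?thesis
  proof cases
    case 1
    then show ?thesis
      using gr_magnus_coeff[OF assms(1,2) _ assms(3) 1, of "gr_class (I_group n) c \<phi>"] assms(1)
      by (simp add: I.gr_class_eq)
  next
    case 2
    then show ?thesis using assms(1) by (simp add: gr_magnus_coeff_0)
  next
    \<comment> \<open>In a degree other than \<open>c\<close> the component is trivial, so the
      identity automorphism serves as a representative.\<close>
    case 3
    have "nc_coeff (gr_magnus n k (gr_class (I_group n) c \<phi>)) w = nc_coeff (magnus_diff k \<one>\<^bsub>I_group n\<^esub>) w"
      by (rule gr_magnus_coeff[OF 3(1) _ _ assms(3) 3(3)])
        (use 3 in \<open>auto simp: I.gr_class_eq I.gr_part_one I.lower_central_closed\<close>)
    also have "\<dots> = 0"
      using I_group_one_apply[OF fgen_carrier[OF assms(3)]] by (simp add: magnus_diff_def)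
    finally show ?thesis using 3 by simp
  qed
qed

text \<open>For \<open>k \<le> m\<close> the generator is conjugated by \<open>u\<close>, so its
  change is the ring commutator of \<open>magnus u\<close> and \<open>magnus (fgen k)\<close> times
  a factor that is 1 up to positive order. The nonconstant leading parts are
  \<open>nc_eval t\<close> and \<open>- nc_var k\<close>, and the minus sign turns the commutator
  around. For \<open>k > m\<close> the generator is fixed.\<close>

lemma gr_magnus_lyndon:
  assumes m: "2 \<le> m" "m \<le> n" and t: "t \<in> lyndon_terms {1..m}" and k: "k \<in> {1..n}"
  shows "gr_magnus n k (gr_class (I_group n) (length (lie_word t)) (commutator_eval (I_group n) (yaut n m) t)) =
    (if k \<le> m then nc_var k * nc_eval t - nc_eval t * nc_var k else 0)"
proof -
  interpret I: group "I_group n" by (rule I_group_group)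
  interpret F: group "Fn n" by (rule free_group_group)
  interpret M: subgroup "carrier (Fn m)" "Fn n" using m by (intro free_group_subgroup) auto
  define c where "c = length (lie_word t)"
  define \<phi> where "\<phi> = commutator_eval (I_group n) (yaut n m) t"
  define u where "u = commutator_eval (Fn n) (\<lambda>i. inv\<^bsub>Fn n\<^esub> (fgen i)) t"
  have c: "c \<ge> 1" unfolding c_def using t by (rule length_lie_word_pos)
  have \<phi>: "\<phi> \<in> lower_central (I_group n) c"
    unfolding \<phi>_def c_def
    by (rule commutator_eval_lower_central[OF I.is_group _ t]) (use m yaut_I_group in auto)
  have conj: "partial_conj n m \<phi> u" unfolding \<phi>_def u_def using m t by (rule partial_conj_commutator_eval)
  have kc: "fgen k \<in> carrier (Fn n)" using k by (rule fgen_carrier)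
  have E: "nc_eval t \<in> nc_order c" unfolding c_def using t by (rule nc_eval_lyndon_order)
  have homog: "length w = c" if "nc_coeff (nc_eval t) w \<noteq> 0" for w
    using lyndon_leading_word(2)[OF _ that] t by (simp add: c_def lyndon_terms_def)
  have cls: "nc_coeff (gr_magnus n k (gr_class (I_group n) c \<phi>)) w =
    (if length w = Suc c then nc_coeff (magnus_diff k \<phi>) w else 0)" for w
    by (rule gr_magnus_class[OF c \<phi> k])
  show ?thesis
  proof (cases "k \<le> m")
    case True
    define Y where "Y = nc_var k"
    define P where "P = magnus u - 1 - nc_eval t"
    define R where "R = magnus (fgen k) - 1 + Y"
    define V where "V = magnus (inv\<^bsub>Fn n\<^esub> u) - 1"
    have P: "P \<in> nc_order (Suc c)" unfolding P_def u_def c_def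
      by (rule magnus_commutator_eval[OF _ t]) (use m in auto)
    have R: "R \<in> nc_order 2" unfolding R_def Y_def magnus_fgen by (rule nc_inv_var_order)
    have V: "V \<in> nc_order 1" unfolding V_def by (rule magnus_minus_one)
    have uc: "u \<in> carrier (Fn n)" using conj by (auto simp: partial_conj_def)
    have "fgen k \<in> carrier (Fn m)" using k True by (intro fgen_carrier) auto
    then have "\<phi> (fgen k) = u \<otimes>\<^bsub>Fn n\<^esub> fgen k \<otimes>\<^bsub>Fn n\<^esub> inv\<^bsub>Fn n\<^esub> u"
      using conj by (auto simp: partial_conj_def)
    then have "magnus_diff k \<phi> = (magnus u * magnus (fgen k) - magnus (fgen k) * magnus u) * magnus (inv\<^bsub>Fn n\<^esub> u)"
      using magnus_inv(2)[OF uc] by (simp add: magnus_diff_def magnus_mult left_diff_distrib mult.assoc)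
    also have "magnus u = 1 + nc_eval t + P" by (simp add: P_def)
    also have "magnus (fgen k) = 1 - Y + R" by (simp add: R_def)
    also have "magnus (inv\<^bsub>Fn n\<^esub> u) = 1 + V" by (simp add: V_def)
    finally have "magnus_diff k \<phi> - (Y * nc_eval t - nc_eval t * Y) =
      (Y * nc_eval t - nc_eval t * Y) * V + ((nc_eval t * R - R * nc_eval t) + (P * (R - Y) - (R - Y) * P)) * (1 + V)"
      by (simp add: algebra_simps)
    also have "\<dots> \<in> nc_order (Suc (Suc c))"
    proof (intro nc_order_add)
      have "Y * nc_eval t - nc_eval t * Y \<in> nc_order (1 + c)"
        unfolding Y_def by (rule nc_bracket_order[OF nc_order_var E])
      from nc_order_mult[OF this V] show "(Y * nc_eval t - nc_eval t * Y) * V \<in> nc_order (Suc (Suc c))"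
        by (rule nc_order_mono) simp
      have "R - Y \<in> nc_order 1"
        using R nc_order_var by (auto simp: Y_def intro!: nc_order_diff elim: nc_order_mono)
      from nc_bracket_order[OF P this] have 1: "P * (R - Y) - (R - Y) * P \<in> nc_order (Suc (Suc c))" by (simp add: One_nat_def numeral_2_eq_2)
      from nc_bracket_order[OF E R] have 2: "nc_eval t * R - R * nc_eval t \<in> nc_order (Suc (Suc c))" by (simp add: One_nat_def numeral_2_eq_2)
      show "((nc_eval t * R - R * nc_eval t) + (P * (R - Y) - (R - Y) * P)) * (1 + V) \<in> nc_order (Suc (Suc c))"
        by (rule nc_order_mult_right[OF nc_order_add[OF 2 1]])
    qed
    finally have diff: "magnus_diff k \<phi> - (Y * nc_eval t - nc_eval t * Y) \<in> nc_order (Suc (Suc c))" .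
    \<comment> \<open>The commutator is homogeneous of degree \<open>c + 1\<close>, and so is the
      value of \<open>gr_magnus\<close> on a class of degree \<open>c\<close>; agreement below order
      \<open>c + 2\<close> is therefore equality.\<close>
    have "length w = Suc c" if "nc_coeff (Y * nc_eval t - nc_eval t * Y) w \<noteq> 0" for w
    proof -
      have "nc_coeff (Y * nc_eval t) w \<noteq> 0 \<or> nc_coeff (nc_eval t * Y) w \<noteq> 0" using that by auto
      then obtain a b where "w = a @ b" "nc_coeff Y a \<noteq> 0 \<and> nc_coeff (nc_eval t) b \<noteq> 0 \<or> nc_coeff (nc_eval t) a \<noteq> 0 \<and> nc_coeff Y b \<noteq> 0"
        unfolding nc_coeff_mult by (metis conv_nonzeroE)
      then show ?thesis using homog[of a] homog[of b] by (auto simp: Y_def split: if_splits)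
    qed
    then have "gr_magnus n k (gr_class (I_group n) c \<phi>) = Y * nc_eval t - nc_eval t * Y"
      using diff cls by (intro nc_eqI) (fastforce simp: nc_order_def)
    then show ?thesis using True by (simp add: c_def \<phi>_def Y_def)
  next
    case False
    then have "\<phi> (fgen k) = fgen k" using conj k by (auto simp: partial_conj_def)
    then have "magnus_diff k \<phi> = 0" by (simp add: magnus_diff_def)
    then have "gr_magnus n k (gr_class (I_group n) c \<phi>) = 0" using cls by (intro nc_eqI) simp
    then show ?thesis using False by (simp add: c_def \<phi>_def)
  qed
qed

section \<open>The relations\<close>

lemma I_group_eqI:
  assumes "\<phi> \<in> carrier (I_group n)" "\<psi> \<in> carrier (I_group n)"
    and "\<And>k. k \<in> {1..n} \<Longrightarrow> \<phi> (fgen k) = \<psi> (fgen k)"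
  shows "\<phi> = \<psi>"
proof (rule extensionalityI[of _ "carrier (Fn n)"])
  show "\<phi> \<in> extensional (carrier (Fn n))" "\<psi> \<in> extensional (carrier (Fn n))"
    using I_group_auto assms(1,2) by (auto simp: auto_def Bij_def)
  show "\<phi> w = \<psi> w" if "w \<in> carrier (Fn n)" for w
    by (rule group.free_group_hom_eqI[OF free_group_group I_group_hom I_group_hom _ that]) (use assms in auto)
qed

text \<open>On the first \<open>m\<close> generators \<open>b\<close> turns the conjugation by
  \<open>u\<close> into the conjugation by \<open>b u\<close>; the remaining generators are fixed by
  all three automorphisms. The relations between two rows come from this, with \<open>b\<close>
  taken from the lower one.\<close>

lemma partial_conj_intertwine:
  assumes mn: "m \<le> n" and a: "partial_conj n m a v" and c: "partial_conj n m c u"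
    and b: "b \<in> carrier (I_group n)" and bu: "b u = v"
    and b1: "\<And>k. k \<in> {1..m} \<Longrightarrow> b (fgen k) \<in> carrier (Fn m)"
    and b2: "\<And>k. k \<in> {m<..n} \<Longrightarrow> b (fgen k) = fgen k"
  shows "a \<otimes>\<^bsub>I_group n\<^esub> b = b \<otimes>\<^bsub>I_group n\<^esub> c"
proof -
  interpret act: ia_action "Fn n" "I_group n" "\<lambda>\<phi>. \<phi>" by (rule ia_action_I_group)
  interpret M: subgroup "carrier (Fn m)" "Fn n" using mn by (intro free_group_subgroup) auto
  interpret b: group_hom "Fn n" "Fn n" b using b by (rule act.act_group_hom)
  have ac: "a \<in> carrier (I_group n)" "c \<in> carrier (I_group n)" and u: "u \<in> carrier (Fn m)"
    using a c by (simp_all add: partial_conj_def)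
  have uc: "u \<in> carrier (Fn n)" using u by (rule M.mem_carrier)
  show ?thesis
  proof (rule I_group_eqI)
    fix k assume k: "k \<in> {1..n}"
    have kc: "fgen k \<in> carrier (Fn n)" using k by (rule fgen_carrier)
    show "(a \<otimes>\<^bsub>I_group n\<^esub> b) (fgen k) = (b \<otimes>\<^bsub>I_group n\<^esub> c) (fgen k)"
    proof (cases "k \<le> m")
      case True
      then have km: "k \<in> {1..m}" "fgen k \<in> carrier (Fn m)" using k by (auto intro: fgen_carrier)
      have "a (b (fgen k)) = v \<otimes>\<^bsub>Fn n\<^esub> b (fgen k) \<otimes>\<^bsub>Fn n\<^esub> inv\<^bsub>Fn n\<^esub> v"
        using a b1[OF km(1)] by (simp add: partial_conj_def)
      moreover have "c (fgen k) = u \<otimes>\<^bsub>Fn n\<^esub> fgen k \<otimes>\<^bsub>Fn n\<^esub> inv\<^bsub>Fn n\<^esub> u"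
        using c km by (simp add: partial_conj_def)
      ultimately show ?thesis using ac b kc uc bu by (simp add: I_group_mult_apply)
    next
      case False
      then have "a (fgen k) = fgen k" "c (fgen k) = fgen k" "b (fgen k) = fgen k"
        using a c b2 k by (auto simp: partial_conj_def)
      then show ?thesis using ac b kc by (simp add: I_group_mult_apply)
    qed
  qed (use ac b in auto)
qed

lemma yaut_image:
  assumes "2 \<le> r" "r < m" "m \<le> n" "1 \<le> j" "j \<le> r"
  shows "k \<in> {1..m} \<Longrightarrow> yaut n r j (fgen k) \<in> carrier (Fn m)"
    and "k \<in> {m<..n} \<Longrightarrow> yaut n r j (fgen k) = fgen k"
proof -
  interpret F: group "Fn n" by (rule free_group_group)
  interpret M: subgroup "carrier (Fn m)" "Fn n" using assms by (intro free_group_subgroup) auto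
  have j: "j \<in> {1..n}" "fgen j \<in> carrier (Fn m)" using assms by (auto intro!: fgen_carrier)
  show "yaut n r j (fgen k) \<in> carrier (Fn m)" if "k \<in> {1..m}"
  proof -
    have "fgen k \<in> carrier (Fn m)" using that by (rule fgen_carrier)
    then show ?thesis using yaut_fgen[of k n j r] j that assms(3) by simp
  qed
  show "yaut n r j (fgen k) = fgen k" if "k \<in> {m<..n}"
    using yaut_fgen[of k n j r] j that assms(2) by auto
qed

text \<open>On the first \<open>r\<close> generators \<open>b\<close> and \<open>d\<close> are the
  same conjugation, by the generator \<open>j\<close>. As the generator \<open>i\<close> is among
  them, \<open>a\<close> is conjugated by \<open>b\<close> and by \<open>d\<close> into the same
  automorphism \<open>c\<close>. For \<open>i = j\<close> the right-hand side is trivial, which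
  gives the relators of kind (1); other pairs give kind (3).\<close>

lemma commutator_yaut_same:
  assumes m: "2 \<le> r" "r < m" "m \<le> n" and i: "1 \<le> i" "i \<le> r" and j: "1 \<le> j" "j \<le> r"
  shows "commutator (I_group n) (yaut n m i) (yaut n r j) = commutator (I_group n) (yaut n m i) (yaut n m j)"
proof -
  interpret act: ia_action "Fn n" "I_group n" "\<lambda>\<phi>. \<phi>" by (rule ia_action_I_group)
  interpret R: subgroup "carrier (Fn r)" "Fn n" using m by (intro free_group_subgroup) auto
  define a where "a = yaut n m i"
  define b where "b = yaut n r j"
  define d where "d = yaut n m j"
  define c where "c = inv\<^bsub>I_group n\<^esub> d \<otimes>\<^bsub>I_group n\<^esub> a \<otimes>\<^bsub>I_group n\<^esub> d"
  define x where "x = (fgen i :: nat letter list)"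
  define y where "y = (fgen j :: nat letter list)"
  have abd: "a \<in> carrier (I_group n)" "b \<in> carrier (I_group n)" "d \<in> carrier (I_group n)"
    unfolding a_def b_def d_def using m i j by (auto intro!: yaut_I_group)
  have xyr: "x \<in> carrier (Fn r)" "y \<in> carrier (Fn r)" unfolding x_def y_def using i j by (auto intro!: fgen_carrier)
  then have xy: "x \<in> carrier (Fn n)" "y \<in> carrier (Fn n)" using R.mem_carrier by auto
  have pa: "partial_conj n m a (inv\<^bsub>Fn n\<^esub> x)" and pd: "partial_conj n m d (inv\<^bsub>Fn n\<^esub> y)"
    unfolding a_def d_def x_def y_def using m i j by (auto intro!: partial_conj_yaut)
  define u where "u = inv\<^bsub>Fn n\<^esub> (inv\<^bsub>Fn n\<^esub> y) \<otimes>\<^bsub>Fn n\<^esub> inv\<^bsub>Fn n\<^esub> x \<otimes>\<^bsub>Fn n\<^esub> inv\<^bsub>Fn n\<^esub> y"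
  have pc: "partial_conj n m c u"
    unfolding c_def u_def by (intro partial_conj_mult partial_conj_inv pa pd m(3))
  have "u \<in> carrier (Fn r)" using xyr by (simp add: u_def)
  then have "b u = inv\<^bsub>Fn n\<^esub> y \<otimes>\<^bsub>Fn n\<^esub> u \<otimes>\<^bsub>Fn n\<^esub> y"
    unfolding b_def y_def using m j by (intro yaut_conjugation) auto
  also have "\<dots> = inv\<^bsub>Fn n\<^esub> x" using xy by (simp add: u_def act.F.m_assoc act.F.inv_mult_cancel)
  finally have bu: "b u = inv\<^bsub>Fn n\<^esub> x" .
  have "a \<otimes>\<^bsub>I_group n\<^esub> b = b \<otimes>\<^bsub>I_group n\<^esub> c"
    by (rule partial_conj_intertwine[OF m(3) pa pc abd(2) bu]) (use yaut_image[OF m j] in \<open>auto simp: b_def\<close>)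
  then have "inv\<^bsub>I_group n\<^esub> b \<otimes>\<^bsub>I_group n\<^esub> (a \<otimes>\<^bsub>I_group n\<^esub> b) = c"
    using abd by (simp add: c_def act.G.inv_mult_cancel)
  then have "commutator (I_group n) a b = inv\<^bsub>I_group n\<^esub> a \<otimes>\<^bsub>I_group n\<^esub> c"
    using abd by (simp add: commutator_def act.G.m_assoc)
  also have "\<dots> = commutator (I_group n) a d"
    using abd by (simp add: c_def commutator_def act.G.m_assoc)
  finally show ?thesis by (simp add: a_def b_def d_def)
qed

text \<open>As \<open>i > r\<close>, the automorphism \<open>b\<close> fixes the generator
  \<open>i\<close> and hence commutes with the conjugation by it.\<close>

lemma commutator_yaut_one:
  assumes m: "2 \<le> r" "m \<le> n" and i: "r < i" "i \<le> m" and j: "1 \<le> j" "j \<le> r"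
  shows "commutator (I_group n) (yaut n m i) (yaut n r j) = \<one>\<^bsub>I_group n\<^esub>"
proof -
  interpret act: ia_action "Fn n" "I_group n" "\<lambda>\<phi>. \<phi>" by (rule ia_action_I_group)
  define a where "a = yaut n m i"
  define b where "b = yaut n r j"
  define x where "x = (fgen i :: nat letter list)"
  have ab: "a \<in> carrier (I_group n)" "b \<in> carrier (I_group n)"
    unfolding a_def b_def using m i j by (auto intro!: yaut_I_group)
  have pa: "partial_conj n m a (inv\<^bsub>Fn n\<^esub> x)"
    unfolding a_def x_def using m i j by (auto intro!: partial_conj_yaut)
  interpret b: group_hom "Fn n" "Fn n" b using ab(2) by (rule act.act_group_hom)
  have ij: "i \<in> {1..n}" "j \<in> {1..n}" using m i j by auto
  have "b x = x" using yaut_fgen[OF ij, of r] i by (simp add: b_def x_def)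
  moreover have "x \<in> carrier (Fn n)" unfolding x_def using ij(1) by (rule fgen_carrier)
  ultimately have bx: "b (inv\<^bsub>Fn n\<^esub> x) = inv\<^bsub>Fn n\<^esub> x" by simp
  have rm: "r < m" using i by simp
  have "a \<otimes>\<^bsub>I_group n\<^esub> b = b \<otimes>\<^bsub>I_group n\<^esub> a"
    by (rule partial_conj_intertwine[OF m(2) pa pa ab(2) bx]) (use yaut_image[OF m(1) rm m(2) j] in \<open>auto simp: b_def\<close>)
  then show ?thesis using ab by (simp add: act.G.commutator_eq_one_iff a_def b_def)
qed

text \<open>Each term of the series is generated by commutators of the preceding term with
  \<open>G\<close>, and the classes of these are brackets with elements of degree 1. Generation in
  degree 1 is the source of surjectivity in the presentation.\<close>

lemma (in group) gr_generated:
  assumes K: "subgroup K (gr G)" and br: "\<And>x y. \<lbrakk>x \<in> K; y \<in> K\<rbrakk> \<Longrightarrow> bracket (gr G) x y \<in> K"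
    and deg1: "\<And>a. a \<in> carrier G \<Longrightarrow> gr_class G 1 a \<in> K"
  shows "carrier (gr G) \<subseteq> K"
proof
  interpret K: subgroup K "gr G" by fact
  have cls: "gr_class G c a \<in> K" if "c \<ge> 1" "a \<in> lower_central G c" for c a
    using that
  proof (induction c arbitrary: a rule: dec_induct)
    case base
    then show ?case using deg1 by (simp add: lower_central_1)
  next
    case (step c)
    define N where "N = {a \<in> lower_central G (Suc c). gr_class G (Suc c) a \<in> K}"
    have "subgroup N G"
    proof (rule subgroupI)
      have "\<one> \<in> N" by (simp add: N_def lower_central_closed gr_class_one K.one_closed)
      then show "N \<noteq> {}" by blast
      fix a assume a: "a \<in> N"
      then show "inv a \<in> N" by (simp add: N_def lower_central_closed gr_class_inv K.m_inv_closed)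
      fix b assume "b \<in> N"
      with a show "a \<otimes> b \<in> N" using K.m_closed[of "gr_class G (Suc c) a" "gr_class G (Suc c) b"]
        by (simp add: N_def lower_central_closed gr_class_mult)
    qed (auto simp: N_def intro: lower_central_carrier)
    moreover have "commutator G a b \<in> N" if a: "a \<in> lower_central G c" and b: "b \<in> carrier G" for a b
    proof -
      have b1: "b \<in> lower_central G 1" using b by (simp add: lower_central_1)
      have "bracket (gr G) (gr_class G c a) (gr_class G 1 b) \<in> K"
        by (rule br[OF step.IH[OF a] deg1[OF b]])
      then show ?thesis
        using gr_bracket_class[OF a b1 step.hyps(1)] lower_central_commutator[OF a b1 step.hyps(1)]
        by (simp add: N_def Suc_eq_plus1)
    qed
    ultimately have "lower_central G (Suc c) \<subseteq> N"
      unfolding lower_central_Suc[OF step.hyps(1)] by (intro generate_subgroup_incl) auto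
    then show ?case using step.prems by (auto simp: N_def)
  qed
  fix x assume "x \<in> carrier (gr G)"
  then show "x \<in> K"
    by (induction x rule: gr_induct) (simp_all add: K.one_closed K.m_closed cls)
qed

lemma gr_I_group_generated:
  assumes K: "subgroup K (gr (I_group n))"
    and br: "\<And>x y. \<lbrakk>x \<in> K; y \<in> K\<rbrakk> \<Longrightarrow> bracket (gr (I_group n)) x y \<in> K"
    and gens: "\<And>m i. (m, i) \<in> ygens n \<Longrightarrow> gr_class (I_group n) 1 (yaut n m i) \<in> K"
  shows "carrier (gr (I_group n)) \<subseteq> K"
proof -
  interpret I: group "I_group n" by (rule I_group_group)
  interpret K: subgroup K "gr (I_group n)" by fact
  define N where "N = {a \<in> carrier (I_group n). gr_class (I_group n) 1 a \<in> K}"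
  have "subgroup N (I_group n)"
  proof (rule I.subgroupI)
    have "\<one>\<^bsub>I_group n\<^esub> \<in> N" by (simp add: N_def I.gr_class_one K.one_closed)
    then show "N \<noteq> {}" by blast
    fix a assume a: "a \<in> N"
    then show "inv\<^bsub>I_group n\<^esub> a \<in> N" by (simp add: N_def I.gr_class_inv lower_central_1 K.m_inv_closed)
    fix b assume "b \<in> N"
    with a show "a \<otimes>\<^bsub>I_group n\<^esub> b \<in> N"
      using K.m_closed[of "gr_class (I_group n) 1 a" "gr_class (I_group n) 1 b"]
      by (simp add: N_def I.gr_class_mult lower_central_1)
  qed (auto simp: N_def)
  then have "carrier (I_group n) \<subseteq> N"
    by (rule I_group_generated) (auto simp: N_def yaut_I_group gens ygens_def)
  then show ?thesis
    by (intro I.gr_generated K br) (auto simp: N_def)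
qed

section \<open>The presentation\<close>

context lie_ring
begin

text \<open>The carrier is itself an ideal containing \<open>R\<close>, which keeps the intersection
  inside the ring.\<close>

lemma gen_lie_ideal_ideal:
  assumes "R \<subseteq> carrier L"
  shows "lie_ideal (gen_lie_ideal L R) L"
proof -
  have "lie_ideal (carrier L) L" by (simp add: lie_ideal_def subgroup_self bracket_closed)
  then have whole: "gen_lie_ideal L R \<subseteq> carrier L" using assms by (auto simp: gen_lie_ideal_def)
  have "subgroup (gen_lie_ideal L R) L"
  proof (rule subgroupI[OF whole])
    have "\<one> \<in> gen_lie_ideal L R" by (auto simp: gen_lie_ideal_def lie_ideal_def subgroup.one_closed)
    then show "gen_lie_ideal L R \<noteq> {}" by blast
  qed (auto simp: gen_lie_ideal_def lie_ideal_def intro: subgroup.m_closed subgroup.m_inv_closed)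
  then show ?thesis by (auto simp: lie_ideal_def gen_lie_ideal_def)
qed

lemma gen_lie_ideal_incl: "R \<subseteq> gen_lie_ideal L R"
  by (auto simp: gen_lie_ideal_def)

lemma gen_lie_ideal_minimal: "\<lbrakk>lie_ideal I L; R \<subseteq> I\<rbrakk> \<Longrightarrow> gen_lie_ideal L R \<subseteq> I"
  by (auto simp: gen_lie_ideal_def)

lemma lie_ideal_bracket:
  assumes "lie_ideal I L" "x \<in> carrier L" "a \<in> I"
  shows "bracket L x a \<in> I" "bracket L a x \<in> I"
proof -
  interpret I: subgroup I L using assms(1) by (simp add: lie_ideal_def)
  show xa: "bracket L x a \<in> I" using assms by (simp add: lie_ideal_def)
  have "bracket L a x = inv (bracket L x a)" using assms by (intro bracket_antisym) auto
  then show "bracket L a x \<in> I" using xa by simp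
qed

lemma generate_bracket_closed:
  assumes "B \<subseteq> carrier L" "\<And>a b. \<lbrakk>a \<in> B; b \<in> B\<rbrakk> \<Longrightarrow> bracket L a b \<in> generate L B"
    and "x \<in> generate L B" "y \<in> generate L B"
  shows "bracket L x y \<in> generate L B"
proof (rule bracket_generate_left[OF assms(3,1)])
  show y: "y \<in> carrier L" using assms(1,4) generate_in_carrier by blast
  show "subgroup (generate L B) L" using assms(1) by (rule generate_is_subgroup)
  fix b assume "b \<in> B"
  then show "bracket L b y \<in> generate L B"
    using assms by (intro bracket_generate_right[OF assms(4,1)] generate_is_subgroup) auto
qed

end

lemma lie_hom_kernel_ideal:
  assumes "lie_ring L" "lie_ring M" "h \<in> lie_hom L M"
  shows "lie_ideal (kernel L M h) L"
proof -
  interpret L: lie_ring L by fact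
  interpret M: lie_ring M by fact
  interpret h: group_hom L M h by unfold_locales (use assms(3) in \<open>simp add: lie_hom_def\<close>)
  show ?thesis
    using assms(3) h.subgroup_kernel
    by (auto simp: lie_ideal_def kernel_def lie_hom_def L.bracket_closed)
qed

lemma lie_hom_lie_eval:
  assumes "lie_ring L" "lie_ring M" "h \<in> lie_hom L M" "\<And>x. g x \<in> carrier L" "t \<in> lyndon_terms A"
    and "\<And>x. x \<in> A \<Longrightarrow> h (g x) = g' x"
  shows "h (lie_eval L g t) = lie_eval M g' t"
  using assms(5)
proof (induction t rule: lyndon_terms_induct)
  case (LBr s t)
  then show ?case
    using assms(3) lie_ring.lie_eval_closed[OF assms(1), of g, OF assms(4)] by (simp add: lie_hom_def)
qed (simp add: assms(6))

lemma group_hom_eq_on_generate: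
  assumes "group_hom G H f" "group_hom G H g" "B \<subseteq> carrier G" "\<And>b. b \<in> B \<Longrightarrow> f b = g b"
    and "x \<in> generate G B"
  shows "f x = g x"
proof -
  interpret f: group_hom G H f by fact
  interpret g: group_hom G H g by fact
  from assms(5) show ?thesis
  proof (induction rule: generate.induct)
    case (inv b)
    then show ?case using assms(3,4) by auto
  next
    case (eng a b)
    then show ?case using f.G.generate_in_carrier[OF assms(3)] by simp
  qed (use assms(4) in auto)
qed

text \<open>The generator extended by zero to all pairs of indices, so that every letter has a value
  in the ring, as \<open>lie_eval_closed\<close> demands.\<close>

definition y_lie :: "nat \<Rightarrow> nat \<Rightarrow> nat \<Rightarrow> (nat \<times> nat) lie_term set" where
  "y_lie n m i = (if (m, i) \<in> ygens n then lie_gen (ygens n) (m, i) else \<one>\<^bsub>free_lie (ygens n)\<^esub>)"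

lemma y_lie_carrier: "y_lie n m i \<in> carrier (free_lie (ygens n))"
proof -
  interpret F: lie_ring "free_lie (ygens n)" by (rule free_lie_lie_ring)
  show ?thesis by (simp add: y_lie_def lie_gen_carrier)
qed

section \<open>The ideal of the relators and the span of the rows\<close>

definition y_ideal :: "nat \<Rightarrow> (nat \<times> nat) lie_term set set" where
  "y_ideal n = gen_lie_ideal (free_lie (ygens n)) (yrelators n)"

lemma yrelators_eq:
  "yrelators n = (let F = free_lie (ygens n) in
      {bracket F (y_lie n m i) (y_lie n r i) | m r i.
         2 \<le> r \<and> r < m \<and> m \<le> n \<and> 1 \<le> i \<and> i \<le> r} \<union>
      {bracket F (y_lie n m i) (y_lie n r j) | m r i j.
         2 \<le> r \<and> r < i \<and> i \<le> m \<and> m \<le> n \<and> 1 \<le> j \<and> j \<le> r} \<union>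
      {bracket F (y_lie n m i) (y_lie n r j) \<otimes>\<^bsub>F\<^esub> inv\<^bsub>F\<^esub> (bracket F (y_lie n m i) (y_lie n m j)) | m r i j.
         2 \<le> r \<and> r < m \<and> m \<le> n \<and> 1 \<le> i \<and> i \<le> r \<and> 1 \<le> j \<and> j \<le> r \<and> j \<noteq> i})"
proof -
  have y: "lie_gen (ygens n) (m, i) = y_lie n m i" if "2 \<le> m" "m \<le> n" "1 \<le> i" "i \<le> m" for m i
    using that by (simp add: y_lie_def ygens_def)
  show ?thesis
    unfolding yrelators_def Let_def
    by (intro arg_cong2[of _ _ _ _ "(\<union>)"] Collect_cong ex_cong1 rev_conj_cong refl) (auto simp: y)
qed

lemma yrelatorsI:
  "\<lbrakk>2 \<le> r; r < m; m \<le> n; 1 \<le> i; i \<le> r\<rbrakk>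
    \<Longrightarrow> bracket (free_lie (ygens n)) (y_lie n m i) (y_lie n r i) \<in> yrelators n"
  "\<lbrakk>2 \<le> r; r < i; i \<le> m; m \<le> n; 1 \<le> j; j \<le> r\<rbrakk>
    \<Longrightarrow> bracket (free_lie (ygens n)) (y_lie n m i) (y_lie n r j) \<in> yrelators n"
  "\<lbrakk>2 \<le> r; r < m; m \<le> n; 1 \<le> i; i \<le> r; 1 \<le> j; j \<le> r; j \<noteq> i\<rbrakk>
    \<Longrightarrow> bracket (free_lie (ygens n)) (y_lie n m i) (y_lie n r j) \<otimes>\<^bsub>free_lie (ygens n)\<^esub>
      inv\<^bsub>free_lie (ygens n)\<^esub> (bracket (free_lie (ygens n)) (y_lie n m i) (y_lie n m j)) \<in> yrelators n"
  unfolding yrelators_eq Let_def by blast+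

lemma yrelators_carrier: "yrelators n \<subseteq> carrier (free_lie (ygens n))"
proof -
  interpret F: lie_ring "free_lie (ygens n)" by (rule free_lie_lie_ring)
  show ?thesis unfolding yrelators_eq Let_def by (auto simp: F.bracket_closed y_lie_carrier)
qed

lemma y_ideal_ideal: "lie_ideal (y_ideal n) (free_lie (ygens n))"
  unfolding y_ideal_def by (rule lie_ring.gen_lie_ideal_ideal[OF free_lie_lie_ring yrelators_carrier])

lemma y_ideal_subgroup: "subgroup (y_ideal n) (free_lie (ygens n))"
  using y_ideal_ideal by (simp add: lie_ideal_def)

text \<open>Row \<open>m\<close> consists of the generators with first index \<open>m\<close>.\<close>

definition row_lyndon :: "nat \<Rightarrow> nat \<Rightarrow> (nat \<times> nat) lie_term set set" where
  "row_lyndon n m = lie_eval (free_lie (ygens n)) (y_lie n m) ` lyndon_terms {1..m}"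

lemma row_lyndon_carrier: "row_lyndon n m \<subseteq> carrier (free_lie (ygens n))"
  using lie_ring.lie_eval_closed[OF free_lie_lie_ring y_lie_carrier] by (auto simp: row_lyndon_def)

lemma row_lyndon_y_lie: "i \<in> {1..m} \<Longrightarrow> y_lie n m i \<in> row_lyndon n m"
  unfolding row_lyndon_def by (rule image_eqI[of _ _ "LGen i"]) (auto simp: lyndon_terms_def intro: lyndon.LGen)

text \<open>Brackets of Lyndon elements of one row are integer combinations of Lyndon elements of
  that row, and the ideal absorbs every bracket with one of its elements.\<close>

lemma row_bracket_closed:
  fixes n m
  defines "F \<equiv> free_lie (ygens n)"
  defines "H \<equiv> generate F (row_lyndon n m \<union> y_ideal n)"
  assumes "x \<in> H" "y \<in> H"
  shows "bracket F x y \<in> H"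
proof -
  interpret F: lie_ring F unfolding F_def by (rule free_lie_lie_ring)
  have sub: "row_lyndon n m \<union> y_ideal n \<subseteq> carrier F"
    using row_lyndon_carrier subgroup.subset[OF y_ideal_subgroup] by (auto simp: F_def)
  have J: "y_ideal n \<subseteq> H" unfolding H_def by (auto intro: generate.incl)
  show ?thesis
    unfolding H_def
  proof (rule F.generate_bracket_closed[OF sub])
    fix a b assume ab: "a \<in> row_lyndon n m \<union> y_ideal n" "b \<in> row_lyndon n m \<union> y_ideal n"
    show "bracket F a b \<in> generate F (row_lyndon n m \<union> y_ideal n)"
    proof (cases "a \<in> row_lyndon n m \<and> b \<in> row_lyndon n m")
      case True
      then obtain s t where st: "s \<in> lyndon_terms {1..m}" "a = lie_eval F (y_lie n m) s"
        "t \<in> lyndon_terms {1..m}" "b = lie_eval F (y_lie n m) t"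
        by (auto simp: row_lyndon_def F_def)
      have "bracket F a b \<in> generate F (row_lyndon n m)"
        using F.bracket_generate_lyndon[of "{1..m}" "y_lie n m" s t] st y_lie_carrier
        by (simp add: row_lyndon_def F_def)
      then show ?thesis using F.mono_generate[of "row_lyndon n m"] by blast
    next
      case False
      then have "a \<in> y_ideal n \<or> b \<in> y_ideal n" using ab by blast
      then have "bracket F a b \<in> y_ideal n"
        using F.lie_ideal_bracket(1)[OF y_ideal_ideal[of n, folded F_def] subsetD[OF sub ab(1)], of b]
          F.lie_ideal_bracket(2)[OF y_ideal_ideal[of n, folded F_def] subsetD[OF sub ab(2)], of a] by fast
      then show ?thesis by (auto intro: generate.incl)
    qed
  qed (use assms in auto)
qed

text \<open>For two generators the relators give the claim. The derivation rule carries it to Lyndon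
  brackets in row \<open>m\<close>, additivity to the whole of \<open>H\<close>, and the derivation
  rule once more to Lyndon brackets in row \<open>r\<close>.\<close>

lemma row_bracket_lower:
  fixes n m
  defines "F \<equiv> free_lie (ygens n)"
  defines "H \<equiv> generate F (row_lyndon n m \<union> y_ideal n)"
  assumes mr: "2 \<le> r" "r < m" "m \<le> n" and x: "x \<in> H" and y: "y \<in> row_lyndon n r"
  shows "bracket F x y \<in> H"
proof -
  interpret F: lie_ring F unfolding F_def by (rule free_lie_lie_ring)
  have sub: "row_lyndon n m \<union> y_ideal n \<subseteq> carrier F"
    using row_lyndon_carrier subgroup.subset[OF y_ideal_subgroup] by (auto simp: F_def)
  have H: "subgroup H F" unfolding H_def by (rule F.generate_is_subgroup[OF sub])
  interpret H: subgroup H F by (rule H)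
  note ideal = y_ideal_ideal[of n, folded F_def]
  have J: "a \<in> H" if "a \<in> y_ideal n" for a unfolding H_def using that by (auto intro: generate.incl)
  have yc: "y_lie n m i \<in> carrier F" for m i unfolding F_def by (rule y_lie_carrier)
  note cl = F.lie_eval_closed[of "y_lie n m" for m, OF yc]
  have evH: "lie_eval F (y_lie n m) t \<in> H" if "t \<in> lyndon_terms {1..m}" for t
    unfolding H_def using that by (auto intro!: generate.incl simp: row_lyndon_def F_def)
  have rel: "a \<in> y_ideal n" if "a \<in> yrelators n" for a
    using that subsetD[OF lie_ring.gen_lie_ideal_incl[OF free_lie_lie_ring]] by (simp add: y_ideal_def)
  have gens: "bracket F (y_lie n m i) (y_lie n r j) \<in> H" if i: "i \<in> {1..m}" and j: "j \<in> {1..r}" for i j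
  proof -
    \<comment> \<open>The three cases are covered by the relators of kind (2), (1) and (3).\<close>
    consider "i > r" | "i \<le> r" "i = j" | "i \<le> r" "i \<noteq> j" by linarith
    then show ?thesis
    proof cases
      case 1
      then have "bracket F (y_lie n m i) (y_lie n r j) \<in> yrelators n"
        unfolding F_def by (intro yrelatorsI(2)) (use mr i j in auto)
      then show ?thesis using rel J by simp
    next
      case 2
      then have "bracket F (y_lie n m i) (y_lie n r j) \<in> yrelators n"
        unfolding F_def 2(2) by (intro yrelatorsI(1)) (use mr i j in auto)
      then show ?thesis using rel J by simp
    next
      case 3
      define B where "B = bracket F (y_lie n m i) (y_lie n m j)"
      have "bracket F (y_lie n m i) (y_lie n r j) \<otimes>\<^bsub>F\<^esub> inv\<^bsub>F\<^esub> B \<in> yrelators n"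
        unfolding F_def B_def by (intro yrelatorsI(3)) (use mr i j 3 in auto)
      then have "bracket F (y_lie n m i) (y_lie n r j) \<otimes>\<^bsub>F\<^esub> inv\<^bsub>F\<^esub> B \<in> H" using rel J by simp
      moreover have "B \<in> H"
        unfolding B_def F_def H_def
        by (rule row_bracket_closed) (use i j mr row_lyndon_y_lie in \<open>auto intro!: generate.incl\<close>)
      ultimately have "bracket F (y_lie n m i) (y_lie n r j) \<otimes>\<^bsub>F\<^esub> inv\<^bsub>F\<^esub> B \<otimes>\<^bsub>F\<^esub> B \<in> H" by (rule H.m_closed)
      then show ?thesis by (simp add: F.m_assoc F.bracket_closed yc B_def)
    qed
  qed
  have closed: "bracket F a b \<in> H" if "a \<in> H" "b \<in> H" for a b
    using that unfolding F_def H_def by (rule row_bracket_closed)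
  have lyn: "bracket F (lie_eval F (y_lie n m) t) (y_lie n r j) \<in> H" if "t \<in> lyndon_terms {1..m}" "j \<in> {1..r}" for t j
    using that(1)
  proof (induction t rule: lyndon_terms_induct)
    case (LGen i)
    then show ?case using gens that by simp
  next
    case (LBr s t)
    then have "bracket F (bracket F (lie_eval F (y_lie n m) s) (y_lie n r j)) (lie_eval F (y_lie n m) t) \<in> H"
      "bracket F (lie_eval F (y_lie n m) s) (bracket F (lie_eval F (y_lie n m) t) (y_lie n r j)) \<in> H"
      using evH by (auto intro: closed)
    then show ?case using cl yc by (simp add: F.bracket_bracket_left[of "lie_eval F (y_lie n m) s" "lie_eval F (y_lie n m) t"])
  qed
  have gen: "bracket F z (y_lie n r j) \<in> H" if "z \<in> H" "j \<in> {1..r}" for z j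
  proof (rule F.bracket_generate_left[OF that(1)[unfolded H_def] sub yc H])
    fix b assume b: "b \<in> row_lyndon n m \<union> y_ideal n"
    show "bracket F b (y_lie n r j) \<in> H"
    proof (cases "b \<in> y_ideal n")
      case True
      then show ?thesis using F.lie_ideal_bracket(2)[OF ideal yc] J by blast
    next
      case False
      then show ?thesis using b lyn that(2) by (auto simp: row_lyndon_def F_def)
    qed
  qed
  from y obtain t where t: "t \<in> lyndon_terms {1..r}" "y = lie_eval F (y_lie n r) t"
    by (auto simp: row_lyndon_def F_def)
  \<comment> \<open>\<open>z\<close> stays arbitrary because
    \<open>[z, [s, t]] = [[z, s], t] - [[z, t], s]\<close> needs the hypothesis at
    \<open>[z, s]\<close> and \<open>[z, t]\<close>.\<close>
  have "bracket F z (lie_eval F (y_lie n r) t) \<in> H" if "z \<in> H" for z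
    using t(1) that
  proof (induction t arbitrary: z rule: lyndon_terms_induct)
    case (LGen j)
    then show ?case using gen by simp
  next
    case (LBr s t)
    let ?s = "lie_eval F (y_lie n r) s" and ?t = "lie_eval F (y_lie n r) t"
    have z: "z \<in> carrier F" using LBr.prems by (rule H.mem_carrier)
    have "bracket F (bracket F z ?s) ?t \<otimes>\<^bsub>F\<^esub> inv\<^bsub>F\<^esub> (bracket F (bracket F z ?t) ?s) \<in> H"
      using LBr by (intro H.m_closed H.m_inv_closed) auto
    moreover have "bracket F (bracket F z ?s) ?t \<otimes>\<^bsub>F\<^esub> inv\<^bsub>F\<^esub> (bracket F (bracket F z ?t) ?s) = bracket F z (bracket F ?s ?t)"
      using z cl F.bracket_bracket_left[of z ?s ?t]
      by (simp add: F.bracket_closed F.m_ac F.inv_mult_cancel)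
    ultimately show ?case by simp
  qed
  then show ?thesis using t x by simp
qed

text \<open>The right-hand side contains the generators and is closed under the bracket, where
  antisymmetry puts the element of the higher row first; so an induction over Lie terms exhausts the
  ring.\<close>

lemma free_lie_row_span:
  "carrier (free_lie (ygens n)) = generate (free_lie (ygens n)) ((\<Union>m\<in>{2..n}. row_lyndon n m) \<union> y_ideal n)"
proof -
  define F where "F = free_lie (ygens n)"
  define B where "B = (\<Union>m\<in>{2..n}. row_lyndon n m) \<union> y_ideal n"
  define H where "H = generate F B"
  interpret F: lie_ring F unfolding F_def by (rule free_lie_lie_ring)
  have sub: "B \<subseteq> carrier F"
    using row_lyndon_carrier subgroup.subset[OF y_ideal_subgroup] by (auto simp: F_def B_def)
  interpret H: subgroup H F unfolding H_def by (rule F.generate_is_subgroup[OF sub])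
  have row: "generate F (row_lyndon n m \<union> y_ideal n) \<subseteq> H" if "m \<in> {2..n}" for m
    unfolding H_def by (rule F.mono_generate) (use that in \<open>auto simp: B_def\<close>)
  have incl: "a \<in> generate F (row_lyndon n m \<union> y_ideal n)" if "a \<in> row_lyndon n m" for a m
    using that by (auto intro: generate.incl)
  have le: "bracket F a b \<in> H" if ab: "a \<in> row_lyndon n m" "b \<in> row_lyndon n r" "m \<in> {2..n}" "r \<in> {2..n}" "r \<le> m" for a b m r
  proof (cases "r = m")
    case True
    then show ?thesis
      using row_bracket_closed[of a n m b] incl[OF ab(1)] incl[of b m] ab row[OF ab(3)] by (auto simp: F_def)
  next
    case False
    then show ?thesis
      using row_bracket_lower[of r m n a b] incl[OF ab(1)] ab row[OF ab(3)] by (auto simp: F_def)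
  qed
  have closed: "bracket F x y \<in> H" if "x \<in> H" "y \<in> H" for x y
    unfolding H_def
  proof (rule F.generate_bracket_closed[OF sub])
    fix a b assume ab: "a \<in> B" "b \<in> B"
    then have abc: "a \<in> carrier F" "b \<in> carrier F" using sub by auto
    have "bracket F a b \<in> H"
    proof (cases "a \<in> y_ideal n \<or> b \<in> y_ideal n")
      case True
      then have "bracket F a b \<in> y_ideal n"
        using F.lie_ideal_bracket(1)[OF y_ideal_ideal[of n, folded F_def] abc(1), of b]
          F.lie_ideal_bracket(2)[OF y_ideal_ideal[of n, folded F_def] abc(2), of a] by fast
      then show ?thesis unfolding H_def B_def by (auto intro: generate.incl)
    next
      case False
      then obtain m r where mr: "m \<in> {2..n}" "a \<in> row_lyndon n m" "r \<in> {2..n}" "b \<in> row_lyndon n r"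
        using ab by (auto simp: B_def)
      show ?thesis
      proof (cases "r \<le> m")
        case False
        then have "bracket F b a \<in> H" using le[of b r a m] mr by simp
        then show ?thesis using F.bracket_antisym[OF abc(2,1)] by simp
      qed (use le mr in blast)
    qed
    then show "bracket F a b \<in> generate F B" by (simp add: H_def)
  qed (use that in \<open>auto simp: H_def\<close>)
  have "lie_rel (ygens n) `` {t} \<in> H" if "t \<in> lie_terms (ygens n)" for t
    using that
  proof (induction t)
    case (LGen p)
    then obtain m i where p: "p = (m, i)" "(m, i) \<in> ygens n" by (cases p) auto
    then have "y_lie n m i \<in> row_lyndon n m" "m \<in> {2..n}"
      by (auto simp: ygens_def intro!: row_lyndon_y_lie)
    then have "y_lie n m i \<in> B" unfolding B_def by blast
    then have "y_lie n m i \<in> H" unfolding H_def by (rule generate.incl)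
    then show ?case using p by (simp add: y_lie_def lie_gen_def)
  next
    case LZero
    then show ?case using H.one_closed by (simp add: F_def free_lie_zero)
  next
    case (LNeg t)
    then show ?case using H.m_inv_closed[of "lie_rel (ygens n) `` {t}"] by (simp add: F_def free_lie_neg)
  next
    case (LAdd s t)
    then show ?case using H.m_closed[of "lie_rel (ygens n) `` {s}" "lie_rel (ygens n) `` {t}"]
      by (simp add: F_def free_lie_add)
  next
    case (LBr s t)
    then show ?case using closed[of "lie_rel (ygens n) `` {s}" "lie_rel (ygens n) `` {t}"]
      by (simp add: F_def free_lie_bracket)
  qed
  then have "carrier F \<subseteq> H" by (auto simp: F_def free_lie_carrier)
  then show ?thesis using H.subset by (auto simp: H_def F_def B_def)
qed

lemma free_lie_decomposition:
  assumes "x \<in> carrier (free_lie (ygens n))"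
  obtains z j where "\<And>m. m \<in> {2..n} \<Longrightarrow> z m \<in> generate (free_lie (ygens n)) (row_lyndon n m)"
    "j \<in> y_ideal n" "x = finprod (free_lie (ygens n)) z {2..n} \<otimes>\<^bsub>free_lie (ygens n)\<^esub> j"
proof -
  define F where "F = free_lie (ygens n)"
  interpret F: lie_ring F unfolding F_def by (rule free_lie_lie_ring)
  interpret J: subgroup "y_ideal n" F unfolding F_def by (rule y_ideal_subgroup)
  define Sp where "Sp m = generate F (row_lyndon n m)" for m
  have Sp: "subgroup (Sp m) F" for m
    unfolding Sp_def F_def by (rule group.generate_is_subgroup) (auto simp: F_def[symmetric] F.is_group row_lyndon_carrier[of n m, folded F_def])
  have Spc: "a \<in> carrier F" if "a \<in> Sp m" for a m using subgroup.mem_carrier[OF Sp that] .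
  define dec where "dec z j x \<longleftrightarrow> (\<forall>m\<in>{2..n}. z m \<in> Sp m) \<and> j \<in> y_ideal n \<and> x = finprod F z {2..n} \<otimes>\<^bsub>F\<^esub> j" for z j x
  define D where "D = {x. \<exists>z j. dec z j x}"
  have DI: "x \<in> D" if "\<forall>m\<in>{2..n}. z m \<in> Sp m" "j \<in> y_ideal n" "x = finprod F z {2..n} \<otimes>\<^bsub>F\<^esub> j" for z j x
    using that unfolding D_def dec_def by blast
  have single: "a \<in> D" if "m \<in> {2..n}" "a \<in> Sp m" for a m
  proof -
    have "finprod F (\<lambda>r. if m = r then a else \<one>\<^bsub>F\<^esub>) {2..n} = a"
      by (rule F.finprod_singleton) (use that Spc in auto)
    then have "a = finprod F (\<lambda>r. if m = r then a else \<one>\<^bsub>F\<^esub>) {2..n} \<otimes>\<^bsub>F\<^esub> \<one>\<^bsub>F\<^esub>" using Spc that by simp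
    moreover have "\<forall>r\<in>{2..n}. (if m = r then a else \<one>\<^bsub>F\<^esub>) \<in> Sp r"
      using that subgroup.one_closed[OF Sp] by auto
    ultimately show ?thesis using J.one_closed by (intro DI)
  qed
  have ideal: "j \<in> D" if "j \<in> y_ideal n" for j
  proof -
    have "j = finprod F (\<lambda>r. \<one>\<^bsub>F\<^esub>) {2..n} \<otimes>\<^bsub>F\<^esub> j" using that by simp
    then show ?thesis using that subgroup.one_closed[OF Sp] by (intro DI[of "\<lambda>r. \<one>\<^bsub>F\<^esub>"]) auto
  qed
  have mult: "a \<otimes>\<^bsub>F\<^esub> b \<in> D" if ab: "a \<in> D" "b \<in> D" for a b
  proof -
    obtain z j where "dec z j a" using ab(1) unfolding D_def by blast
    then have z: "\<forall>m\<in>{2..n}. z m \<in> Sp m" "j \<in> y_ideal n" "a = finprod F z {2..n} \<otimes>\<^bsub>F\<^esub> j"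
      by (simp_all add: dec_def)
    obtain y l where "dec y l b" using ab(2) unfolding D_def by blast
    then have y: "\<forall>m\<in>{2..n}. y m \<in> Sp m" "l \<in> y_ideal n" "b = finprod F y {2..n} \<otimes>\<^bsub>F\<^esub> l"
      by (simp_all add: dec_def)
    have zy: "z \<in> {2..n} \<rightarrow> carrier F" "y \<in> {2..n} \<rightarrow> carrier F" using z(1) y(1) Spc by auto
    have "a \<otimes>\<^bsub>F\<^esub> b = finprod F (\<lambda>m. z m \<otimes>\<^bsub>F\<^esub> y m) {2..n} \<otimes>\<^bsub>F\<^esub> (j \<otimes>\<^bsub>F\<^esub> l)"
      using z(2) y(2) zy by (simp add: z(3) y(3) F.finprod_multf F.m_ac)
    moreover have "\<forall>m\<in>{2..n}. z m \<otimes>\<^bsub>F\<^esub> y m \<in> Sp m" using z(1) y(1) subgroup.m_closed[OF Sp] by blast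
    ultimately show ?thesis using J.m_closed[OF z(2) y(2)] by (intro DI)
  qed
  have "x \<in> generate F ((\<Union>m\<in>{2..n}. row_lyndon n m) \<union> y_ideal n)"
    using assms free_lie_row_span by (simp add: F_def)
  then have "x \<in> D"
  proof (induction rule: generate.induct)
    case one
    then show ?case by (rule ideal[OF J.one_closed])
  next
    case (incl a)
    then consider m where "m \<in> {2..n}" "a \<in> row_lyndon n m" | "a \<in> y_ideal n" by blast
    then show ?case
    proof cases
      case 1
      then show ?thesis by (intro single[OF 1(1)]) (simp add: Sp_def generate.incl)
    qed (simp add: ideal)
  next
    case (inv a)
    then consider m where "m \<in> {2..n}" "a \<in> row_lyndon n m" | "a \<in> y_ideal n" by blast
    then show ?case
    proof cases
      case 1
      then show ?thesis by (intro single[OF 1(1)]) (simp add: Sp_def generate.inv)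
    qed (simp add: ideal)
  next
    case (eng a b)
    then show ?case using mult by blast
  qed
  then obtain z j where "dec z j x" unfolding D_def by blast
  then show ?thesis using that[of z j] by (simp add: dec_def Sp_def F_def)
qed

text \<open>The linear algebra of the faithfulness argument: \<open>u m\<close> is the component in row \<open>m\<close>, and the
  partial sum from row \<open>k\<close> on commutes with the variable \<open>k\<close>, hence involves only powers of it.\<close>

lemma row_components_zero:
  fixes u :: "nat \<Rightarrow> nat nc_series"
  assumes comm: "\<And>k. k \<in> {1..n} \<Longrightarrow>
      nc_var k * (\<Sum>m\<in>{max 2 k..n}. u m) = (\<Sum>m\<in>{max 2 k..n}. u m) * nc_var k"
    and supp: "\<And>m w. \<lbrakk>m \<in> {2..n}; nc_coeff (u m) w \<noteq> 0\<rbrakk> \<Longrightarrow> w \<noteq> [] \<and> set w \<subseteq> {1..m}"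
    and m: "m \<in> {2..n}"
  shows "u m = 0"
proof -
  define s where "s k = (\<Sum>m\<in>{max 2 k..n}. u m)" for k
  have power: "w = replicate (length w) k" if "k \<in> {1..n}" "nc_coeff (s k) w \<noteq> 0" for k w
    using commutes_nc_var[of k "s k" w] comm[OF that(1)] that(2) by (simp add: s_def)
  have nonempty: "w \<noteq> []" if "nc_coeff (s k) w \<noteq> 0" for k w
  proof -
    from that obtain m where "m \<in> {max 2 k..n}" "nc_coeff (u m) w \<noteq> 0"
      unfolding s_def nc_coeff_sum by (meson sum.not_neutral_contains_not_neutral)
    then show ?thesis using supp[of m w] by auto
  qed
  have step: "s k = u k + s (Suc k)" if "k \<in> {2..n}" for k
    using that by (simp add: s_def sum.atLeast_Suc_atMost max_def)
  have zero: "s k = 0" if k: "k \<in> {2..n}" for k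
  proof (rule nc_eqI, rule ccontr)
    fix w assume "nc_coeff (s k) w \<noteq> nc_coeff 0 w"
    then have w: "nc_coeff (s k) w \<noteq> 0" by simp
    have wk: "w = replicate (length w) k" using w k by (intro power) auto
    have ne: "w \<noteq> []" using w by (rule nonempty)
    then have in_w: "k \<in> set w" using wk by (metis in_set_replicate length_0_conv)
    \<comment> \<open>The coefficient of \<open>w\<close> survives the passage to
      \<open>s (k - 1)\<close>, because row \<open>k - 1\<close> involves only letters below
      \<open>k\<close>. For \<open>k = 2\<close> there is no row 1 to add.\<close>
    have "nc_coeff (s (k - 1)) w \<noteq> 0"
    proof (cases "k = 2")
      case True
      then have "s (k - 1) = s k" by (simp add: s_def)
      then show ?thesis using w by simp
    next
      case False
      then have k': "k - 1 \<in> {2..n}" using k by auto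
      have "nc_coeff (u (k - 1)) w = 0"
      proof (rule ccontr)
        assume "\<not> ?thesis"
        then have "set w \<subseteq> {1..k - 1}" using supp[OF k'] by blast
        then show False using in_w k by auto
      qed
      then show ?thesis using step[OF k'] w k by simp
    qed
    then have "w = replicate (length w) (k - 1)" using k by (intro power) auto
    then have "k \<in> set (replicate (length w) (k - 1))" using in_w by simp
    then show False using k by auto
  qed
  show ?thesis
  proof (cases "m = n")
    case True
    have "s (Suc n) = 0" using m True by (simp add: s_def)
    then show ?thesis using step[OF m] zero[OF m] True by simp
  next
    case False
    then show ?thesis using step[OF m] zero[OF m] zero[of "Suc m"] m by simp
  qed
qed

section \<open>Surjectivity and kernel of the map from the free Lie ring\<close>

lemma gr_class_yaut_carrier:
  "(m, i) \<in> ygens n \<Longrightarrow> gr_class (I_group n) 1 (yaut n m i) \<in> carrier (gr (I_group n))"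
  using group.gr_class_carrier[OF I_group_group] by (auto simp: lower_central_1 yaut_I_group ygens_def)

context
  fixes n :: nat and h :: "(nat \<times> nat) lie_term set \<Rightarrow> nat \<Rightarrow> (nat letter list \<Rightarrow> nat letter list) set"
  assumes h: "h \<in> lie_hom (free_lie (ygens n)) (gr (I_group n))"
    and h_gen: "\<And>m i. (m, i) \<in> ygens n \<Longrightarrow>
      h (lie_gen (ygens n) (m, i)) = gr_class (I_group n) 1 (yaut n m i)"
begin

interpretation I: group "I_group n" by (rule I_group_group)
interpretation L: lie_ring "gr (I_group n)" by (rule I.gr_lie_ring)
interpretation F: lie_ring "free_lie (ygens n)" by (rule free_lie_lie_ring)
interpretation N: lie_ring "nc_lie :: nat nc_series lie_ring" by (rule nc_lie_ring)
interpretation h: group_hom "free_lie (ygens n)" "gr (I_group n)" h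
  by unfold_locales (use h in \<open>simp add: lie_hom_def\<close>)

lemma h_bracket:
  "\<lbrakk>x \<in> carrier (free_lie (ygens n)); y \<in> carrier (free_lie (ygens n))\<rbrakk>
    \<Longrightarrow> h (bracket (free_lie (ygens n)) x y) = bracket (gr (I_group n)) (h x) (h y)"
  using h by (simp add: lie_hom_def)

lemma h_y_lie:
  "\<lbrakk>2 \<le> m; m \<le> n; 1 \<le> i; i \<le> m\<rbrakk> \<Longrightarrow> h (y_lie n m i) = gr_class (I_group n) 1 (yaut n m i)"
  using h_gen[of m i] by (simp add: y_lie_def ygens_def)

lemma h_bracket_y_lie:
  assumes "2 \<le> m" "m \<le> n" "1 \<le> i" "i \<le> m" "2 \<le> r" "r \<le> n" "1 \<le> j" "j \<le> r"
  shows "h (bracket (free_lie (ygens n)) (y_lie n m i) (y_lie n r j)) =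
    gr_class (I_group n) (1 + 1) (commutator (I_group n) (yaut n m i) (yaut n r j))"
  using I.gr_bracket_class[of "yaut n m i" 1 "yaut n r j" 1] assms
  by (simp add: h_bracket y_lie_carrier h_y_lie lower_central_1 yaut_I_group)

lemma h_surj: "h ` carrier (free_lie (ygens n)) = carrier (gr (I_group n))"
proof
  show "carrier (gr (I_group n)) \<subseteq> h ` carrier (free_lie (ygens n))"
  proof (rule gr_I_group_generated)
    show "subgroup (h ` carrier (free_lie (ygens n))) (gr (I_group n))" by (rule h.img_is_subgroup)
    show "bracket (gr (I_group n)) x y \<in> h ` carrier (free_lie (ygens n))"
      if "x \<in> h ` carrier (free_lie (ygens n))" "y \<in> h ` carrier (free_lie (ygens n))" for x y
      using that by (auto simp: h_bracket[symmetric] F.bracket_closed)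
    show "gr_class (I_group n) 1 (yaut n m i) \<in> h ` carrier (free_lie (ygens n))" if "(m, i) \<in> ygens n" for m i
      unfolding h_gen[OF that, symmetric] using lie_gen_carrier[OF that] by (rule imageI)
  qed
qed auto

lemma y_ideal_subset_kernel: "y_ideal n \<subseteq> kernel (free_lie (ygens n)) (gr (I_group n)) h"
  unfolding y_ideal_def
proof (rule F.gen_lie_ideal_minimal)
  show "lie_ideal (kernel (free_lie (ygens n)) (gr (I_group n)) h) (free_lie (ygens n))"
    by (rule lie_hom_kernel_ideal[OF free_lie_lie_ring I.gr_lie_ring h])
  have "h a = \<one>\<^bsub>gr (I_group n)\<^esub>" if "a \<in> yrelators n" for a
  proof -
    from that consider
      m r i where "a = bracket (free_lie (ygens n)) (y_lie n m i) (y_lie n r i)"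
        "2 \<le> r" "r < m" "m \<le> n" "1 \<le> i" "i \<le> r"
    | m r i j where "a = bracket (free_lie (ygens n)) (y_lie n m i) (y_lie n r j)"
        "2 \<le> r" "r < i" "i \<le> m" "m \<le> n" "1 \<le> j" "j \<le> r"
    | m r i j where "a = bracket (free_lie (ygens n)) (y_lie n m i) (y_lie n r j) \<otimes>\<^bsub>free_lie (ygens n)\<^esub>
          inv\<^bsub>free_lie (ygens n)\<^esub> (bracket (free_lie (ygens n)) (y_lie n m i) (y_lie n m j))"
        "2 \<le> r" "r < m" "m \<le> n" "1 \<le> i" "i \<le> r" "1 \<le> j" "j \<le> r"
      unfolding yrelators_eq Let_def by blast
    then show ?thesis
    proof cases
      case 1
      have "commutator (I_group n) (yaut n m i) (yaut n r i) = \<one>\<^bsub>I_group n\<^esub>"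
        using commutator_yaut_same[of r m n i i] 1 by (simp add: I.commutator_eq_one_iff yaut_I_group)
      then show ?thesis using 1 h_bracket_y_lie[of m i r i] by (simp add: I.gr_class_one)
    next
      case 2
      then show ?thesis
        using h_bracket_y_lie[of m i r j] commutator_yaut_one[of r m n i j] by (simp add: I.gr_class_one)
    next
      case 3
      have "h (bracket (free_lie (ygens n)) (y_lie n m i) (y_lie n r j)) =
          h (bracket (free_lie (ygens n)) (y_lie n m i) (y_lie n m j))"
        using 3 h_bracket_y_lie[of m i r j] h_bracket_y_lie[of m i m j] commutator_yaut_same[of r m n i j] by simp
      then show ?thesis using 3(1) by (simp add: F.bracket_closed y_lie_carrier)
    qed
  qed
  then show "yrelators n \<subseteq> kernel (free_lie (ygens n)) (gr (I_group n)) h"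
    using yrelators_carrier by (auto simp: kernel_def)
qed

text \<open>Brackets of classes are classes of commutators. This translates Lyndon elements of a row
  into the classes on which \<open>gr_magnus_lyndon\<close> computes.\<close>

lemma h_lyndon:
  assumes "2 \<le> m" "m \<le> n" "t \<in> lyndon_terms {1..m}"
  shows "h (lie_eval (free_lie (ygens n)) (y_lie n m) t) =
    gr_class (I_group n) (length (lie_word t)) (commutator_eval (I_group n) (yaut n m) t)"
  using assms(3)
proof (induction t rule: lyndon_terms_induct)
  case (LGen i)
  then show ?case using h_y_lie[of m i] assms by (simp add: One_nat_def)
next
  case (LBr s t)
  have "commutator_eval (I_group n) (yaut n m) r \<in> lower_central (I_group n) (length (lie_word r))"
    if "r \<in> lyndon_terms {1..m}" for r
    by (rule commutator_eval_lower_central[OF I.is_group _ that]) (use assms yaut_I_group in auto)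
  then show ?case
    using LBr length_lie_word_pos[OF LBr.hyps(1)] length_lie_word_pos[OF LBr.hyps(2)]
    by (simp add: h_bracket F.lie_eval_closed[OF y_lie_carrier] I.gr_bracket_class)
qed

text \<open>Modulo the ideal \<open>x\<close> is a sum of row components \<open>z m\<close>. Each of
  them turns out to be zero in the free Lie ring itself, so that \<open>x\<close> equals its ideal
  part \<open>j\<close>.\<close>

lemma kernel_subset_y_ideal: "kernel (free_lie (ygens n)) (gr (I_group n)) h \<subseteq> y_ideal n"
proof
  fix x assume "x \<in> kernel (free_lie (ygens n)) (gr (I_group n)) h"
  then have x: "x \<in> carrier (free_lie (ygens n))" and hx: "h x = \<one>\<^bsub>gr (I_group n)\<^esub>"
    by (auto simp: kernel_def)
  obtain z j where z: "\<And>m. m \<in> {2..n} \<Longrightarrow> z m \<in> generate (free_lie (ygens n)) (row_lyndon n m)"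
    and j: "j \<in> y_ideal n" and xzj: "x = finprod (free_lie (ygens n)) z {2..n} \<otimes>\<^bsub>free_lie (ygens n)\<^esub> j"
    using free_lie_decomposition[OF x] by blast
  have zc: "z m \<in> carrier (free_lie (ygens n))" if "m \<in> {2..n}" for m
    using F.generate_in_carrier[OF row_lyndon_carrier z[OF that]] .
  have jc: "j \<in> carrier (free_lie (ygens n))" and hj: "h j = \<one>\<^bsub>gr (I_group n)\<^esub>"
    using y_ideal_subset_kernel j by (auto simp: kernel_def)
  \<comment> \<open>\<open>e m\<close> evaluates row \<open>m\<close> in the power series ring: it
    sends \<open>y_lie n m i\<close> to the variable \<open>i\<close> and the generators of the
    other rows to zero.\<close>
  have "\<exists>e. e \<in> lie_hom (free_lie (ygens n)) nc_lie \<and>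
      (\<forall>p\<in>ygens n. e (lie_gen (ygens n) p) = (if fst p = m then nc_var (snd p) else 0))" for m :: nat
    using N.free_lie_universal[of "\<lambda>p. if fst p = m then nc_var (snd p) else 0" "ygens n"] by auto
  then obtain e where e: "\<And>m::nat. e m \<in> lie_hom (free_lie (ygens n)) nc_lie"
    and e_gen: "\<And>m p. p \<in> ygens n \<Longrightarrow> e m (lie_gen (ygens n) p) = (if fst p = m then nc_var (snd p) else 0)"
    by metis
  have e_hom: "group_hom (free_lie (ygens n)) nc_lie (e m)" for m
    by unfold_locales (use e[of m] in \<open>simp add: lie_hom_def\<close>)
  have e_lyndon: "e m (lie_eval (free_lie (ygens n)) (y_lie n m) t) = nc_eval t"
    if "m \<in> {2..n}" "t \<in> lyndon_terms {1..m}" for m t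
    by (rule lie_hom_lie_eval[OF free_lie_lie_ring nc_lie_ring e y_lie_carrier that(2)])
      (use that e_gen in \<open>auto simp: y_lie_def ygens_def\<close>)
  have supp: "w \<noteq> [] \<and> set w \<subseteq> {1..m}" if m: "m \<in> {2..n}" and w: "nc_coeff (e m (z m)) w \<noteq> 0" for m w
  proof -
    \<comment> \<open>Series with such supports form a subgroup, so the condition passes from the
      Lyndon elements of the row to their span.\<close>
    define K where "K = {f :: nat nc_series. \<forall>w. nc_coeff f w \<noteq> 0 \<longrightarrow> w \<noteq> [] \<and> set w \<subseteq> {1..m}}"
    have "subgroup K nc_lie"
    proof (rule N.subgroupI)
      have "0 \<in> K" by (simp add: K_def)
      then show "K \<noteq> {}" by blast
      fix f assume f: "f \<in> K"
      have "inv\<^bsub>nc_lie\<^esub> f = - f" by (rule N.inv_equality) simp_all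
      then show "inv\<^bsub>nc_lie\<^esub> f \<in> K" using f by (simp add: K_def)
      fix g assume g: "g \<in> K"
      have "w \<noteq> [] \<and> set w \<subseteq> {1..m}" if "nc_coeff f w + nc_coeff g w \<noteq> 0" for w
      proof (cases "nc_coeff f w = 0")
        case True
        then have "nc_coeff g w \<noteq> 0" using that by simp
        then show ?thesis using g by (simp add: K_def)
      qed (use f in \<open>simp add: K_def\<close>)
      then show "f \<otimes>\<^bsub>nc_lie\<^esub> g \<in> K" by (simp add: K_def)
    qed simp
    moreover have "e m ` row_lyndon n m \<subseteq> K"
    proof
      fix f assume "f \<in> e m ` row_lyndon n m"
      then obtain t where t: "t \<in> lyndon_terms {1..m}" "f = nc_eval t"
        using e_lyndon[OF m] by (auto simp: row_lyndon_def)
      then have "w \<noteq> [] \<and> set w \<subseteq> {1..m}" if "nc_coeff f w \<noteq> 0" for w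
        using nc_eval_support[of t w] that by (auto simp: lyndon_terms_def)
      then show "f \<in> K" by (simp add: K_def)
    qed
    ultimately have "e m ` generate (free_lie (ygens n)) (row_lyndon n m) \<subseteq> K"
      by (intro F.generate_hom_subset[OF e_hom] row_lyndon_carrier)
    then show ?thesis using z[OF m] w by (auto simp: K_def)
  qed
  \<comment> \<open>Both sides are additive in \<open>z m\<close>, so they need to be compared only
    on the Lyndon elements of the row.\<close>
  have magnus: "gr_magnus n k (h (z m)) = (if k \<le> m then nc_var k * e m (z m) - e m (z m) * nc_var k else 0)"
    if m: "m \<in> {2..n}" and k: "k \<in> {1..n}" for m k
  proof (rule group_hom_eq_on_generate[OF _ _ row_lyndon_carrier _ z[OF m]])
    interpret e: group_hom "free_lie (ygens n)" nc_lie "e m" by (rule e_hom)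
    show "group_hom (free_lie (ygens n)) nc_lie (\<lambda>x. gr_magnus n k (h x))"
      using hom_compose[OF h.homh group_hom.homh[OF gr_magnus_hom[OF k]]]
      by unfold_locales (simp add: comp_def)
    show "group_hom (free_lie (ygens n)) nc_lie
      (\<lambda>x. if k \<le> m then nc_var k * e m x - e m x * nc_var k else 0)"
      by unfold_locales (auto simp: hom_def e.hom_mult algebra_simps)
    fix b assume "b \<in> row_lyndon n m"
    then obtain t where t: "t \<in> lyndon_terms {1..m}" "b = lie_eval (free_lie (ygens n)) (y_lie n m) t"
      by (auto simp: row_lyndon_def)
    then show "gr_magnus n k (h b) = (if k \<le> m then nc_var k * e m b - e m b * nc_var k else 0)"
      using m k h_lyndon[of m t] gr_magnus_lyndon[of m n t k] e_lyndon[OF m t(1)] by simp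
  qed
  have comm: "nc_var k * (\<Sum>m\<in>{max 2 k..n}. e m (z m)) = (\<Sum>m\<in>{max 2 k..n}. e m (z m)) * nc_var k"
    if k: "k \<in> {1..n}" for k
  proof -
    interpret g: group_hom "gr (I_group n)" nc_lie "gr_magnus n k" using k by (rule gr_magnus_hom)
    have gh: "group_hom (free_lie (ygens n)) nc_lie (\<lambda>x. gr_magnus n k (h x))"
      using hom_compose[OF h.homh g.homh] by unfold_locales (simp add: comp_def)
    have "0 = gr_magnus n k (h x)" using g.hom_one by (simp add: hx)
    also have "\<dots> = gr_magnus n k (h (finprod (free_lie (ygens n)) z {2..n}))"
      using zc jc hj by (simp add: xzj Pi_iff)
    also have "\<dots> = (\<Sum>m\<in>{2..n}. gr_magnus n k (h (z m)))"
      by (rule hom_finprod_nc_lie[OF free_lie_lie_ring gh]) (use zc in auto)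
    also have "\<dots> = (\<Sum>m\<in>{2..n}. if k \<le> m then nc_var k * e m (z m) - e m (z m) * nc_var k else 0)"
      using magnus k by simp
    \<comment> \<open>Rows below \<open>k\<close> fix the generator \<open>k\<close> and drop out;
      \<open>max 2 k\<close> records that the rows start at 2.\<close>
    also have "\<dots> = (\<Sum>m\<in>{max 2 k..n}. nc_var k * e m (z m) - e m (z m) * nc_var k)"
      by (rule sum.mono_neutral_cong_right) auto
    finally show ?thesis by (simp add: sum_subtractf sum_distrib_left sum_distrib_right)
  qed
  have "z m = \<one>\<^bsub>free_lie (ygens n)\<^esub>" if m: "m \<in> {2..n}" for m
  proof (rule lyndon_span_injective[OF free_lie_lie_ring e_hom y_lie_carrier e_lyndon[OF m]])
    show "z m \<in> generate (free_lie (ygens n)) (lie_eval (free_lie (ygens n)) (y_lie n m) ` lyndon_terms {1..m})"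
      using z[OF m] by (simp add: row_lyndon_def)
    show "e m (z m) = 0" by (rule row_components_zero[OF comm supp m])
  qed
  then have "finprod (free_lie (ygens n)) z {2..n} = \<one>\<^bsub>free_lie (ygens n)\<^esub>" by (intro F.finprod_one_eqI)
  then show "x \<in> y_ideal n" using j jc by (simp add: xzj)
qed

end

theorem corollary6:
  fixes n :: nat
  assumes "n \<ge> 3"
  shows "lie_presentation (gr (I_group n)) (ygens n)
           (\<lambda>(i, j). gr_class (I_group n) 1 (yaut n i j)) (yrelators n)"
proof -
  interpret L: lie_ring "gr (I_group n)" by (rule group.gr_lie_ring[OF I_group_group])
  have g: "(\<lambda>(i, j). gr_class (I_group n) 1 (yaut n i j)) \<in> ygens n \<rightarrow> carrier (gr (I_group n))"
    using gr_class_yaut_carrier by auto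
  then obtain h where h: "h \<in> lie_hom (free_lie (ygens n)) (gr (I_group n))"
    and h_gen: "\<forall>p\<in>ygens n. h (lie_gen (ygens n) p) = (\<lambda>(i, j). gr_class (I_group n) 1 (yaut n i j)) p"
    using L.free_lie_universal by blast
  have h_gen': "h (lie_gen (ygens n) (m, i)) = gr_class (I_group n) 1 (yaut n m i)" if "(m, i) \<in> ygens n" for m i
    using h_gen that by auto
  have "kernel (free_lie (ygens n)) (gr (I_group n)) h = gen_lie_ideal (free_lie (ygens n)) (yrelators n)"
    using kernel_subset_y_ideal[OF h h_gen'] y_ideal_subset_kernel[OF h h_gen'] by (simp add: y_ideal_def)
  with h h_gen h_surj[OF h h_gen'] have "\<exists>h\<in>lie_hom (free_lie (ygens n)) (gr (I_group n)).
     (\<forall>p\<in>ygens n. h (lie_gen (ygens n) p) = (\<lambda>(i, j). gr_class (I_group n) 1 (yaut n i j)) p) \<and>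
     h ` carrier (free_lie (ygens n)) = carrier (gr (I_group n)) \<and>
     kernel (free_lie (ygens n)) (gr (I_group n)) h = gen_lie_ideal (free_lie (ygens n)) (yrelators n)"
    by (intro bexI[of _ h] conjI)
  with L.lie_ring_axioms g yrelators_carrier show ?thesis
    unfolding lie_presentation_def by (intro conjI)
qed

end
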